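(* Let $d,k\ge 1$, let $\Omega\subseteq\mathbb{R}^d$ be a compact convex set, and let $\mu_1,\dots,\mu_k$ be probability measures on $\Omega$. Suppose that $0\in\Omega^k$ and that $L:\mathbb{R}^{kd}\to\mathbb{R}$ is $\alpha$-semi-convex: $\alpha\ge 0$ is a constant such that $x\mapsto L(x)+\alpha\frac{|x|^2}{2}$ is convex on $\mathbb{R}^{kd}$. Then $$\min_{\gamma\in\Pi(\mu_1,\dots,\mu_k)}\int_{\Omega^k}L\,d\gamma=\min_{(\pi,m)\in\mathcal{C}(\delta_0,\mu_1,\dots,\mu_k)}\int_0^1\int_{\Omega^k}\left[L\!\left(\frac{dm(t,x)}{d\pi(t,x)}\right)+\frac{\alpha}{2}\left|\frac{dm(t,x)}{d\pi(t,x)}\right|^2\right]d\pi(t,x)\,dt-\frac{\alpha}{2}\sum_{l=1}^k\int_\Omega|x_l|^2\,d\mu_l(x_l),$$ and the minimum on both sides is attained. Further: (1) For any minimizer $\gamma_{\mathrm{opt}}\in\Pi(\mu_1,\dots,\mu_k)$ of the left-hand side there is a flow $(\pi_{\mathrm{opt}},m_{\mathrm{opt}})\in\mathcal{C}(\delta_0,\mu_1,\dots,\mu_k)$ (induced by $\gamma_{\mathrm{opt}}$) which is a minimizer of the right-hand side and satisfies $\pi_{\mathrm{opt}}(1,\cdot)=\gamma_{\mathrm{opt}}$. (2) For any minimizer $(\pi_{\mathrm{opt}},m_{\mathrm{opt}})\in\mathcal{C}(\delta_0,\mu_1,\dots,\mu_k)$ of the right-hand side, $\pi_{\mathrm{opt}}(1,\cdot)$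 is a minimizer of the left-hand side.
   Context: Identify $(\mathbb{R}^d)^k\cong\mathbb{R}^{kd}$ and write $x=(x_1,\dots,x_k)$ with $x_l\in\mathbb{R}^d$; $[k]=\{1,\dots,k\}$; $|\cdot|$ is the Euclidean norm. $\Pi(\mu_1,\dots,\mu_k)$ is the set of probability measures on $\Omega^k$ whose respective marginals on the $k$ factors are $\mu_1,\dots,\mu_k$. $\mathcal{P}(\Omega^k)$ is the set of probability measures on $\Omega^k$ with the weak convergence topology, $C([0,1];\mathcal{P}(\Omega^k))$ is the set of continuous maps $[0,1]\to\mathcal{P}(\Omega^k)$, and $\mathcal{M}([0,1]\times\Omega^k;\mathbb{R}^{kd})$ is the set of $\mathbb{R}^{kd}$-valued measures on $[0,1]\times\Omega^k$. Such vector measures are understood to be of the form $dm(t,x)\,dt$, with $m(t,\cdot)$ an $\mathbb{R}^{kd}$-valued measure on $\Omega^k$. For a probability measure $p$ on $\Omega^k$ (here $p=\delta_0$), the set $\mathcal{C}(p,\mu_1,\dots,\mu_k)$ consists of all pairs $(\pi,m)\in C([0,1];\mathcal{P}(\Omega^k))\times\mathcal{M}([0,1]\times\Omega^k;\mathbb{R}^{kd})$ such that: - $m\ll\pi$, meaning that $m(t,\cdot)$ is absolutely continuous with respect to $\pi(t,\cdot)$ for all $t\in[0,1]$; - $\int_0^1\int_{\Omega^k}\left|\frac{dm(t,x)}{d\pi(t,x)}\right|^{r}d\pi(t,x)\,dt<+\infty$ for some exponent $r>1$; - $\partial_t\pi+\nabla\cdot m=0$ in the weak sense: for every continuously differentiable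 $\eta\in C^1([0,1]\times\Omega^k;\mathbb{R})$, $$\int_0^1\!\int_{\Omega^k}\partial_t\eta\,d\pi(t,x)\,dt+\int_0^1\!\int_{\Omega^k}\langle\nabla\eta(t,x),dm(t,x)\rangle\,dt=\int_{\Omega^k}\eta(1,x)\,d\pi(1,x)-\int_{\Omega^k}\eta(0,x)\,d\pi(0,x);$$ - $\pi(0,\cdot)=p$ and, for all $l\in[k]$, the $l$-th marginal $\pi_l(1,\cdot)$ of $\pi(1,\cdot)$ equals $\mu_l$. *)

theory Defs
  imports "HOL-Probability.Probability"
begin

abbreviation borel_on :: "'a::topological_space set \<Rightarrow> 'a measure" where
  "borel_on S \<equiv> restrict_space borel S"

definition prob_measures :: "'a::topological_space set \<Rightarrow> 'a measure set" where
  "prob_measures S = {M. prob_space M \<and> sets M = sets (borel_on S)}"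

text \<open>The coarsest topology making all integrals of bounded continuous functions continuous.\<close>

definition weak_topology :: "'a::topological_space set \<Rightarrow> 'a measure topology" where
  "weak_topology S = topology_generated_by
     {{M \<in> prob_measures S. (\<integral>x. f x \<partial>M) \<in> U} | (f :: 'a \<Rightarrow> real) U.
        continuous_on S f \<and> bounded (f ` S) \<and> open U}"

definition set_power :: "'a set \<Rightarrow> ('a ^ 'k) set" where
  "set_power \<Omega> = {x. \<forall>l. x $ l \<in> \<Omega>}"

definition marginal ::
  "(real ^ 'd) set \<Rightarrow> 'k \<Rightarrow> (real ^ 'd ^ 'k) measure \<Rightarrow> (real ^ 'd) measure" where
  "marginal \<Omega> l \<gamma> = distr \<gamma> (borel_on \<Omega>) (\<lambda>x. x $ l)"

definition couplings ::
  "(real ^ 'd) set \<Rightarrow> ('k \<Rightarrow> (real ^ 'd) measure) \<Rightarrow> (real ^ 'd ^ 'k) measure set" where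
  "couplings \<Omega> \<mu> = {\<gamma> \<in> prob_measures (set_power \<Omega>). \<forall>l. marginal \<Omega> l \<gamma> = \<mu> l}"

text \<open>
  A vector measure is a countably additive set function on the measurable sets of \<open>M\<close>;
  the measure of \<open>M\<close> itself plays no role.
\<close>

definition vector_measure :: "'a measure \<Rightarrow> ('a set \<Rightarrow> 'b::real_normed_vector) \<Rightarrow> bool" where
  "vector_measure M \<nu> \<longleftrightarrow> \<nu> {} = 0 \<and>
     (\<forall>A. range A \<subseteq> sets M \<longrightarrow> disjoint_family A \<longrightarrow>
        (\<lambda>n::nat. \<nu> (A n)) sums \<nu> (\<Union>n. A n))"

definition vector_abs_cont :: "'a measure \<Rightarrow> ('a set \<Rightarrow> 'b::real_normed_vector) \<Rightarrow> bool" where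
  "vector_abs_cont \<rho> \<nu> \<longleftrightarrow> (\<forall>A\<in>null_sets \<rho>. \<nu> A = 0)"

text \<open>
  The Radon--Nikodym derivative of a vector measure. For finite \<open>\<rho>\<close>, finite-dimensional
  values and absolutely continuous \<open>\<nu>\<close> it exists and is unique up to \<open>\<rho>\<close>-null sets.
\<close>

definition vector_RN_deriv ::
  "'a measure \<Rightarrow> ('a set \<Rightarrow> 'b) \<Rightarrow> 'a \<Rightarrow> 'b::{banach, second_countable_topology}" where
  "vector_RN_deriv \<rho> \<nu> = (SOME f. integrable \<rho> f \<and>
     (\<forall>A\<in>sets \<rho>. \<nu> A = set_lebesgue_integral \<rho> A f))"

text \<open>
  The integral of \<open>\<langle>g, d\<nu>\<rangle>\<close> for a vector measure \<open>\<nu>\<close> that is absolutely continuous with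
  respect to the finite measure \<open>\<rho>\<close>; the value does not depend on the choice of \<open>\<rho>\<close>.
\<close>

definition vector_integral ::
  "'a measure \<Rightarrow> ('a set \<Rightarrow> 'b) \<Rightarrow> ('a \<Rightarrow> 'b::euclidean_space) \<Rightarrow> real" where
  "vector_integral \<rho> \<nu> g = (\<integral>x. g x \<bullet> vector_RN_deriv \<rho> \<nu> x \<partial>\<rho>)"

text \<open>
  Vector measures of the form \<open>dm(t,x) dt\<close> on \<open>[0,1] \<times> S\<close>, represented by the
  family of slices \<open>m t\<close>; here \<open>N\<close> is the resulting measure on the product.
\<close>

definition sliced_vector_measures :: "'a::euclidean_space set \<Rightarrow> (real \<Rightarrow> 'a set \<Rightarrow> 'a) set" where
  "sliced_vector_measures S = {m.
     (\<forall>t\<in>{0..1}. vector_measure (borel_on S) (m t)) \<and>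
     (\<exists>N. vector_measure (borel_on ({0..1} \<times> S)) N \<and>
        (\<forall>B\<in>sets (borel_on ({0..1} \<times> S)).
           set_integrable lebesgue {0..1} (\<lambda>t. m t (Pair t -` B)) \<and>
           N B = (LINT t:{0..1}|lebesgue. m t (Pair t -` B))))}"

text \<open>
  \<open>C1_test S \<eta> \<eta>t g\<close>: \<open>\<eta>\<close> is continuously differentiable on \<open>[0,1] \<times> S\<close>
  with time derivative \<open>\<eta>t\<close> and spatial gradient \<open>g\<close>. Derivatives are taken relative to
  \<open>[0,1] \<times> S\<close>. If \<open>S\<close> is convex with nonempty interior they are determined by \<open>\<eta>\<close>; if \<open>S\<close>
  lies in a proper affine subspace, every continuous choice of the normal component of \<open>g\<close>
  is admitted.
\<close>

definition C1_test :: "'a::euclidean_space set \<Rightarrow> (real \<Rightarrow> 'a \<Rightarrow> real) \<Rightarrow>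
    (real \<Rightarrow> 'a \<Rightarrow> real) \<Rightarrow> (real \<Rightarrow> 'a \<Rightarrow> 'a) \<Rightarrow> bool" where
  "C1_test S \<eta> \<eta>t g \<longleftrightarrow>
     continuous_on ({0..1} \<times> S) (\<lambda>(t, x). \<eta>t t x) \<and>
     continuous_on ({0..1} \<times> S) (\<lambda>(t, x). g t x) \<and>
     (\<forall>t\<in>{0..1}. \<forall>x\<in>S.
        ((\<lambda>(s, y). \<eta> s y) has_derivative (\<lambda>(s, y). s * \<eta>t t x + g t x \<bullet> y))
          (at (t, x) within {0..1} \<times> S))"

definition continuity_equation ::
  "'a::euclidean_space set \<Rightarrow> (real \<Rightarrow> 'a measure) \<Rightarrow> (real \<Rightarrow> 'a set \<Rightarrow> 'a) \<Rightarrow> bool" where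
  "continuity_equation S \<pi> m \<longleftrightarrow> (\<forall>\<eta> \<eta>t g. C1_test S \<eta> \<eta>t g \<longrightarrow>
     (LINT t:{0..1}|lebesgue. (\<integral>x. \<eta>t t x \<partial>\<pi> t)) +
     (LINT t:{0..1}|lebesgue. vector_integral (\<pi> t) (m t) (g t)) =
     (\<integral>x. \<eta> 1 x \<partial>\<pi> 1) - (\<integral>x. \<eta> 0 x \<partial>\<pi> 0))"

definition flows :: "(real ^ 'd) set \<Rightarrow> (real ^ 'd ^ 'k) measure \<Rightarrow>
    ('k \<Rightarrow> (real ^ 'd) measure) \<Rightarrow>
    ((real \<Rightarrow> (real ^ 'd ^ 'k) measure) \<times>
     (real \<Rightarrow> (real ^ 'd ^ 'k) set \<Rightarrow> real ^ 'd ^ 'k)) set" where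
  "flows \<Omega> p \<mu> = {(\<pi>, m).
     continuous_map (top_of_set {0..1}) (weak_topology (set_power \<Omega>)) \<pi> \<and>
     m \<in> sliced_vector_measures (set_power \<Omega>) \<and>
     (\<forall>t\<in>{0..1}. vector_abs_cont (\<pi> t) (m t)) \<and>
     (\<exists>r>1. (\<integral>\<^sup>+t\<in>{0..1}. (\<integral>\<^sup>+x. ennreal
        (norm (vector_RN_deriv (\<pi> t) (m t) x) powr r) \<partial>\<pi> t) \<partial>lebesgue) < \<infinity>) \<and>
     continuity_equation (set_power \<Omega>) \<pi> m \<and>
     \<pi> 0 = p \<and>
     (\<forall>l. marginal \<Omega> l (\<pi> 1) = \<mu> l)}"

text \<open>
  The integral of \<open>F (dm/d\<pi>)\<close> with respect to \<open>d\<pi>(t,x) dt\<close>, as the difference of the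
  integrals of the positive and the negative part, since it may be \<open>+\<infinity>\<close> (for convex \<open>F\<close>
  the negative part has finite integral on \<open>flows\<close>).
\<close>

definition action :: "('a::euclidean_space \<Rightarrow> real) \<Rightarrow>
    (real \<Rightarrow> 'a measure) \<times> (real \<Rightarrow> 'a set \<Rightarrow> 'a) \<Rightarrow> ereal" where
  "action F = (\<lambda>(\<pi>, m).
     enn2ereal (\<integral>\<^sup>+t\<in>{0..1}. (\<integral>\<^sup>+x. ennreal (F (vector_RN_deriv (\<pi> t) (m t) x)) \<partial>\<pi> t) \<partial>lebesgue) -
     enn2ereal (\<integral>\<^sup>+t\<in>{0..1}. (\<integral>\<^sup>+x. ennreal (- F (vector_RN_deriv (\<pi> t) (m t) x)) \<partial>\<pi> t) \<partial>lebesgue))"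

definition static_cost :: "('a \<Rightarrow> real) \<Rightarrow> 'a measure \<Rightarrow> real" where
  "static_cost L \<gamma> = (\<integral>x. L x \<partial>\<gamma>)"

definition dynamic_cost :: "real \<Rightarrow> (real ^ 'd ^ 'k \<Rightarrow> real) \<Rightarrow> ('k \<Rightarrow> (real ^ 'd) measure) \<Rightarrow>
    (real \<Rightarrow> (real ^ 'd ^ 'k) measure) \<times>
    (real \<Rightarrow> (real ^ 'd ^ 'k) set \<Rightarrow> real ^ 'd ^ 'k) \<Rightarrow> ereal" where
  "dynamic_cost \<alpha> L \<mu> q = action (\<lambda>v. L v + \<alpha> / 2 * (norm v)\<^sup>2) q -
     ereal (\<alpha> / 2 * (\<Sum>l\<in>UNIV. \<integral>x. (norm x)\<^sup>2 \<partial>\<mu> l))"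

text \<open>
  The flow from \<open>\<delta>\<^sub>0\<close> induced by \<open>\<gamma>\<close>: mass moves from \<open>0\<close> to \<open>x\<close> along \<open>t \<mapsto> tx\<close>
  with velocity \<open>x\<close>, so \<open>\<pi> t\<close> and \<open>m t\<close> are the push-forwards under \<open>x \<mapsto> tx\<close> of
  \<open>\<gamma>\<close> and \<open>x d\<gamma>(x)\<close>.
\<close>

definition induced_flow :: "'a::euclidean_space set \<Rightarrow> 'a measure \<Rightarrow>
    (real \<Rightarrow> 'a measure) \<times> (real \<Rightarrow> 'a set \<Rightarrow> 'a) \<Rightarrow> bool" where
  "induced_flow S \<gamma> = (\<lambda>(\<pi>, m). \<forall>t\<in>{0..1}.
     \<pi> t = distr \<gamma> (borel_on S) (\<lambda>x. t *\<^sub>R x) \<and>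
     (\<forall>A\<in>sets (borel_on S). m t A = (\<integral>x. indicator A (t *\<^sub>R x) *\<^sub>R x \<partial>\<gamma>)))"

end

theory Submission
  imports Defs
begin

text \<open>
  On couplings the quadratic term integrates to a constant, so the claim is about the convex
  function \<open>F v = L v + \<alpha> / 2 * |v|\<^sup>2\<close>. Moving mass from \<open>0\<close> to \<open>x\<close> along straight lines gives
  a flow of action \<open>\<integral> F d\<gamma>\<close>. Conversely, \<open>\<integral> F d\<pi>(1)\<close> is a lower bound for the action of every flow
  \<open>(\<pi>, m)\<close>: if \<open>G \<le> F\<close> is smooth and convex, then \<open>\<eta>(t,x) = (t + \<epsilon>) G(x / (t + \<epsilon>))\<close> is a test
  function with \<open>\<partial>\<^sub>t\<eta> + \<nabla>\<eta> \<bullet> v \<le> G(v) \<le> F(v)\<close>, and one lets \<open>\<epsilon> \<rightarrow> 0\<close> and \<open>G \<rightarrow> F\<close>. Minimisers of the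
  static problem exist since couplings are weakly compact, which is reduced to Helly's selection
  theorem on the real line through a space-filling curve with a Borel section.
\<close>

section \<open>Densities of vector measures\<close>

text \<open>The velocity \<open>dm/d\<pi>\<close> is chosen slice by slice, so nothing is known
  about its joint measurability in \<open>(t,x)\<close>. The inner integrals in
  \<open>action\<close> need not be measurable in \<open>t\<close>, and the outer ones act as lower
  integrals, which are not additive. The lower bound therefore compares them with the integral over
  \<open>x\<close> of \<open>\<partial>\<^sub>t\<eta> + \<nabla>\<eta> \<bullet> v\<close>, by
  inequalities that survive for lower integrals. As a function of \<open>t\<close> that integral
  must itself be shown integrable, because a Bochner integral otherwise defaults to 0: measurability
  comes from the slice condition on \<open>m\<close>, the bound from the energy with exponent
  \<open>r > 1\<close>. The perspective function is suggested by the straight-line flow: mass found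
  at \<open>x\<close> at time \<open>t\<close> has velocity \<open>x / t\<close>, and comparing
  \<open>F(v)\<close> with the test function amounts to the tangent inequality of \<open>G\<close>
  at \<open>x / t\<close>. Test functions must be \<open>C1\<close> while \<open>F\<close> is merely
  convex, hence the smoothing. Closeness of \<open>G\<close> to \<open>F\<close> is needed only on
  the compact set, but \<open>G \<le> F\<close> everywhere, since velocities are not confined to
  that set.\<close>

lemma vector_measure_Un:
  assumes "vector_measure M \<nu>" "A \<in> sets M" "B \<in> sets M" "A \<inter> B = {}"
  shows "\<nu> (A \<union> B) = \<nu> A + \<nu> B"
proof -
  have "range (binaryset A B) \<subseteq> sets M" "disjoint_family (binaryset A B)"
    using assms(2-4) by (auto simp: range_binaryset_eq disjoint_family_on_def binaryset_def)
  then have "(\<lambda>n. \<nu> (binaryset A B n)) sums \<nu> (\<Union>n. binaryset A B n)"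
    using assms(1) unfolding vector_measure_def by blast
  moreover have "(\<lambda>n. \<nu> (binaryset A B n)) sums (\<nu> A + \<nu> B)"
    using sums_finite[of "{..<2}" "\<lambda>n. \<nu> (binaryset A B n)"] assms(1)
    by (auto simp: binaryset_def vector_measure_def numeral_2_eq_2)
  ultimately show ?thesis
    by (simp add: UN_binaryset_eq sums_iff)
qed

lemma vector_measure_Diff:
  assumes "vector_measure M \<nu>" "A \<in> sets M" "B \<in> sets M" "B \<subseteq> A"
  shows "\<nu> (A - B) = \<nu> A - \<nu> B"
  using vector_measure_Un[OF assms(1) assms(3), of "A - B"] assms
  by (auto simp: Un_absorb1)

lemma vector_measure_incseq_limit:
  assumes "vector_measure M \<nu>" "range A \<subseteq> sets M" "incseq A"
  shows "(\<lambda>n. \<nu> (A n)) \<longlonglongrightarrow> \<nu> (\<Union>n. A n)"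
proof -
  have D: "range (disjointed A) \<subseteq> sets M"
    using assms(2) by (rule sets.range_disjointed_sets)
  have "(\<lambda>n. \<nu> (disjointed A n)) sums \<nu> (\<Union>n. A n)"
    using assms(1) D disjoint_family_disjointed[of A] UN_disjointed_eq[of A]
    unfolding vector_measure_def by metis
  moreover have "(\<Sum>i<Suc n. \<nu> (disjointed A i)) = \<nu> (A n)" for n
  proof (induction n)
    case (Suc n)
    have "\<nu> (A (Suc n) - A n) = \<nu> (A (Suc n)) - \<nu> (A n)"
      using assms by (intro vector_measure_Diff[of M]) (auto simp: incseq_SucD)
    with Suc show ?case
      by (simp add: disjointed_mono[OF assms(3)])
  qed (simp add: disjointed_def)
  ultimately show ?thesis
    unfolding sums_def by (subst (asm) filterlim_sequentially_Suc[symmetric]) simp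
qed

lemma vector_measure_decseq_limit:
  assumes "vector_measure M \<nu>" "range B \<subseteq> sets M" "decseq B"
  shows "(\<lambda>n. \<nu> (B n)) \<longlonglongrightarrow> \<nu> (\<Inter>n. B n)"
proof -
  have B: "B n \<in> sets M" "B n \<subseteq> B 0" for n
    using assms(2,3) by (auto dest: decseqD)
  have "(\<lambda>n. \<nu> (B 0 - B n)) \<longlonglongrightarrow> \<nu> (\<Union>n. B 0 - B n)"
    using assms B by (intro vector_measure_incseq_limit[of M]) (auto simp: decseq_def incseq_def)
  also have "(\<Union>n. B 0 - B n) = B 0 - (\<Inter>n. B n)" by auto
  also have "\<nu> \<dots> = \<nu> (B 0) - \<nu> (\<Inter>n. B n)"
    using assms B by (intro vector_measure_Diff[of M]) auto
  finally have "(\<lambda>n. \<nu> (B 0) - \<nu> (B n)) \<longlonglongrightarrow> \<nu> (B 0) - \<nu> (\<Inter>n. B n)"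
    using assms B by (simp add: vector_measure_Diff[of M])
  from tendsto_diff[OF tendsto_const[of "\<nu> (B 0)"] this] show ?thesis by simp
qed

section \<open>Jordan decomposition and Radon-Nikodym derivatives of signed and vector
  measures\<close>

definition upper_variation :: "'a measure \<Rightarrow> ('a set \<Rightarrow> real) \<Rightarrow> 'a set \<Rightarrow> ennreal" where
  "upper_variation M \<nu> A = (SUP B\<in>{B \<in> sets M. B \<subseteq> A}. ennreal (\<nu> B))"

lemma upper_variation_upper:
  "B \<in> sets M \<Longrightarrow> B \<subseteq> A \<Longrightarrow> ennreal (\<nu> B) \<le> upper_variation M \<nu> A"
  unfolding upper_variation_def by (rule SUP_upper) auto

lemma upper_variation_mono:
  "A \<subseteq> A' \<Longrightarrow> upper_variation M \<nu> A \<le> upper_variation M \<nu> A'"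
  unfolding upper_variation_def by (rule SUP_subset_mono) auto

lemma upper_variation_empty [simp]: "vector_measure M \<nu> \<Longrightarrow> upper_variation M \<nu> {} = 0"
  by (auto simp: upper_variation_def vector_measure_def image_constant_conv)

lemma upper_variation_superadd:
  assumes \<nu>: "vector_measure M \<nu>" and "A1 \<inter> A2 = {}"
  shows "upper_variation M \<nu> A1 + upper_variation M \<nu> A2 \<le> upper_variation M \<nu> (A1 \<union> A2)"
proof -
  have ne: "{B \<in> sets M. B \<subseteq> A} \<noteq> {}" for A by auto
  have "ennreal (\<nu> B1) + ennreal (\<nu> B2) \<le> upper_variation M \<nu> (A1 \<union> A2)"
    if B: "B1 \<in> sets M" "B1 \<subseteq> A1" "B2 \<in> sets M" "B2 \<subseteq> A2" for B1 B2
  proof -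
    have "\<nu> (B1 \<union> B2) = \<nu> B1 + \<nu> B2"
      using B assms(2) by (intro vector_measure_Un[OF \<nu>]) auto
    \<comment> \<open>If a value is negative it is truncated to 0 and the other set alone competes;
      the union competes when both are nonnegative.\<close>
    moreover have "ennreal (\<nu> B1) \<le> upper_variation M \<nu> (A1 \<union> A2)"
      "ennreal (\<nu> B2) \<le> upper_variation M \<nu> (A1 \<union> A2)"
      "ennreal (\<nu> (B1 \<union> B2)) \<le> upper_variation M \<nu> (A1 \<union> A2)"
      using B by (auto intro!: upper_variation_upper)
    ultimately show ?thesis
      by (cases "\<nu> B1 \<ge> 0"; cases "\<nu> B2 \<ge> 0") (auto simp: ennreal_neg simp flip: ennreal_plus)
  qed
  then have "ennreal (\<nu> B1) + upper_variation M \<nu> A2 \<le> upper_variation M \<nu> (A1 \<union> A2)"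
    if "B1 \<in> sets M" "B1 \<subseteq> A1" for B1
    unfolding upper_variation_def[of M \<nu> A2] using that
    by (subst ennreal_SUP_add_right[OF ne]) (auto intro!: SUP_least)
  then show ?thesis
    unfolding upper_variation_def[of M \<nu> A1]
    by (subst ennreal_SUP_add_left[OF ne, symmetric]) (auto intro!: SUP_least)
qed

text \<open>Superadditivity on finite unions and monotonicity give one inequality. For the other, a
  competitor \<open>B\<close> is cut along the sets \<open>A i\<close>; truncation makes
  \<open>ennreal\<close> only subadditive on reals, which is the direction required.\<close>

lemma upper_variation_countably_additive:
  assumes \<nu>: "vector_measure M \<nu>"
  shows "countably_additive (sets M) (upper_variation M \<nu>)"
proof (rule countably_additiveI)
  fix A :: "nat \<Rightarrow> 'a set"
  assume A: "range A \<subseteq> sets M" "disjoint_family A"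
  have "(\<Sum>i<n. upper_variation M \<nu> (A i)) \<le> upper_variation M \<nu> (\<Union>i<n. A i)" for n
  proof (induction n)
    case (Suc n)
    have "A n \<inter> (\<Union>i<n. A i) = {}"
    proof -
      have "A n \<inter> A i = {}" if "i < n" for i
        using A(2) that by (intro disjoint_family_onD[of A UNIV]) auto
      then show ?thesis by blast
    qed
    have "(\<Sum>i<Suc n. upper_variation M \<nu> (A i)) \<le>
        upper_variation M \<nu> (A n) + upper_variation M \<nu> (\<Union>i<n. A i)"
      using Suc by (simp add: add.commute add_mono)
    also have "\<dots> \<le> upper_variation M \<nu> (A n \<union> (\<Union>i<n. A i))"
      by (rule upper_variation_superadd[OF \<nu>]) fact
    also have "A n \<union> (\<Union>i<n. A i) = (\<Union>i<Suc n. A i)" by (simp add: lessThan_Suc)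
    finally show ?case .
  qed (simp add: \<nu>)
  then have "(\<Sum>i<n. upper_variation M \<nu> (A i)) \<le> upper_variation M \<nu> (\<Union>i. A i)" for n
    by (rule order_trans) (auto intro!: upper_variation_mono)
  then have le: "(\<Sum>i. upper_variation M \<nu> (A i)) \<le> upper_variation M \<nu> (\<Union>i. A i)"
    by (intro suminf_le_const) auto
  have "ennreal (\<nu> B) \<le> (\<Sum>i. upper_variation M \<nu> (A i))" if B: "B \<in> sets M" "B \<subseteq> (\<Union>i. A i)" for B
  proof -
    have "(\<lambda>i. \<nu> (B \<inter> A i)) sums \<nu> (\<Union>i. B \<inter> A i)"
    proof -
      have "range (\<lambda>i. B \<inter> A i) \<subseteq> sets M" "disjoint_family (\<lambda>i. B \<inter> A i)"
        using A B by (auto simp: disjoint_family_on_def)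
      then show ?thesis using \<nu> unfolding vector_measure_def by blast
    qed
    also have "(\<Union>i. B \<inter> A i) = B" using B by auto
    finally have s: "(\<lambda>n. \<Sum>i<n. \<nu> (B \<inter> A i)) \<longlonglongrightarrow> \<nu> B" by (simp add: sums_def)
    have "ennreal (\<Sum>i<n. \<nu> (B \<inter> A i)) \<le> (\<Sum>i. upper_variation M \<nu> (A i))" for n
    proof -
      have "ennreal (\<Sum>i<n. \<nu> (B \<inter> A i)) \<le> (\<Sum>i<n. ennreal (\<nu> (B \<inter> A i)))"
      proof (induction n)
        case (Suc n)
        have "ennreal (a + b) \<le> ennreal a + ennreal b" for a b
          by (cases "a \<ge> 0"; cases "b \<ge> 0")
            (auto simp: ennreal_neg simp flip: ennreal_plus intro!: ennreal_leI)
        then have "ennreal (\<Sum>i<Suc n. \<nu> (B \<inter> A i)) \<le>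
            ennreal (\<Sum>i<n. \<nu> (B \<inter> A i)) + ennreal (\<nu> (B \<inter> A n))"
          by simp
        also have "\<dots> \<le> (\<Sum>i<n. ennreal (\<nu> (B \<inter> A i))) + ennreal (\<nu> (B \<inter> A n))"
          by (intro add_mono Suc order_refl)
        finally show ?case by simp
      qed simp
      also have "\<dots> \<le> (\<Sum>i<n. upper_variation M \<nu> (A i))"
        using A B by (intro sum_mono upper_variation_upper) auto
      also have "\<dots> \<le> (\<Sum>i. upper_variation M \<nu> (A i))" by (intro sum_le_suminf) auto
      finally show ?thesis .
    qed
    with s show ?thesis
      by (intro Lim_bounded[OF tendsto_ennrealI[OF s]]) auto
  qed
  then have "upper_variation M \<nu> (\<Union>i. A i) \<le> (\<Sum>i. upper_variation M \<nu> (A i))"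
    unfolding upper_variation_def[of M \<nu> "\<Union>i. A i"] by (auto intro!: SUP_least)
  with le show "(\<Sum>i. upper_variation M \<nu> (A i)) = upper_variation M \<nu> (\<Union>i. A i)"
    by (rule antisym)
qed

lemma upper_variation_add:
  assumes "vector_measure M \<nu>" "A \<in> sets M" "B \<in> sets M" "A \<inter> B = {}"
  shows "upper_variation M \<nu> (A \<union> B) = upper_variation M \<nu> A + upper_variation M \<nu> B"
  using sets.countably_additive_additive[OF _ upper_variation_countably_additive[OF assms(1)]] assms
  by (auto simp: additive_def positive_def)

text \<open>
  If the upper variation were infinite, halving would produce a decreasing sequence of sets on
  which \<open>\<nu>\<close> is unbounded, against continuity from above.
\<close>

lemma upper_variation_finite:
  assumes \<nu>: "vector_measure M \<nu>"
  shows "upper_variation M \<nu> (space M) < \<infinity>"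
proof (rule ccontr)
  let ?P = "upper_variation M \<nu>"
  assume "\<not> ?P (space M) < \<infinity>"
  then have inf: "?P (space M) = \<infinity>" by (simp add: less_top[symmetric])
  have step: "\<exists>B. (B \<in> sets M \<and> ?P B = \<infinity>) \<and> B \<subseteq> A \<and> real (Suc n) \<le> \<bar>\<nu> B\<bar>"
    if A: "A \<in> sets M \<and> ?P A = \<infinity>" for A n
  proof -
    \<comment> \<open>The term \<open>\<bar>\<nu> A\<bar>\<close> makes \<open>\<nu>\<close> large
      in absolute value on both \<open>D\<close> and \<open>A - D\<close>, whichever of the two
      keeps infinite upper variation.\<close>
    have "ennreal (real (Suc n) + \<bar>\<nu> A\<bar>) < ?P A" using A by simp
    then obtain D where D: "D \<in> sets M" "D \<subseteq> A" "ennreal (real (Suc n) + \<bar>\<nu> A\<bar>) < ennreal (\<nu> D)"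
      unfolding upper_variation_def less_SUP_iff by auto
    then have "real (Suc n) + \<bar>\<nu> A\<bar> < \<nu> D"
      by (subst (asm) ennreal_less_iff) auto
    moreover have "\<nu> (A - D) = \<nu> A - \<nu> D"
      using A D by (intro vector_measure_Diff[OF \<nu>]) auto
    moreover have "?P D + ?P (A - D) = \<infinity>"
      using upper_variation_add[OF \<nu>, of D "A - D"] A D by (simp add: Un_absorb1 sets.Diff)
    ultimately have "?P D = \<infinity> \<or> ?P (A - D) = \<infinity>" "real (Suc n) \<le> \<bar>\<nu> D\<bar>"
        "real (Suc n) \<le> \<bar>\<nu> (A - D)\<bar>"
      by (simp_all add: ennreal_add_eq_top)
    with A D(1,2) show ?thesis
      by (meson Diff_subset sets.Diff)
  qed
  have "\<exists>f. \<forall>n. (f n \<in> sets M \<and> ?P (f n) = \<infinity>) \<and> f (Suc n) \<subseteq> f n \<and> real (Suc n) \<le> \<bar>\<nu> (f (Suc n))\<bar>"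
  proof (rule dependent_nat_choice)
    show "\<exists>A. A \<in> sets M \<and> ?P A = \<infinity>" using inf by blast
  qed (rule step)
  then obtain B where B: "\<And>n. B n \<in> sets M" "\<And>n. B (Suc n) \<subseteq> B n"
    "\<And>n. real (Suc n) \<le> \<bar>\<nu> (B (Suc n))\<bar>" by blast
  have "(\<lambda>n. \<nu> (B n)) \<longlonglongrightarrow> \<nu> (\<Inter>n. B n)"
    using B by (intro vector_measure_decseq_limit[OF \<nu>]) (auto intro!: decseq_SucI)
  then have "Bseq (\<lambda>n. \<nu> (B n))" by (intro convergent_imp_Bseq) (auto simp: convergent_def)
  then obtain K where K: "\<And>n. \<bar>\<nu> (B n)\<bar> \<le> K" by (auto simp: Bseq_def)
  obtain n where "K < real n" using reals_Archimedean2 by blast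
  moreover have "real (Suc n) \<le> K" using B(3)[of n] K[of "Suc n"] by (rule order_trans)
  ultimately show False by simp
qed

text \<open>The positive and the negative part of \<open>\<nu>\<close> are finite measures vanishing
  on the null sets of \<open>M\<close>, so the classical Radon-Nikodym theorem (\<open>dens\<close>)
  gives each a density; the difference of the two is the density of \<open>\<nu>\<close>.\<close>

lemma real_vector_measure_density:
  assumes M: "finite_measure M" and \<nu>: "vector_measure M (\<nu> :: 'a set \<Rightarrow> real)"
    and ac: "vector_abs_cont M \<nu>"
  shows "\<exists>f. integrable M f \<and> (\<forall>A\<in>sets M. \<nu> A = (LINT x:A|M. f x))"
proof -
  interpret M: finite_measure M by fact
  have dens: "\<exists>f. integrable M f \<and> (\<forall>x. 0 \<le> f x) \<and> (\<forall>A\<in>sets M. p A = ennreal (LINT x:A|M. f x))"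
    if p: "countably_additive (sets M) p" "p {} = 0" "p (space M) < \<infinity>"
      "\<And>A. A \<in> null_sets M \<Longrightarrow> p A = 0" for p
  proof -
    define N where "N = measure_of (space M) (sets M) p"
    have sN: "sets N = sets M" "space N = space M" by (auto simp: N_def)
    have eN: "emeasure N A = p A" if "A \<in> sets M" for A
      using p(1,2) that sets.sigma_algebra_axioms[of M]
      by (auto simp: N_def positive_def intro!: emeasure_measure_of_sigma)
    interpret N: finite_measure N
      using p(3) by (intro finite_measureI) (auto simp: sN eN)
    have acN: "absolutely_continuous M N"
      using p(4) by (auto simp: absolutely_continuous_def null_sets_def eN sN)
    obtain D where D: "D \<in> borel_measurable M" "AE x in M. RN_deriv M N x = ennreal (D x)"
        "\<And>x. 0 \<le> D x"
      using M.real_RN_deriv[OF N.finite_measure_axioms acN sN(1)] by blast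
    have eq: "p A = (\<integral>\<^sup>+x. ennreal (D x * indicator A x) \<partial>M)" if A: "A \<in> sets M" for A
    proof -
      have "p A = emeasure (density M (RN_deriv M N)) A"
        using M.density_RN_deriv[OF acN sN(1)] A by (simp add: eN)
      also have "\<dots> = (\<integral>\<^sup>+x. RN_deriv M N x * indicator A x \<partial>M)"
        using A by (simp add: emeasure_density)
      also have "\<dots> = (\<integral>\<^sup>+x. ennreal (D x * indicator A x) \<partial>M)"
        using D(2) by (intro nn_integral_cong_AE) (auto simp: indicator_def)
      finally show ?thesis .
    qed
    have "(\<integral>\<^sup>+x. ennreal (D x) \<partial>M) = p (space M)"
      by (subst eq) (auto intro!: nn_integral_cong)
    then have int: "integrable M D"
      using D p(3) by (intro integrableI_nonneg) auto
    have "p A = ennreal (LINT x:A|M. D x)" if A: "A \<in> sets M" for A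
      unfolding eq[OF A] set_lebesgue_integral_def real_scaleR_def
      using int A D by (subst nn_integral_eq_integral)
        (auto simp: mult.commute intro!: integrable_real_mult_indicator)
    with int D show ?thesis by blast
  qed
  let ?P = "upper_variation M \<nu>"
  have fin: "?P A < \<infinity>" for A
  proof -
    have "?P A \<le> ?P (space M)"
      unfolding upper_variation_def by (rule SUP_mono) (auto dest: sets.sets_into_space)
    then show ?thesis using upper_variation_finite[OF \<nu>] by (rule le_less_trans)
  qed
  have ge: "\<nu> A \<le> enn2real (?P A)" if "A \<in> sets M" for A
    using upper_variation_upper[OF that subset_refl, of \<nu>] fin[of A] that
    by (cases "?P A") (auto simp: ennreal_le_iff2 split: if_splits)
  have null: "\<nu> A = 0" if "A \<in> null_sets M" for A
    using ac that by (auto simp: vector_abs_cont_def)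
  have pnull: "?P A = 0" if "A \<in> null_sets M" for A
  proof -
    have "ennreal (\<nu> B) = 0" if B: "B \<in> sets M" "B \<subseteq> A" for B
      using null[of B] null_sets_subset[OF \<open>A \<in> null_sets M\<close>] B by auto
    then show ?thesis by (auto simp: upper_variation_def intro!: antisym SUP_least)
  qed
  obtain f where f: "integrable M f" "\<And>x. 0 \<le> f x" "\<And>A. A \<in> sets M \<Longrightarrow> ?P A = ennreal (LINT x:A|M. f x)"
    using dens[OF upper_variation_countably_additive[OF \<nu>]] \<nu> fin pnull by auto
  \<comment> \<open>The negative part; by \<open>ge\<close> it is a difference of nonnegative sign,
    since \<open>A\<close> itself competes in \<open>upper_variation M \<nu> A\<close>.\<close>
  define q where "q = (\<lambda>A. ennreal (enn2real (?P A) - \<nu> A))"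
  have "countably_additive (sets M) q"
  proof (rule countably_additiveI)
    fix A :: "nat \<Rightarrow> 'a set" assume A: "range A \<subseteq> sets M" "disjoint_family A"
    have "(\<lambda>i. ?P (A i)) sums ?P (\<Union>i. A i)"
      using upper_variation_countably_additive[OF \<nu>] A
      by (auto simp: countably_additive_def sums_iff)
    then have "(\<lambda>i. ennreal (enn2real (?P (A i)))) sums ennreal (enn2real (?P (\<Union>i. A i)))"
      using fin by simp
    then have "(\<lambda>i. enn2real (?P (A i))) sums enn2real (?P (\<Union>i. A i))"
      by simp
    moreover have "(\<lambda>i. \<nu> (A i)) sums \<nu> (\<Union>i. A i)"
      using \<nu> A unfolding vector_measure_def by blast
    ultimately have "(\<lambda>i. enn2real (?P (A i)) - \<nu> (A i)) sums (enn2real (?P (\<Union>i. A i)) - \<nu> (\<Union>i. A i))"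
      by (rule sums_diff)
    then have "(\<lambda>i. q (A i)) sums q (\<Union>i. A i)"
      unfolding q_def using A ge by (subst sums_ennreal) auto
    then show "(\<Sum>i. q (A i)) = q (\<Union>i. A i)" by (rule sums_unique[symmetric])
  qed
  then obtain h where h: "integrable M h" "\<And>x. 0 \<le> h x" "\<And>A. A \<in> sets M \<Longrightarrow> q A = ennreal (LINT x:A|M. h x)"
    using dens[of q] \<nu> null pnull by (auto simp: q_def vector_measure_def)
  have "\<nu> A = (LINT x:A|M. f x - h x)" if A: "A \<in> sets M" for A
  proof -
    have si: "set_integrable M A f" "set_integrable M A h"
      using f h A unfolding set_integrable_def by (auto intro!: integrable_mult_indicator simp del: real_scaleR_def)
    have "0 \<le> (LINT x:A|M. f x)" "0 \<le> (LINT x:A|M. h x)"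
      using f(2) h(2) by (auto simp: set_lebesgue_integral_def intro!: Bochner_Integration.integral_nonneg)
    then have "enn2real (?P A) = (LINT x:A|M. f x)" "enn2real (?P A) - \<nu> A = (LINT x:A|M. h x)"
      using f(3)[OF A] h(3)[OF A] ge[OF A] by (auto simp: q_def)
    then show ?thesis using si by (simp add: set_integral_diff)
  qed
  with f(1) h(1) show ?thesis by (intro exI[of _ "\<lambda>x. f x - h x"]) auto
qed

text \<open>The scalar result is applied to each coordinate of \<open>\<nu>\<close> and the
  densities are reassembled over \<open>Basis\<close>.\<close>

lemma vector_measure_density:
  fixes \<nu> :: "'a set \<Rightarrow> 'b::euclidean_space"
  assumes M: "finite_measure M" and \<nu>: "vector_measure M \<nu>" and ac: "vector_abs_cont M \<nu>"
  shows "\<exists>f. integrable M f \<and> (\<forall>A\<in>sets M. \<nu> A = (LINT x:A|M. f x))"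
proof -
  have "\<exists>f. integrable M f \<and> (\<forall>A\<in>sets M. \<nu> A \<bullet> b = (LINT x:A|M. f x))" for b
  proof (rule real_vector_measure_density[OF M])
    show "vector_measure M (\<lambda>A. \<nu> A \<bullet> b)"
      using \<nu> by (auto simp: vector_measure_def intro!: bounded_linear.sums[OF bounded_linear_inner_left])
    show "vector_abs_cont M (\<lambda>A. \<nu> A \<bullet> b)"
      using ac by (auto simp: vector_abs_cont_def)
  qed
  then obtain f where f: "\<And>b. integrable M (f b)"
    "\<And>b A. A \<in> sets M \<Longrightarrow> \<nu> A \<bullet> b = (LINT x:A|M. f b x)"
    by metis
  have "\<nu> A = (LINT x:A|M. (\<Sum>b\<in>Basis. f b x *\<^sub>R b))" if A: "A \<in> sets M" for A
  proof -
    have "(LINT x:A|M. (\<Sum>b\<in>Basis. f b x *\<^sub>R b)) = (\<integral>x. (\<Sum>b\<in>Basis. (indicator A x *\<^sub>R f b x) *\<^sub>R b) \<partial>M)"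
      by (simp add: set_lebesgue_integral_def scaleR_sum_right)
    also have "\<dots> = (\<Sum>b\<in>Basis. (\<integral>x. (indicator A x *\<^sub>R f b x) *\<^sub>R b \<partial>M))"
      using f(1) A by (intro Bochner_Integration.integral_sum integrable_scaleR_left integrable_mult_indicator) auto
    also have "\<dots> = (\<Sum>b\<in>Basis. (LINT x:A|M. f b x) *\<^sub>R b)"
      using f(1) A unfolding set_lebesgue_integral_def
      by (intro sum.cong refl integral_scaleR_left integrable_mult_indicator) auto
    also have "\<dots> = \<nu> A"
      by (simp add: f(2)[OF A, symmetric] euclidean_representation)
    finally show ?thesis by simp
  qed
  moreover have "integrable M (\<lambda>x. \<Sum>b\<in>Basis. f b x *\<^sub>R b)"
    using f(1) by auto
  ultimately show ?thesis by blast
qed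

lemma vector_RN_deriv:
  fixes \<nu> :: "'a set \<Rightarrow> 'b::euclidean_space"
  assumes "finite_measure M" "vector_measure M \<nu>" "vector_abs_cont M \<nu>"
  shows integrable_vector_RN_deriv: "integrable M (vector_RN_deriv M \<nu>)"
    and set_integral_vector_RN_deriv:
      "A \<in> sets M \<Longrightarrow> (LINT x:A|M. vector_RN_deriv M \<nu> x) = \<nu> A"
  using someI_ex[OF vector_measure_density[OF assms]] unfolding vector_RN_deriv_def by auto

text \<open>A known density witnesses the choice in \<open>vector_RN_deriv\<close>, and densities
  are unique almost everywhere. This is how the velocity of an explicit flow is computed.\<close>

lemma vector_RN_deriv_AE_eq:
  fixes \<nu> :: "'a set \<Rightarrow> 'b::euclidean_space"
  assumes M: "finite_measure M" and f: "integrable M f"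
    and eq: "\<And>A. A \<in> sets M \<Longrightarrow> \<nu> A = (LINT x:A|M. f x)"
  shows "AE x in M. vector_RN_deriv M \<nu> x = f x"
proof -
  let ?v = "vector_RN_deriv M \<nu>"
  have v: "integrable M ?v \<and> (\<forall>A\<in>sets M. \<nu> A = (LINT x:A|M. ?v x))"
    unfolding vector_RN_deriv_def by (rule someI[of _ f]) (use f eq in blast)
  show ?thesis
    by (rule sigma_finite_measure.density_unique_banach)
      (use M f eq v in \<open>auto intro: finite_measure.sigma_finite_measure\<close>)
qed

section \<open>Weak compactness of probability measures\<close>

lemma prob_measuresD:
  assumes "M \<in> prob_measures S"
  shows "prob_space M" "sets M = sets (borel_on S)" "space M = S"
  using assms sets_eq_imp_space_eq[of M "borel_on S"]
  by (auto simp: prob_measures_def space_restrict_space)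

lemma prob_measures_borel_measurable:
  "M \<in> prob_measures S \<Longrightarrow> borel_measurable M = borel_measurable (borel_on S)"
  using prob_measuresD(2) by (intro measurable_cong_sets) auto

lemma borel_measurable_prob_measures:
  fixes f :: "'a::topological_space \<Rightarrow> 'b::topological_space"
  shows "f \<in> borel_measurable borel \<Longrightarrow> M \<in> prob_measures S \<Longrightarrow> f \<in> borel_measurable M"
  by (simp add: prob_measures_borel_measurable measurable_restrict_space1)

lemma continuous_on_borel_measurable_prob_measures:
  fixes f :: "'a::topological_space \<Rightarrow> 'b::topological_space"
  shows "continuous_on S f \<Longrightarrow> M \<in> prob_measures S \<Longrightarrow> f \<in> borel_measurable M"
  by (simp add: prob_measures_borel_measurable borel_measurable_continuous_on_restrict)

lemma continuous_on_integrable_prob_measures: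
  fixes f :: "'a::topological_space \<Rightarrow> 'b::{banach, second_countable_topology}"
  assumes "compact S" "continuous_on S f" "M \<in> prob_measures S"
  shows "integrable M f"
proof -
  interpret prob_space M using assms(3) by (rule prob_measuresD)
  have "bounded (f ` S)"
    using assms by (intro compact_imp_bounded compact_continuous_image)
  then obtain B where "\<And>x. x \<in> S \<Longrightarrow> norm (f x) \<le> B" by (auto simp: bounded_iff)
  then show ?thesis
    using assms by (intro integrable_const_bound[of _ B])
      (auto simp: prob_measuresD continuous_on_borel_measurable_prob_measures)
qed

text \<open>The functions \<open>max 0 (1 - n * infdist x C)\<close> decrease to the indicator of a
  closed set \<open>C\<close>, so the integrals determine the measures of closed sets, which
  generate the Borel sets and are stable under intersection.\<close>

lemma prob_measures_eqI:
  fixes M N :: "'a::metric_space measure"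
  assumes M: "M \<in> prob_measures S" and N: "N \<in> prob_measures S"
    and eq: "\<And>f :: 'a \<Rightarrow> real. continuous_on UNIV f \<Longrightarrow> (\<And>x. 0 \<le> f x \<and> f x \<le> 1) \<Longrightarrow> (\<integral>x. f x \<partial>M) = (\<integral>x. f x \<partial>N)"
  shows "M = N"
proof -
  note D = prob_measuresD[OF M] prob_measuresD[OF N]
  interpret M: prob_space M by fact
  interpret N: prob_space N by fact
  have lim: "(\<lambda>n. \<integral>x. max 0 (1 - real n * infdist x C) \<partial>P) \<longlonglongrightarrow> measure P (C \<inter> S)"
    if P: "P \<in> prob_measures S" and C: "closed C" "C \<noteq> {}" for C P
  proof -
    interpret P: prob_space P by (rule prob_measuresD[OF P])
    have "(\<lambda>n. max 0 (1 - real n * infdist x C)) \<longlonglongrightarrow> indicator (C \<inter> S) x" if "x \<in> S" for x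
    proof (cases "x \<in> C")
      case True
      then show ?thesis using that by (simp add: infdist_zero)
    next
      case False
      then have pos: "infdist x C > 0"
        using C by (simp add: infdist_pos_not_in_closed)
      obtain n0 where n0: "1 / infdist x C < real n0" using reals_Archimedean2 by blast
      have "max 0 (1 - real n * infdist x C) = 0" if "n \<ge> n0" for n
      proof -
        have "1 < real n0 * infdist x C" using n0 pos by (simp add: field_simps)
        also have "\<dots> \<le> real n * infdist x C" using that pos by simp
        finally show ?thesis by simp
      qed
      then have "eventually (\<lambda>n. max 0 (1 - real n * infdist x C) = 0) sequentially"
        by (auto simp: eventually_sequentially)
      then show ?thesis using False by (simp add: tendsto_eventually)
    qed
    then have "(\<lambda>n. \<integral>x. max 0 (1 - real n * infdist x C) \<partial>P) \<longlonglongrightarrow> (\<integral>x. indicator (C \<inter> S) x \<partial>P)"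
    proof (intro integral_dominated_convergence[where w="\<lambda>_. 1"])
      have "C \<inter> S \<in> sets P"
        using C(1) prob_measuresD(2)[OF P] by (auto simp: sets_restrict_space)
      then show "(\<lambda>x. indicator (C \<inter> S) x :: real) \<in> borel_measurable P" by simp
      show "(\<lambda>x. max 0 (1 - real n * infdist x C)) \<in> borel_measurable P" for n
        by (intro borel_measurable_prob_measures[OF _ P] borel_measurable_continuous_onI continuous_intros)
    qed (auto simp: prob_measuresD(3)[OF P] infdist_nonneg)
    also have "(\<integral>x. indicator (C \<inter> S) x \<partial>P) = measure P (C \<inter> S)"
      using prob_measuresD(3)[OF P] by (simp add: Int_assoc)
    finally show ?thesis .
  qed
  have closed: "measure M (C \<inter> S) = measure N (C \<inter> S)" if "closed C" for C
  \<comment> \<open>\<open>infdist\<close> to the empty set is 0 by convention, so the approximants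
    would be constantly 1 there.\<close>
  proof (cases "C = {}")
    case False
    have "(\<integral>x. max 0 (1 - real n * infdist x C) \<partial>M) = (\<integral>x. max 0 (1 - real n * infdist x C) \<partial>N)" for n
      by (rule eq) (auto intro!: continuous_intros simp: infdist_nonneg)
    with lim[OF M that False] lim[OF N that False] show ?thesis
      by (simp add: LIMSEQ_unique)
  qed simp
  have emd: "emeasure (distr P borel (\<lambda>x. x)) C = emeasure P (C \<inter> S)"
    if "P \<in> prob_measures S" "C \<in> sets borel" for C P
    using that prob_measuresD(3)[OF that(1)]
    by (subst emeasure_distr) (auto intro: borel_measurable_prob_measures)
  \<comment> \<open>The generator argument runs on the whole space, where the closed sets live; the
    restriction to \<open>S\<close> is put back afterwards.\<close>
  have "distr M borel (\<lambda>x. x) = distr N borel (\<lambda>x. x)"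
  proof (rule measure_eqI_generator_eq[where E="Collect closed" and A="\<lambda>_. UNIV" and \<Omega>=UNIV])
    show "sets (distr M borel (\<lambda>x. x)) = sigma_sets UNIV (Collect closed)"
      "sets (distr N borel (\<lambda>x. x)) = sigma_sets UNIV (Collect closed)"
      by (simp_all add: borel_eq_closed)
    fix X :: "'a set" assume "X \<in> Collect closed"
    then show "emeasure (distr M borel (\<lambda>x. x)) X = emeasure (distr N borel (\<lambda>x. x)) X"
      using M N closed by (simp add: emd M.emeasure_eq_measure N.emeasure_eq_measure)
  qed (use M in \<open>auto simp: Int_stable_def emd M.emeasure_eq_measure\<close>)
  then have eq': "emeasure M (C \<inter> S) = emeasure N (C \<inter> S)" if "C \<in> sets borel" for C
    using emd[OF M that] emd[OF N that] by simp
  show ?thesis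
  proof (rule measure_eqI)
    fix A assume "A \<in> sets M"
    then have "A \<in> (\<inter>) S ` sets borel" by (simp add: D(2) sets_restrict_space)
    then obtain C where "C \<in> sets borel" "A = C \<inter> S" by blast
    then show "emeasure M A = emeasure N A" using eq' by simp
  qed (simp add: D)
qed

text \<open>
  Schoenberg's space-filling curve: \<open>bump\<close> is 2-periodic, equals 0 on \<open>[0,1/3]\<close> and 1 on
  \<open>[2/3,1]\<close>, so \<open>bump (3 ^ m * t)\<close> reads off the \<open>m\<close>-th digit of a point \<open>t\<close> of the Cantor set.
\<close>

definition bump :: "real \<Rightarrow> real" where
  "bump u = max 0 (min 1 (1/2 - cos (pi * u)))"

lemma bump_bounds: "0 \<le> bump u" "bump u \<le> 1"
  by (auto simp: bump_def)

lemma continuous_on_bump: "continuous_on A bump"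
  unfolding bump_def by (intro continuous_intros)

lemma bump_periodic: "bump (2 * of_int k + u) = bump u"
proof -
  have "cos (pi * (2 * of_int k + u)) = cos (pi * u + of_int k * (2 * pi))"
    by (simp add: algebra_simps)
  also have "\<dots> = cos (pi * u)"
    using sin_int_2pin[of k] cos_int_2pin[of k] by (simp add: cos_add mult_ac)
  finally show ?thesis by (simp add: bump_def)
qed

lemma bump_eq_0: "0 \<le> u \<Longrightarrow> u \<le> 1/3 \<Longrightarrow> bump u = 0"
  using cos_monotone_0_pi_le[of "pi * u" "pi / 3"] by (simp add: bump_def cos_60)

lemma bump_eq_1: "2/3 \<le> u \<Longrightarrow> u \<le> 1 \<Longrightarrow> bump u = 1"
  using cos_monotone_0_pi_le[of "2 * pi / 3" "pi * u"] by (simp add: bump_def cos_120)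

definition cantor_point :: "(nat \<Rightarrow> bool) \<Rightarrow> real" where
  "cantor_point a = (\<Sum>m. (if a m then 2 else 0) * (1/3) ^ Suc m)"

lemma cantor_point_summable:
  "summable (\<lambda>m. (if a m then 2 else 0) * (1/3::real) ^ Suc m)"
proof (rule summable_comparison_test)
  show "summable (\<lambda>m. 2 * (1/3::real) ^ Suc m)"
    by (intro summable_mult) (simp add: summable_geometric)
qed (auto intro!: exI[of _ 0])

lemma cantor_point_bounds: "0 \<le> cantor_point a" "cantor_point a \<le> 1"
proof -
  show "0 \<le> cantor_point a"
    unfolding cantor_point_def by (intro suminf_nonneg cantor_point_summable) auto
  have s: "(\<lambda>m. (2/3) * (1/3::real) ^ m) sums ((2/3) * (1 / (1 - 1/3)))"
    by (intro sums_mult geometric_sums) auto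
  have "cantor_point a \<le> (\<Sum>m. (2/3) * (1/3::real) ^ m)"
    unfolding cantor_point_def using s
    by (intro suminf_le cantor_point_summable) (auto simp: sums_iff)
  then show "cantor_point a \<le> 1" using s by (simp add: sums_iff)
qed

lemma cantor_point_Suc:
  "3 * cantor_point a = (if a 0 then 2 else 0) + cantor_point (\<lambda>m. a (Suc m))"
proof -
  have "cantor_point a = (if a 0 then 2 else 0) * (1/3) + (\<Sum>m. (if a (Suc m) then 2 else 0) * (1/3) ^ Suc (Suc m))"
    unfolding cantor_point_def using suminf_split_head[OF cantor_point_summable[of a]] by simp
  also have "(\<Sum>m. (if a (Suc m) then 2 else 0) * (1/3::real) ^ Suc (Suc m)) =
      (\<Sum>m. (1/3) * ((if a (Suc m) then 2 else 0) * (1/3) ^ Suc m))"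
    by (simp add: algebra_simps)
  also have "\<dots> = (1/3) * cantor_point (\<lambda>m. a (Suc m))"
    unfolding cantor_point_def by (intro suminf_mult cantor_point_summable)
  finally show ?thesis by auto
qed

text \<open>Multiplication by 3 shifts the ternary digits. The leading digit turns into 0 or
  \<open>2 * 3 ^ m\<close>, an even integer that the period 2 of \<open>bump\<close> discards. For
  \<open>m = 0\<close> the leading digit places the point in \<open>[0,1/3]\<close> or
  \<open>[2/3,1]\<close>.\<close>

lemma bump_cantor_point: "bump (3 ^ m * cantor_point a) = (if a m then 1 else 0)"
proof (induction m arbitrary: a)
  case 0
  have "3 * cantor_point a = (if a 0 then 2 else 0) + cantor_point (\<lambda>m. a (Suc m))"
    by (rule cantor_point_Suc)
  then show ?case
    using cantor_point_bounds[of "\<lambda>m. a (Suc m)"] by (auto intro!: bump_eq_0 bump_eq_1)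
next
  case (Suc m)
  have "3 ^ Suc m * cantor_point a = 3 ^ m * (3 * cantor_point a)" by simp
  also have "\<dots> = 2 * of_int (if a 0 then 3 ^ m else 0) + 3 ^ m * cantor_point (\<lambda>m. a (Suc m))"
    unfolding cantor_point_Suc by (simp add: algebra_simps)
  finally show ?case using Suc by (simp only: bump_periodic)
qed

definition binary_digit :: "nat \<Rightarrow> real \<Rightarrow> bool" where
  "binary_digit i y \<longleftrightarrow> odd \<lfloor>2 ^ Suc i * y\<rfloor>"

lemma binary_expansion:
  assumes "0 \<le> y" "y < 1"
  shows "(\<lambda>i. (1/2) ^ Suc i * (if binary_digit i y then 1 else 0)) sums y"
proof -
  have digit: "real_of_int \<lfloor>2 * z\<rfloor> = 2 * real_of_int \<lfloor>z\<rfloor> + (if odd \<lfloor>2 * z\<rfloor> then 1 else 0)" for z :: real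
  proof -
    have "\<lfloor>2 * z\<rfloor> = 2 * \<lfloor>z\<rfloor> \<or> \<lfloor>2 * z\<rfloor> = 2 * \<lfloor>z\<rfloor> + 1" by linarith
    then show ?thesis by auto
  qed
  \<comment> \<open>The partial sums are the dyadic truncations of \<open>y\<close>;
    \<open>0 \<le> y < 1\<close> makes the integer part, the case \<open>n = 0\<close>,
    vanish.\<close>
  have partial: "(\<Sum>i<n. (1/2) ^ Suc i * (if binary_digit i y then 1 else 0)) = real_of_int \<lfloor>2 ^ n * y\<rfloor> / 2 ^ n" for n
  proof (induction n)
    case 0
    then show ?case using assms by (simp add: floor_eq_iff)
  next
    case (Suc n)
    then show ?case
      using digit[of "2 ^ n * y"] by (simp add: binary_digit_def field_simps)
  qed
  have "(\<lambda>n. real_of_int \<lfloor>2 ^ n * y\<rfloor> / 2 ^ n) \<longlonglongrightarrow> y"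
  proof (rule real_tendsto_sandwich[of "\<lambda>n. y - (1/2) ^ n" _ _ "\<lambda>_. y"])
    have "y - (1/2) ^ n \<le> real_of_int \<lfloor>2 ^ n * y\<rfloor> / 2 ^ n" for n
    proof -
      have "2 ^ n * y - 1 \<le> real_of_int \<lfloor>2 ^ n * y\<rfloor>" by linarith
      then have "(2 ^ n * y - 1) / 2 ^ n \<le> real_of_int \<lfloor>2 ^ n * y\<rfloor> / 2 ^ n"
        by (intro divide_right_mono) auto
      then show ?thesis by (simp add: diff_divide_distrib power_one_over)
    qed
    then show "eventually (\<lambda>n. y - (1/2) ^ n \<le> real_of_int \<lfloor>2 ^ n * y\<rfloor> / 2 ^ n) sequentially" by simp
    have "real_of_int \<lfloor>2 ^ n * y\<rfloor> / 2 ^ n \<le> y" for n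
      by (simp add: divide_le_eq mult.commute)
    then show "eventually (\<lambda>n. real_of_int \<lfloor>2 ^ n * y\<rfloor> / 2 ^ n \<le> y) sequentially" by simp
    have "(\<lambda>n. y - (1/2) ^ n) \<longlonglongrightarrow> y - 0"
      by (intro tendsto_diff tendsto_const LIMSEQ_realpow_zero) auto
    then show "(\<lambda>n. y - (1/2) ^ n) \<longlonglongrightarrow> y" by simp
  qed simp
  then show ?thesis unfolding sums_def partial .
qed

text \<open>\<open>prod_encode\<close> deals the digits of a single Cantor point out to countably
  many coordinates: the digits at positions \<open>(i, j)\<close> are read as the binary digits of
  coordinate \<open>j\<close>.\<close>

definition schoenberg_coord :: "nat \<Rightarrow> real \<Rightarrow> real" where
  "schoenberg_coord j t = (\<Sum>i. (1/2) ^ Suc i * bump (3 ^ prod_encode (i, j) * t))"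

lemma continuous_on_schoenberg_coord: "continuous_on UNIV (schoenberg_coord j)"
proof -
  have "uniform_limit UNIV (\<lambda>n t. \<Sum>i<n. (1/2) ^ Suc i * bump (3 ^ prod_encode (i, j) * t))
      (schoenberg_coord j) sequentially"
    unfolding schoenberg_coord_def
  proof (rule Weierstrass_m_test)
    show "norm ((1/2) ^ Suc i * bump (3 ^ prod_encode (i, j) * t)) \<le> (1/2) ^ Suc i" for i t
      using bump_bounds[of "3 ^ prod_encode (i, j) * t"]
      by (simp add: abs_mult mult_left_le)
    show "summable (\<lambda>i. (1/2::real) ^ Suc i)" by (simp add: summable_geometric)
  qed
  then show ?thesis
    by (rule uniform_limit_theorem[rotated])
      (auto intro!: always_eventually continuous_intros continuous_on_compose2[OF continuous_on_bump])
qed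

text \<open>\<open>s\<close> packs the binary digits of all rescaled coordinates into one Cantor
  point and \<open>\<phi>\<close> unpacks them. Digits jump, so \<open>s\<close> is only shown to be
  Borel, whereas \<open>\<phi>\<close> is continuous on the whole line because \<open>bump\<close>
  interpolates between the two digit values.\<close>

lemma schoenberg_section:
  fixes S :: "'a::euclidean_space set"
  assumes "bounded S"
  obtains \<phi> :: "real \<Rightarrow> 'a" and s :: "'a \<Rightarrow> real"
  where "continuous_on UNIV \<phi>" "s \<in> borel_measurable borel"
    "\<And>x. 0 \<le> s x \<and> s x \<le> 1" "\<And>x. x \<in> S \<Longrightarrow> \<phi> (s x) = x"
proof -
  obtain R where R: "R > 0" "\<And>x. x \<in> S \<Longrightarrow> norm x < R"
    using assms by (metis bounded_pos_less)
  \<comment> \<open>Rescales the coordinates of \<open>S\<close> into \<open>[0,1)\<close>; the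
    strict bound \<open>norm x < R\<close> keeps them below 1, as \<open>binary_expansion\<close>
    requires.\<close>
  define y where "y b x = (x \<bullet> b + R) / (2 * R)" for b x :: 'a
  define \<phi> :: "real \<Rightarrow> 'a" where
    "\<phi> t = (\<Sum>b\<in>Basis. (2 * R * schoenberg_coord (to_nat_on Basis b) t - R) *\<^sub>R b)" for t
  define a where "a x m = (case prod_decode m of (i, j) \<Rightarrow> binary_digit i (y (from_nat_into Basis j) x))" for x m
  define s where "s x = cantor_point (a x)" for x
  have "\<phi> (s x) = x" if "x \<in> S" for x
  proof -
    have "schoenberg_coord (to_nat_on Basis b) (s x) = y b x" if b: "b \<in> Basis" for b
    proof -
      have "\<bar>x \<bullet> b\<bar> < R" using R(2)[OF \<open>x \<in> S\<close>] Basis_le_norm[OF b, of x] by linarith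
      then have "0 \<le> y b x" "y b x < 1" using R(1) by (auto simp: y_def field_simps)
      moreover have "bump (3 ^ prod_encode (i, to_nat_on Basis b) * s x) =
          (if binary_digit i (y b x) then 1 else 0)" for i
        using b by (simp add: s_def bump_cantor_point a_def countable_finite)
      ultimately show ?thesis
        using binary_expansion[of "y b x"] by (simp add: schoenberg_coord_def sums_iff)
    qed
    then have "\<phi> (s x) = (\<Sum>b\<in>Basis. (x \<bullet> b) *\<^sub>R b)"
      using R(1) unfolding \<phi>_def by (intro sum.cong) (auto simp: y_def field_simps)
    then show ?thesis by (simp add: euclidean_representation)
  qed
  moreover have "continuous_on UNIV \<phi>"
    unfolding \<phi>_def by (intro continuous_intros continuous_on_schoenberg_coord)
  moreover have "s \<in> borel_measurable borel"
  proof -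
    have "Measurable.pred borel (\<lambda>x. a x m)" for m
      unfolding a_def binary_digit_def y_def by (cases "prod_decode m") (simp; measurable)
    then show ?thesis
      unfolding s_def cantor_point_def by measurable
  qed
  ultimately show ?thesis
    using that[of \<phi> s] cantor_point_bounds by (auto simp: s_def)
qed


text \<open>The laws of \<open>s\<close> live on \<open>[0,1]\<close> and are tight, so a
  subsequence converges weakly to some \<open>N\<close>; the limit sought is the image of
  \<open>N\<close> under \<open>\<phi>\<close>. For bounded continuous \<open>g\<close> the function
  \<open>g\<close> after \<open>\<phi>\<close> is an admissible test on the line, and
  \<open>\<phi> (s x) = x\<close> on \<open>S\<close> turns its integral back into that of
  \<open>g\<close>. The discontinuities of \<open>s\<close> do no harm, since \<open>s\<close>
  enters only before the limit.\<close>

lemma prob_measures_seq_compact: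
  fixes S :: "'a::euclidean_space set"
  assumes S: "compact S" and \<gamma>: "\<And>n. \<gamma> n \<in> prob_measures S"
  obtains r :: "nat \<Rightarrow> nat" and \<gamma>' where "strict_mono r" "\<gamma>' \<in> prob_measures S"
    "\<And>f :: 'a \<Rightarrow> real. continuous_on S f \<Longrightarrow> (\<lambda>n. \<integral>x. f x \<partial>\<gamma> (r n)) \<longlonglongrightarrow> (\<integral>x. f x \<partial>\<gamma>')"
proof -
  obtain \<phi> :: "real \<Rightarrow> 'a" and s :: "'a \<Rightarrow> real"
    where \<phi>: "continuous_on UNIV \<phi>" and s: "s \<in> borel_measurable borel"
      "\<And>x. 0 \<le> s x \<and> s x \<le> 1" and \<phi>s: "\<And>x. x \<in> S \<Longrightarrow> \<phi> (s x) = x"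
    using schoenberg_section[OF compact_imp_bounded[OF S]] by metis
  have \<phi>m: "\<phi> \<in> borel_measurable borel" using \<phi> by (rule borel_measurable_continuous_onI)
  define \<nu> where "\<nu> n = distr (\<gamma> n) borel s" for n
  have sm: "s \<in> borel_measurable (\<gamma> n)" for n
    using s(1) \<gamma> by (rule borel_measurable_prob_measures)
  have rd: "real_distribution (\<nu> n)" for n
  proof -
    interpret prob_space "\<gamma> n" using \<gamma> by (rule prob_measuresD)
    show ?thesis unfolding \<nu>_def using sm by (intro real_distribution_distr)
  qed
  have "tight \<nu>"
    unfolding tight_def
  proof (intro conjI allI impI rd)
    fix e :: real assume "e > 0"
    have "measure (\<nu> n) {-1<..2} = 1" for n
    proof -
      interpret prob_space "\<gamma> n" using \<gamma> by (rule prob_measuresD)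
      have "s -` {-1<..2} \<inter> space (\<gamma> n) = space (\<gamma> n)"
      proof (intro equalityI subsetI IntI vimageI2)
        show "s x \<in> {-1<..2}" for x using s(2)[of x] by auto
      qed auto
      then show ?thesis unfolding \<nu>_def using sm by (simp add: measure_distr prob_space)
    qed
    with \<open>e > 0\<close> show "\<exists>a b::real. a < b \<and> (\<forall>n. 1 - e < measure (\<nu> n) {a<..b})"
      by (intro exI[of _ "-1"] exI[of _ 2]) auto
  qed
  from tight_imp_convergent_subsubsequence[OF this strict_mono_id]
  obtain r N where r: "strict_mono (r :: nat \<Rightarrow> nat)" and N: "real_distribution N"
    and conv: "weak_conv_m (\<nu> \<circ> r) N" by auto
  interpret N: real_distribution N by fact
  have lim: "(\<lambda>n. \<integral>x. g x \<partial>\<gamma> (r n)) \<longlonglongrightarrow> (\<integral>t. g (\<phi> t) \<partial>N)"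
    if g: "continuous_on UNIV g" "\<And>x. norm (g x) \<le> B" for g :: "'a \<Rightarrow> real" and B :: real
  proof -
    have "(\<lambda>n. \<integral>t. g (\<phi> t) \<partial>(\<nu> \<circ> r) n) \<longlonglongrightarrow> (\<integral>t. g (\<phi> t) \<partial>N)"
    proof (rule weak_conv_imp_integral_bdd_continuous_conv[OF _ N conv])
      show "isCont (\<lambda>t. g (\<phi> t)) x" for x
        using continuous_on_compose2[OF g(1) \<phi>] by (auto simp: continuous_on_eq_continuous_at)
    qed (use rd g in auto)
    moreover have "(\<integral>t. g (\<phi> t) \<partial>(\<nu> \<circ> r) n) = (\<integral>x. g x \<partial>\<gamma> (r n))" for n
      unfolding \<nu>_def comp_def
      using sm measurable_compose[OF \<phi>m borel_measurable_continuous_onI[OF g(1)]]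
      by (subst integral_distr)
        (auto simp: prob_measuresD(3)[OF \<gamma>] \<phi>s intro!: Bochner_Integration.integral_cong)
    ultimately show ?thesis by simp
  qed
  define M where "M = distr N borel \<phi>"
  interpret M: prob_space M
    unfolding M_def using \<phi>m by (intro N.prob_space_distr) simp
  have Mint: "(\<integral>x. g x \<partial>M) = (\<integral>t. g (\<phi> t) \<partial>N)" if "g \<in> borel_measurable borel" for g :: "'a \<Rightarrow> real"
    unfolding M_def using \<phi>m that by (intro integral_distr) auto
  have sets_M: "sets M = sets borel" "space M = UNIV" by (simp_all add: M_def)
  have meas_M: "g \<in> borel_measurable borel \<Longrightarrow> g \<in> borel_measurable M" for g :: "'a \<Rightarrow> real"
    by (simp add: M_def)
  have ne: "S \<noteq> {}"
    using prob_space.not_empty[OF prob_measuresD(1)[OF \<gamma>]] prob_measuresD(3)[OF \<gamma>] by simp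
  \<comment> \<open>The limit \<open>M\<close> is so far a measure on the whole space. This bounded
    continuous function vanishes exactly on \<open>S\<close> and has integral 0 along the sequence,
    hence also in the limit, so \<open>M\<close> is concentrated on \<open>S\<close>.\<close>
  let ?d = "\<lambda>x. min 1 (infdist x S)"
  have dm: "?d \<in> borel_measurable borel"
    by (intro borel_measurable_continuous_onI continuous_intros)
  have "(\<lambda>n. \<integral>x. ?d x \<partial>\<gamma> (r n)) \<longlonglongrightarrow> (\<integral>x. ?d x \<partial>M)"
    unfolding Mint[OF dm] by (rule lim[of _ 1]) (auto intro!: continuous_intros simp: infdist_nonneg)
  moreover have "(\<integral>x. ?d x \<partial>\<gamma> (r n)) = 0" for n
    by (rule integral_eq_zero_AE) (auto simp: prob_measuresD(3)[OF \<gamma>])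
  ultimately have "(\<integral>x. ?d x \<partial>M) = 0" by (simp add: LIMSEQ_const_iff)
  moreover have "integrable M ?d"
    using meas_M[OF dm] by (intro M.integrable_const_bound[of _ 1]) (auto simp: infdist_nonneg)
  ultimately have "AE x in M. ?d x = 0"
    by (subst (asm) integral_nonneg_eq_0_iff_AE) (auto simp: infdist_nonneg)
  then have AE: "AE x in M. x \<in> S"
    using compact_imp_closed[OF S] ne by (auto simp: in_closed_iff_infdist_zero min_def elim!: AE_mp)
  have SM: "S \<in> sets M" using S by (simp add: sets_M borel_compact)
  define \<gamma>' where "\<gamma>' = restrict_space M S"
  have g'_int: "(\<integral>x. f x \<partial>\<gamma>') = (\<integral>x. indicator S x *\<^sub>R f x \<partial>M)" for f :: "'a \<Rightarrow> real"
    unfolding \<gamma>'_def using SM by (subst integral_restrict_space) (auto simp: sets_M)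
  have "\<gamma>' \<in> prob_measures S"
  proof -
    have "emeasure M S = 1" using AE SM by (simp add: M.emeasure_eq_1_AE)
    then have "prob_space \<gamma>'"
      unfolding \<gamma>'_def using SM by (intro prob_spaceI) (simp add: emeasure_restrict_space space_restrict_space sets_M)
    then show ?thesis
      by (auto simp: prob_measures_def \<gamma>'_def intro!: sets_restrict_space_cong sets_M)
  qed
  moreover have "(\<lambda>n. \<integral>x. f x \<partial>\<gamma> (r n)) \<longlonglongrightarrow> (\<integral>x. f x \<partial>\<gamma>')"
    if f: "continuous_on S f" for f :: "'a \<Rightarrow> real"
  proof -
    have "bounded (f ` S)"
      using f S by (intro compact_imp_bounded compact_continuous_image)
    then obtain B where B: "B > 0" "\<And>x. x \<in> S \<Longrightarrow> norm (f x) \<le> B"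
      by (auto simp: bounded_pos)
    \<comment> \<open>\<open>lim\<close> tests with functions continuous on the whole space, so
      \<open>f\<close> is extended with the same bound.\<close>
    obtain g where g: "continuous_on UNIV g" "\<And>x. x \<in> S \<Longrightarrow> g x = f x" "\<And>x. norm (g x) \<le> B"
      using Tietze[OF f, of UNIV B] B S by (auto simp: compact_imp_closed)
    have gm: "g \<in> borel_measurable borel" using g(1) by (rule borel_measurable_continuous_onI)
    have "(\<lambda>n. \<integral>x. g x \<partial>\<gamma> (r n)) \<longlonglongrightarrow> (\<integral>x. g x \<partial>M)"
      unfolding Mint[OF gm] using g by (intro lim)
    moreover have "(\<integral>x. g x \<partial>\<gamma> (r n)) = (\<integral>x. f x \<partial>\<gamma> (r n))" for n
      by (intro Bochner_Integration.integral_cong) (auto simp: prob_measuresD(3)[OF \<gamma>] g)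
    moreover have "(\<integral>x. f x \<partial>\<gamma>') = (\<integral>x. indicator S x *\<^sub>R g x \<partial>M)"
      unfolding g'_int by (intro Bochner_Integration.integral_cong) (auto simp: g indicator_def)
    moreover have "(\<integral>x. indicator S x *\<^sub>R g x \<partial>M) = (\<integral>x. g x \<partial>M)"
      using AE meas_M[OF gm] SM by (intro integral_cong_AE) auto
    ultimately show ?thesis by simp
  qed
  ultimately show ?thesis using r that by blast
qed

section \<open>Couplings\<close>

lemma compact_set_power:
  fixes \<Omega> :: "(real ^ 'd) set"
  assumes "compact \<Omega>"
  shows "compact (set_power \<Omega> :: (real ^ 'd ^ 'k::finite) set)"
  unfolding compact_eq_bounded_closed
proof
  obtain B where B: "\<And>x. x \<in> \<Omega> \<Longrightarrow> norm x \<le> B"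
    using compact_imp_bounded[OF assms] by (auto simp: bounded_iff)
  have "norm x \<le> (\<Sum>l\<in>(UNIV :: 'k set). B)" if "x \<in> set_power \<Omega>" for x :: "real ^ 'd ^ 'k"
  proof -
    have "norm x \<le> (\<Sum>l\<in>UNIV. norm (x $ l))"
      unfolding norm_vec_def by (rule L2_set_le_sum) simp
    also have "\<dots> \<le> (\<Sum>l\<in>(UNIV :: 'k set). B)"
      using that B by (intro sum_mono) (auto simp: set_power_def)
    finally show ?thesis .
  qed
  then show "bounded (set_power \<Omega> :: (real ^ 'd ^ 'k) set)" by (auto simp: bounded_iff)
  have "set_power \<Omega> = (\<Inter>l. (\<lambda>x :: real ^ 'd ^ 'k. x $ l) -` \<Omega>)"
    by (auto simp: set_power_def)
  then show "closed (set_power \<Omega> :: (real ^ 'd ^ 'k) set)"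
    using compact_imp_closed[OF assms]
    by (auto intro!: closed_INT closed_vimage continuous_intros)
qed

lemma convex_set_power:
  fixes \<Omega> :: "(real ^ 'd) set"
  shows "convex \<Omega> \<Longrightarrow> convex (set_power \<Omega> :: (real ^ 'd ^ 'k) set)"
  by (auto simp: set_power_def convex_def)

lemma power2_norm_vec_eq_sum:
  fixes x :: "'a::real_inner ^ 'k::finite"
  shows "(norm x)\<^sup>2 = (\<Sum>l\<in>UNIV. (norm (x $ l))\<^sup>2)"
  by (simp add: power2_norm_eq_inner inner_vec_def)

lemma measurable_coord:
  assumes "\<gamma> \<in> prob_measures (set_power \<Omega>)"
  shows "(\<lambda>x :: real ^ 'd ^ 'k::finite. x $ l) \<in> measurable \<gamma> (borel_on \<Omega>)"
proof (rule measurable_restrict_space2)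
  show "(\<lambda>x. x $ l) \<in> borel_measurable \<gamma>"
    by (rule borel_measurable_prob_measures[OF borel_measurable_continuous_onI assms])
      (intro continuous_intros)
qed (use assms in \<open>auto simp: prob_measuresD(3) set_power_def\<close>)

lemma marginal_in_prob_measures:
  fixes \<gamma> :: "(real ^ 'd ^ 'k::finite) measure"
  assumes "\<gamma> \<in> prob_measures (set_power \<Omega>)"
  shows "marginal \<Omega> l \<gamma> \<in> prob_measures \<Omega>"
  using prob_space.prob_space_distr[OF prob_measuresD(1)[OF assms] measurable_coord[OF assms]]
  by (auto simp: marginal_def prob_measures_def)

lemma integral_marginal:
  fixes \<gamma> :: "(real ^ 'd ^ 'k::finite) measure" and f :: "real ^ 'd \<Rightarrow> real"
  assumes "\<gamma> \<in> prob_measures (set_power \<Omega>)" "continuous_on \<Omega> f"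
  shows "(\<integral>x. f x \<partial>marginal \<Omega> l \<gamma>) = (\<integral>x. f (x $ l) \<partial>\<gamma>)"
  unfolding marginal_def
  by (rule integral_distr[OF measurable_coord[OF assms(1)] borel_measurable_continuous_on_restrict[OF assms(2)]])

text \<open>The independent coupling is a witness: the image of the product measure when functions
  on the index type are read as vectors.\<close>

lemma couplings_nonempty:
  fixes \<mu> :: "'k::finite \<Rightarrow> (real ^ 'd) measure"
  assumes \<mu>: "\<And>l. \<mu> l \<in> prob_measures \<Omega>"
  shows "couplings \<Omega> \<mu> \<noteq> {}"
proof -
  let ?P = "PiM UNIV \<mu>" and ?S = "set_power \<Omega> :: (real ^ 'd ^ 'k) set"
  have p: "prob_space (\<mu> l)" for l using \<mu> by (rule prob_measuresD)
  interpret P: prob_space ?P using p by (rule prob_space_PiM)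
  have space: "space ?P = {f. \<forall>l. f l \<in> \<Omega>}"
    by (auto simp: space_PiM prob_measuresD(3)[OF \<mu>] PiE_def extensional_def)
  have comp: "(\<lambda>f. f l) \<in> borel_measurable ?P" for l
    using measurable_compose[OF measurable_component_singleton[of l UNIV \<mu>]
        borel_measurable_prob_measures[OF measurable_ident \<mu>]] by simp
  have "(\<lambda>f. \<chi> l. f l) \<in> borel_measurable ?P"
  proof (rule borel_measurable_euclidean_space[THEN iffD2], rule ballI)
    fix b :: "real ^ 'd ^ 'k"
    have "(\<lambda>f. (\<chi> l. f l) \<bullet> b) = (\<lambda>f. \<Sum>l\<in>UNIV. f l \<bullet> b $ l)"
      by (auto simp: inner_vec_def)
    then show "(\<lambda>f. (\<chi> l. f l) \<bullet> b) \<in> borel_measurable ?P"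
      using comp by (auto intro!: borel_measurable_sum borel_measurable_inner)
  qed
  then have m: "(\<lambda>f. \<chi> l. f l) \<in> measurable ?P (borel_on ?S)"
    by (intro measurable_restrict_space2) (auto simp: space set_power_def)
  define \<gamma> where "\<gamma> = distr ?P (borel_on ?S) (\<lambda>f. \<chi> l. f l)"
  have \<gamma>: "\<gamma> \<in> prob_measures ?S"
    using P.prob_space_distr[OF m] by (auto simp: \<gamma>_def prob_measures_def)
  have "marginal \<Omega> l \<gamma> = \<mu> l" for l
  proof -
    have "marginal \<Omega> l \<gamma> = distr ?P (borel_on \<Omega>) ((\<lambda>x. x $ l) \<circ> (\<lambda>f. \<chi> l. f l))"
      unfolding marginal_def \<gamma>_def
      using m measurable_coord[OF \<gamma>, of l] by (intro distr_distr) (auto simp: \<gamma>_def)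
    also have "\<dots> = distr ?P (\<mu> l) (\<lambda>f. f l)"
      using prob_measuresD(2)[OF \<mu>, of l] by (intro distr_cong) (simp_all add: comp_def)
    also have "\<dots> = \<mu> l"
      using p by (intro distr_PiM_component) auto
    finally show ?thesis .
  qed
  with \<gamma> show ?thesis by (auto simp: couplings_def)
qed

text \<open>The marginal constraints survive the weak limit because a continuous function of one
  coordinate is a continuous function of \<open>x\<close>.\<close>

lemma couplings_seq_compact:
  fixes \<mu> :: "'k::finite \<Rightarrow> (real ^ 'd) measure"
  assumes \<Omega>: "compact \<Omega>" and \<mu>: "\<And>l. \<mu> l \<in> prob_measures \<Omega>"
    and \<gamma>: "\<And>n. \<gamma> n \<in> couplings \<Omega> \<mu>"
  obtains r :: "nat \<Rightarrow> nat" and \<gamma>' where "strict_mono r" "\<gamma>' \<in> couplings \<Omega> \<mu>"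
    "\<And>f :: _ \<Rightarrow> real. continuous_on (set_power \<Omega>) f \<Longrightarrow> (\<lambda>n. \<integral>x. f x \<partial>\<gamma> (r n)) \<longlonglongrightarrow> (\<integral>x. f x \<partial>\<gamma>')"
proof -
  have \<gamma>p: "\<gamma> n \<in> prob_measures (set_power \<Omega>)" and \<gamma>m: "marginal \<Omega> l (\<gamma> n) = \<mu> l" for n l
    using \<gamma>[of n] by (auto simp: couplings_def)
  obtain r \<gamma>' where r: "strict_mono (r :: nat \<Rightarrow> nat)" "\<gamma>' \<in> prob_measures (set_power \<Omega>)"
    and lim: "\<And>f :: _ \<Rightarrow> real. continuous_on (set_power \<Omega>) f \<Longrightarrow> (\<lambda>n. \<integral>x. f x \<partial>\<gamma> (r n)) \<longlonglongrightarrow> (\<integral>x. f x \<partial>\<gamma>')"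
    by (rule prob_measures_seq_compact[OF compact_set_power[OF \<Omega>], where \<gamma>=\<gamma>, OF \<gamma>p]) blast
  have "marginal \<Omega> l \<gamma>' = \<mu> l" for l
  proof (rule prob_measures_eqI[OF marginal_in_prob_measures[OF r(2)] \<mu>])
    fix f :: "real ^ 'd \<Rightarrow> real" assume f: "continuous_on UNIV f"
    then have fO: "continuous_on \<Omega> f" by (rule continuous_on_subset) simp
    have "(\<lambda>n. \<integral>x. f (x $ l) \<partial>\<gamma> (r n)) \<longlonglongrightarrow> (\<integral>x. f (x $ l) \<partial>\<gamma>')"
      by (intro lim continuous_on_compose2[OF f continuous_on_component[OF continuous_on_id]] subset_UNIV)
    then have "(\<lambda>n. \<integral>x. f x \<partial>\<mu> l) \<longlonglongrightarrow> (\<integral>x. f x \<partial>marginal \<Omega> l \<gamma>')"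
      using integral_marginal[OF \<gamma>p fO, of l] integral_marginal[OF r(2) fO, of l] \<gamma>m by simp
    then show "(\<integral>x. f x \<partial>marginal \<Omega> l \<gamma>') = (\<integral>x. f x \<partial>\<mu> l)"
      by (simp add: LIMSEQ_const_iff)
  qed
  with r lim that show ?thesis by (auto simp: couplings_def)
qed

text \<open>Direct method: a minimising sequence has a weakly convergent subsequence within the
  couplings, and the cost is weakly continuous because \<open>L\<close> is continuous on a compact
  set.\<close>

lemma static_minimizer_exists:
  fixes \<mu> :: "'k::finite \<Rightarrow> (real ^ 'd) measure"
  assumes \<Omega>: "compact \<Omega>" and \<mu>: "\<And>l. \<mu> l \<in> prob_measures \<Omega>"
    and L: "continuous_on (set_power \<Omega>) L"
  obtains \<gamma>' where "\<gamma>' \<in> couplings \<Omega> \<mu>" "\<And>\<gamma>. \<gamma> \<in> couplings \<Omega> \<mu> \<Longrightarrow> static_cost L \<gamma>' \<le> static_cost L \<gamma>"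
proof -
  let ?\<Gamma> = "couplings \<Omega> \<mu>" and ?S = "set_power \<Omega> :: (real ^ 'd ^ 'k) set"
  have "bounded (L ` ?S)"
    using L compact_set_power[OF \<Omega>] by (intro compact_imp_bounded compact_continuous_image)
  then obtain B where B: "\<And>x. x \<in> ?S \<Longrightarrow> \<bar>L x\<bar> \<le> B" by (auto simp: bounded_iff)
  have "- B \<le> static_cost L \<gamma>" if "\<gamma> \<in> ?\<Gamma>" for \<gamma>
  proof -
    have \<gamma>: "\<gamma> \<in> prob_measures ?S" using that by (simp add: couplings_def)
    interpret prob_space \<gamma> using \<gamma> by (rule prob_measuresD)
    have "(\<integral>x. - B \<partial>\<gamma>) \<le> (\<integral>x. L x \<partial>\<gamma>)"
    proof (rule integral_mono)
      show "integrable \<gamma> L"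
        using compact_set_power[OF \<Omega>] L \<gamma> by (rule continuous_on_integrable_prob_measures)
      show "- B \<le> L x" if "x \<in> space \<gamma>" for x
        using B[of x] that by (auto simp: prob_measuresD(3)[OF \<gamma>])
    qed simp
    then show ?thesis by (simp add: static_cost_def prob_space)
  qed
  then have bdd: "bdd_below (static_cost L ` ?\<Gamma>)" by (auto simp: bdd_below_def)
  define I where "I = (INF \<gamma>\<in>?\<Gamma>. static_cost L \<gamma>)"
  have "\<exists>\<gamma>\<in>?\<Gamma>. static_cost L \<gamma> < I + 1 / real (Suc n)" for n
    using couplings_nonempty[of \<mu>, OF \<mu>] bdd unfolding I_def by (subst cINF_less_iff[symmetric]) auto
  then obtain \<gamma> where \<gamma>: "\<And>n. \<gamma> n \<in> ?\<Gamma>" "\<And>n. static_cost L (\<gamma> n) < I + 1 / real (Suc n)"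
    by metis
  obtain r \<gamma>' where r: "strict_mono (r :: nat \<Rightarrow> nat)" "\<gamma>' \<in> ?\<Gamma>"
    and lim: "\<And>f :: _ \<Rightarrow> real. continuous_on ?S f \<Longrightarrow> (\<lambda>n. \<integral>x. f x \<partial>\<gamma> (r n)) \<longlonglongrightarrow> (\<integral>x. f x \<partial>\<gamma>')"
    by (rule couplings_seq_compact[OF \<Omega> \<mu>, where \<gamma>=\<gamma>, OF \<gamma>(1)]) blast
  have "static_cost L \<gamma>' \<le> I"
  proof (rule LIMSEQ_le)
    show "(\<lambda>n. static_cost L (\<gamma> (r n))) \<longlonglongrightarrow> static_cost L \<gamma>'"
      unfolding static_cost_def by (rule lim[OF L])
    have "(\<lambda>n. I + 1 / real (Suc n)) \<longlonglongrightarrow> I + 0"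
      by (intro tendsto_intros LIMSEQ_Suc lim_1_over_n)
    then show "((\<lambda>n. I + 1 / real (Suc n)) \<circ> r) \<longlonglongrightarrow> I"
      using LIMSEQ_subseq_LIMSEQ[OF _ r(1)] by fastforce
    show "\<exists>N. \<forall>n\<ge>N. static_cost L (\<gamma> (r n)) \<le> ((\<lambda>n. I + 1 / real (Suc n)) \<circ> r) n"
      using \<gamma>(2) by (auto intro: less_imp_le)
  qed
  moreover have "I \<le> static_cost L \<gamma>" if "\<gamma> \<in> ?\<Gamma>" for \<gamma>
    unfolding I_def using bdd that by (rule cINF_lower)
  ultimately show ?thesis using r(2) that by (meson order_trans)
qed

text \<open>The squared norm is a sum of functions of one coordinate each, so only the marginals
  enter.\<close>

lemma integral_power2_norm_coupling:
  fixes \<mu> :: "'k::finite \<Rightarrow> (real ^ 'd) measure"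
  assumes \<Omega>: "compact \<Omega>" and \<gamma>: "\<gamma> \<in> couplings \<Omega> \<mu>"
  shows "(\<integral>x. (norm x)\<^sup>2 \<partial>\<gamma>) = (\<Sum>l\<in>UNIV. \<integral>x. (norm x)\<^sup>2 \<partial>\<mu> l)"
proof -
  have p: "\<gamma> \<in> prob_measures (set_power \<Omega>)" and m: "\<And>l. marginal \<Omega> l \<gamma> = \<mu> l"
    using \<gamma> by (auto simp: couplings_def)
  have "(\<integral>x. (norm x)\<^sup>2 \<partial>\<gamma>) = (\<integral>x. (\<Sum>l\<in>UNIV. (norm (x $ l))\<^sup>2) \<partial>\<gamma>)"
    by (simp add: power2_norm_vec_eq_sum)
  also have "\<dots> = (\<Sum>l\<in>UNIV. \<integral>x. (norm (x $ l))\<^sup>2 \<partial>\<gamma>)"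
    by (intro Bochner_Integration.integral_sum continuous_on_integrable_prob_measures[OF compact_set_power[OF \<Omega>] _ p]
        continuous_intros)
  also have "\<dots> = (\<Sum>l\<in>UNIV. \<integral>x. (norm x)\<^sup>2 \<partial>\<mu> l)"
    using integral_marginal[OF p, of "\<lambda>x. (norm x)\<^sup>2"] by (simp add: m continuous_intros)
  finally show ?thesis .
qed

lemma integral_coupling_eq_static_cost:
  fixes \<mu> :: "'k::finite \<Rightarrow> (real ^ 'd) measure"
  assumes \<Omega>: "compact \<Omega>" and \<gamma>: "\<gamma> \<in> couplings \<Omega> \<mu>" and L: "continuous_on (set_power \<Omega>) L"
  shows "(\<integral>x. L x + \<alpha> / 2 * (norm x)\<^sup>2 \<partial>\<gamma>) =
    static_cost L \<gamma> + \<alpha> / 2 * (\<Sum>l\<in>UNIV. \<integral>x. (norm x)\<^sup>2 \<partial>\<mu> l)"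
proof -
  have p: "\<gamma> \<in> prob_measures (set_power \<Omega>)" using \<gamma> by (auto simp: couplings_def)
  note int = continuous_on_integrable_prob_measures[OF compact_set_power[OF \<Omega>] _ p]
  have "integrable \<gamma> (\<lambda>x. (norm x)\<^sup>2)" by (intro int continuous_intros)
  with int[OF L] show ?thesis
    by (simp add: static_cost_def integral_power2_norm_coupling[OF \<Omega> \<gamma>, symmetric])
qed

section \<open>Smooth convex minorants\<close>

text \<open>A hyperplane strictly separates the point \<open>(x0, F x0 - e)\<close> from the closed
  convex epigraph; solved for the last coordinate, it is the graph of the minorant.\<close>

lemma convex_affine_minorant:
  fixes F :: "'a::euclidean_space \<Rightarrow> real"
  assumes F: "convex_on UNIV F" and "e > 0"
  obtains a c where "\<And>x. a \<bullet> x + c \<le> F x" "F x0 - e < a \<bullet> x0 + c"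
proof -
  have cont: "continuous_on UNIV F" using F by (intro convex_on_continuous) auto
  have "closed (epigraph UNIV F)"
  proof -
    have "epigraph UNIV F = {p. F (fst p) \<le> snd p}" by (auto simp: epigraph_def)
    then show ?thesis
      by (auto intro!: closed_Collect_le continuous_intros continuous_on_compose2[OF cont])
  qed
  then obtain p b where p: "p \<bullet> (x0, F x0 - e) < b" "\<And>q. q \<in> epigraph UNIV F \<Longrightarrow> p \<bullet> q > b"
    using separating_hyperplane_closed_point[of "epigraph UNIV F" "(x0, F x0 - e)"]
      convex_epigraphI[OF F] \<open>e > 0\<close> by (auto simp: epigraph_def)
  obtain u w where uw: "p = (u, w)" by (cases p)
  have lt: "u \<bullet> x0 + w * (F x0 - e) < b" using p(1) by (simp add: uw)
  have gt: "b < u \<bullet> x + w * F x" for x using p(2)[of "(x, F x)"] by (simp add: uw epigraph_def)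
  \<comment> \<open>Comparing the two strict inequalities at \<open>x0\<close> rules out a vertical
    hyperplane.\<close>
  have "0 < w * e" using lt gt[of x0] by (simp add: algebra_simps)
  then have w: "w > 0" using \<open>e > 0\<close> by (simp add: zero_less_mult_iff)
  show thesis
  proof
    show "(- (1 / w) *\<^sub>R u) \<bullet> x + b / w \<le> F x" for x
      using gt[of x] w by (simp add: field_simps)
    show "F x0 - e < (- (1 / w) *\<^sub>R u) \<bullet> x0 + b / w"
      using lt w by (simp add: field_simps)
  qed
qed

text \<open>Each affine minorant is \<open>e\<close>-close to \<open>F\<close> on an open set. These
  sets cover the space, and compactness of \<open>S\<close> leaves finitely many of them.\<close>

lemma convex_finite_affine_minorants:
  fixes F :: "'a::euclidean_space \<Rightarrow> real"
  assumes F: "convex_on UNIV F" and S: "compact S" and "e > 0"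
  obtains I :: "('a \<times> real) set" where "finite I" "I \<noteq> {}"
    "\<And>a c x. (a, c) \<in> I \<Longrightarrow> a \<bullet> x + c \<le> F x"
    "\<And>x. x \<in> S \<Longrightarrow> \<exists>(a, c)\<in>I. F x - e < a \<bullet> x + c"
proof -
  have cont: "continuous_on UNIV F" using F by (intro convex_on_continuous) auto
  define A where "A = {(a, c). \<forall>x. a \<bullet> x + c \<le> F x}"
  define U where "U = (\<lambda>(a, c). {x. F x - e < a \<bullet> x + c})"
  have U: "open (U p)" for p
    unfolding U_def by (cases p) (auto intro!: open_Collect_less continuous_intros cont)
  have cover: "\<exists>p\<in>A. x \<in> U p" for x
    by (rule convex_affine_minorant[OF F \<open>e > 0\<close>, of x]) (auto simp: A_def U_def)
  have "S \<subseteq> (\<Union>p\<in>A. U p)" using cover by blast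
  then obtain J where J: "J \<subseteq> A" "finite J" "S \<subseteq> (\<Union>p\<in>J. U p)"
    using compactE_image[OF S, of A U] U by metis
  \<comment> \<open>An extra minorant keeps the family nonempty even when \<open>S\<close> is
    empty.\<close>
  obtain p0 where "p0 \<in> A" using cover by blast
  show thesis
  proof (rule that[of "insert p0 J"])
    show "\<exists>(a, c)\<in>insert p0 J. F x - e < a \<bullet> x + c" if "x \<in> S" for x
      using J(3) that by (auto simp: U_def)
    show "a \<bullet> x + c \<le> F x" if "(a, c) \<in> insert p0 J" for a c x
      using J(1) \<open>p0 \<in> A\<close> that by (auto simp: A_def)
  qed (use J(2) in auto)
qed

text \<open>The minorant is the normalised log-sum-exp of finitely many affine minorants.\<close>

lemma smooth_convex_minorant:
  fixes F :: "'a::euclidean_space \<Rightarrow> real"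
  assumes F: "convex_on UNIV F" and S: "compact S" and "e > 0"
  obtains G :: "'a \<Rightarrow> real" and D where
    "\<And>x. (G has_derivative (\<lambda>h. D x \<bullet> h)) (at x)" "continuous_on UNIV D"
    "\<And>x v. G x + D x \<bullet> (v - x) \<le> G v" "\<And>v. G v \<le> F v"
    "\<And>x. x \<in> S \<Longrightarrow> F x - e \<le> G x"
proof -
  have "e / 2 > 0" using \<open>e > 0\<close> by simp
  obtain I :: "('a \<times> real) set" where I: "finite I" "I \<noteq> {}"
    and le: "\<And>a c x. (a, c) \<in> I \<Longrightarrow> a \<bullet> x + c \<le> F x"
    and ge: "\<And>x. x \<in> S \<Longrightarrow> \<exists>(a, c)\<in>I. F x - e / 2 < a \<bullet> x + c"
    using convex_finite_affine_minorants[OF F S \<open>e / 2 > 0\<close>] by metis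
  define n where "n = real (card I)"
  have n: "n \<ge> 1" using I by (simp add: n_def card_gt_0_iff Suc_le_eq)
  \<comment> \<open>Log-sum-exp with parameter \<open>\<beta>\<close> exceeds the maximum of
    \<open>n\<close> terms by at most \<open>ln n / \<beta>\<close>. Subtracting this amount gives
    \<open>G \<le> F\<close>, and half of \<open>e\<close> is reserved for it. The summand 1 in the
    witness keeps \<open>\<beta>\<close> positive when \<open>n = 1\<close>.\<close>
  obtain \<beta> where \<beta>: "\<beta> > 0" "ln n / \<beta> \<le> e / 2"
  proof
    show "2 * (ln n + 1) / e > 0" using \<open>e > 0\<close> n by (intro divide_pos_pos) (auto simp: add_nonneg_pos)
    have "e / 2 * (ln n / (ln n + 1)) \<le> e / 2 * 1"
      using \<open>e > 0\<close> ln_ge_zero[OF n] by (intro mult_left_mono) auto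
    then show "ln n / (2 * (ln n + 1) / e) \<le> e / 2" by (simp add: mult.commute)
  qed
  define E where "E p x = exp (\<beta> * (fst p \<bullet> x + snd p))" for p :: "'a \<times> real" and x
  define Z where "Z x = (\<Sum>p\<in>I. E p x)" for x
  define G where "G x = (ln (Z x) - ln n) / \<beta>" for x
  \<comment> \<open>The gradient of \<open>G\<close>: the average of the slopes with weights
    \<open>E p x / Z x\<close>.\<close>
  define D where "D x = (1 / Z x) *\<^sub>R (\<Sum>p\<in>I. E p x *\<^sub>R fst p)" for x
  have Epos: "E p x > 0" for p x by (simp add: E_def)
  have Z: "Z x > 0" for x unfolding Z_def using I Epos by (intro sum_pos) auto
  show thesis
  proof
    have dE: "(E p has_derivative (\<lambda>h. E p x * (\<beta> * (fst p \<bullet> h)))) (at x)" for p x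
      unfolding E_def by (auto intro!: derivative_eq_intros)
    have "(Z has_derivative (\<lambda>h. \<Sum>p\<in>I. E p x * (\<beta> * (fst p \<bullet> h)))) (at x)" for x
      unfolding Z_def by (intro has_derivative_sum dE)
    then have "(G has_derivative (\<lambda>h. (1 / Z x * (\<Sum>p\<in>I. E p x * (\<beta> * (fst p \<bullet> h)))) / \<beta>)) (at x)" for x
      unfolding G_def using Z[of x] \<beta>(1)
      by (auto intro!: derivative_eq_intros simp: field_simps)
    moreover have "(1 / Z x * (\<Sum>p\<in>I. E p x * (\<beta> * (fst p \<bullet> h)))) / \<beta> = D x \<bullet> h" for x h
    proof -
      have "(\<Sum>p\<in>I. E p x * (\<beta> * (fst p \<bullet> h))) = \<beta> * (\<Sum>p\<in>I. E p x * (fst p \<bullet> h))"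
        by (simp add: sum_distrib_left algebra_simps)
      then show ?thesis using \<beta>(1) by (simp add: D_def inner_sum_left)
    qed
    ultimately show "(G has_derivative (\<lambda>h. D x \<bullet> h)) (at x)" for x by simp
    show "continuous_on UNIV D"
      unfolding D_def Z_def E_def using Z
      by (intro continuous_intros ballI) (auto simp: Z_def E_def less_imp_neq[symmetric])
    show "G v \<le> F v" for v
    proof -
      have "Z v \<le> (\<Sum>p\<in>I. exp (\<beta> * F v))"
        unfolding Z_def E_def using le \<beta>(1) by (intro sum_mono) auto
      then have "Z v \<le> n * exp (\<beta> * F v)" by (simp add: n_def)
      then have "ln (Z v) \<le> ln (n * exp (\<beta> * F v))" using Z n by (subst ln_le_cancel_iff) auto
      also have "\<dots> = ln n + \<beta> * F v" using n by (simp add: ln_mult)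
      finally show ?thesis using \<beta>(1) by (simp add: G_def field_simps)
    qed
    show "F x - e \<le> G x" if "x \<in> S" for x
    proof -
      obtain a c where ac: "(a, c) \<in> I" "F x - e / 2 < a \<bullet> x + c" using ge[OF \<open>x \<in> S\<close>] by auto
      have "exp (\<beta> * (a \<bullet> x + c)) \<le> Z x"
        unfolding Z_def using member_le_sum[OF ac(1), of "\<lambda>p. E p x"] I Epos
        by (auto simp: E_def less_imp_le)
      then have "\<beta> * (a \<bullet> x + c) \<le> ln (Z x)" using Z by (simp add: ln_ge_iff)
      then have "a \<bullet> x + c \<le> ln (Z x) / \<beta>" using \<beta>(1) by (simp add: pos_le_divide_eq mult.commute)
      then have "a \<bullet> x + c - ln n / \<beta> \<le> G x" by (simp add: G_def diff_divide_distrib)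
      then show ?thesis using ac(2) \<beta>(2) by linarith
    qed
    show "G x + D x \<bullet> (v - x) \<le> G v" for x v
    proof -
      \<comment> \<open>Jensen's inequality for \<open>exp\<close>: \<open>m\<close> is the mean of
        the increments \<open>\<delta> p\<close> under the weights \<open>E p x / Z x\<close>, so
        the tangent of \<open>exp\<close> at \<open>m\<close> bounds \<open>Z v\<close> from below
        by \<open>Z x * exp m\<close>.\<close>
      define m where "m = \<beta> * (D x \<bullet> (v - x))"
      define \<delta> where "\<delta> p = \<beta> * (fst p \<bullet> (v - x))" for p :: "'a \<times> real"
      have Ev: "E p v = E p x * exp (\<delta> p)" for p
        by (simp add: E_def \<delta>_def algebra_simps flip: exp_add)
      have m: "(\<Sum>p\<in>I. E p x * \<delta> p) = Z x * m"
        using Z[of x] by (simp add: m_def D_def \<delta>_def inner_sum_left sum_distrib_left sum_subtractf algebra_simps)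
      have "Z x * exp m = exp m * (\<Sum>p\<in>I. E p x * (1 + (\<delta> p - m)))"
        using m by (simp add: Z_def algebra_simps sum.distrib sum_subtractf sum_distrib_left)
      also have "\<dots> = (\<Sum>p\<in>I. E p x * (exp m * (1 + (\<delta> p - m))))"
        by (simp add: sum_distrib_left algebra_simps)
      also have "\<dots> \<le> (\<Sum>p\<in>I. E p x * exp (\<delta> p))"
      proof (intro sum_mono mult_left_mono)
        fix p :: "'a \<times> real"
        have "exp m * (1 + (\<delta> p - m)) \<le> exp m * exp (\<delta> p - m)"
          by (intro mult_left_mono exp_ge_add_one_self) auto
        then show "exp m * (1 + (\<delta> p - m)) \<le> exp (\<delta> p)" by (simp flip: exp_add)
      qed (use Epos in \<open>auto simp: less_imp_le\<close>)
      also have "\<dots> = Z v" by (simp add: Z_def Ev)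
      finally have "ln (Z x * exp m) \<le> ln (Z v)" using Z by (subst ln_le_cancel_iff) auto
      then have "ln (Z x) + m \<le> ln (Z v)" using Z[of x] by (simp add: ln_mult)
      then have "(ln (Z x) + m - ln n) / \<beta> \<le> (ln (Z v) - ln n) / \<beta>"
        using \<beta>(1) by (intro divide_right_mono) auto
      then show ?thesis using \<beta>(1) by (simp add: G_def m_def add_divide_distrib diff_divide_distrib)
    qed
  qed
qed

section \<open>The lower bound for the action\<close>

text \<open>Continuity into a generated topology need only be tested on the generators. The
  generator with \<open>f = 0\<close> and \<open>U = UNIV\<close> is all of
  \<open>prob_measures S\<close>, which identifies the underlying space of the topology.\<close>

lemma continuous_map_weak_topology:
  "continuous_map (top_of_set T) (weak_topology S) \<pi> \<longleftrightarrow>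
    (\<forall>t\<in>T. \<pi> t \<in> prob_measures S) \<and>
    (\<forall>f :: 'a::topological_space \<Rightarrow> real. continuous_on S f \<longrightarrow> bounded (f ` S) \<longrightarrow> continuous_on T (\<lambda>t. \<integral>x. f x \<partial>\<pi> t))"
  (is "?L \<longleftrightarrow> ?P \<and> ?C")
proof -
  let ?B = "\<lambda>(f :: 'a \<Rightarrow> real) U. {M \<in> prob_measures S. (\<integral>x. f x \<partial>M) \<in> U}"
  let ?G = "{?B f U | (f :: 'a \<Rightarrow> real) U. continuous_on S f \<and> bounded (f ` S) \<and> open U}"
  have UG: "\<Union>?G = prob_measures S"
  proof
    have "prob_measures S = ?B (\<lambda>_. 0) UNIV" by simp
    moreover have "?B (\<lambda>_. 0) UNIV \<in> ?G"
      by (intro CollectI exI[of _ "\<lambda>_. 0"] exI[of _ UNIV]) (auto simp: bounded_iff)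
    ultimately show "prob_measures S \<subseteq> \<Union>?G" by (metis (no_types, lifting) Union_upper)
  qed blast
  have all_image: "(\<forall>X. X \<in> {h f U | f U. continuous_on S f \<and> bounded (f ` S) \<and> open U} \<longrightarrow> Q X) \<longleftrightarrow>
      (\<forall>(f :: 'a \<Rightarrow> real) U. continuous_on S f \<longrightarrow> bounded (f ` S) \<longrightarrow> open U \<longrightarrow> Q (h f U))"
    for h :: "('a \<Rightarrow> real) \<Rightarrow> real set \<Rightarrow> 'a measure set" and Q by blast
  have "?L \<longleftrightarrow> ((\<forall>U. U \<in> ?G \<longrightarrow> openin (top_of_set T) (\<pi> -` U \<inter> T)) \<and> \<pi> ` T \<subseteq> prob_measures S)"
    unfolding weak_topology_def continuous_on_generated_topo_iff UG by simp
  also have "\<dots> \<longleftrightarrow> ?P \<and> (\<forall>(f :: 'a \<Rightarrow> real) U. continuous_on S f \<longrightarrow> bounded (f ` S) \<longrightarrow> open U \<longrightarrow>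
      openin (top_of_set T) (\<pi> -` ?B f U \<inter> T))"
    unfolding all_image by (simp add: image_subset_iff conj_commute)
  also have "\<dots> \<longleftrightarrow> ?P \<and> (\<forall>(f :: 'a \<Rightarrow> real) U. continuous_on S f \<longrightarrow> bounded (f ` S) \<longrightarrow> open U \<longrightarrow>
      openin (top_of_set T) (T \<inter> (\<lambda>t. \<integral>x. f x \<partial>\<pi> t) -` U))"
  proof (rule conj_cong[OF refl])
    assume ?P
    then have "\<pi> -` ?B f U \<inter> T = T \<inter> (\<lambda>t. \<integral>x. f x \<partial>\<pi> t) -` U" for f U by auto
    then show "(\<forall>(f :: 'a \<Rightarrow> real) U. continuous_on S f \<longrightarrow> bounded (f ` S) \<longrightarrow> open U \<longrightarrow>
        openin (top_of_set T) (\<pi> -` ?B f U \<inter> T)) \<longleftrightarrow>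
      (\<forall>(f :: 'a \<Rightarrow> real) U. continuous_on S f \<longrightarrow> bounded (f ` S) \<longrightarrow> open U \<longrightarrow>
        openin (top_of_set T) (T \<inter> (\<lambda>t. \<integral>x. f x \<partial>\<pi> t) -` U))"
      by simp
  qed
  also have "\<dots> \<longleftrightarrow> ?P \<and> ?C"
    unfolding continuous_openin_preimage_eq by blast
  finally show ?thesis .
qed

lemma continuous_on_slice:
  assumes f: "continuous_on (T \<times> S) (\<lambda>(t, x). f t x)" and t: "t \<in> T"
  shows "continuous_on S (f t)"
proof -
  have "continuous_on S (\<lambda>x. case (t, x) of (t, x) \<Rightarrow> f t x)"
    by (rule continuous_on_compose2[OF f continuous_on_Pair[OF continuous_on_const continuous_on_id]])
      (use t in auto)
  then show ?thesis by simp
qed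

text \<open>By uniform continuity on the compact product, replacing \<open>f t\<close> by
  \<open>f t0\<close> costs at most \<open>e / 2\<close> whatever the probability measure; weak
  continuity for the fixed function \<open>f t0\<close> supplies the rest.\<close>

lemma continuous_on_integral_weakly_continuous:
  fixes f :: "real \<Rightarrow> 'a::metric_space \<Rightarrow> real"
  assumes S: "compact S" and T: "compact T"
    and \<pi>: "continuous_map (top_of_set T) (weak_topology S) \<pi>"
    and f: "continuous_on (T \<times> S) (\<lambda>(t, x). f t x)"
  shows "continuous_on T (\<lambda>t. \<integral>x. f t x \<partial>\<pi> t)"
  unfolding continuous_on_iff
proof (intro ballI allI impI)
  fix t0 e :: real assume t0: "t0 \<in> T" and e: "e > 0"
  have p: "\<pi> t \<in> prob_measures S" if "t \<in> T" for t
    using \<pi> that by (simp add: continuous_map_weak_topology)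
  have ft: "continuous_on S (f t)" if "t \<in> T" for t
    using f that by (rule continuous_on_slice)
  have "bounded (f t0 ` S)"
    using S ft[OF t0] by (intro compact_imp_bounded compact_continuous_image)
  then have "continuous_on T (\<lambda>t. \<integral>x. f t0 x \<partial>\<pi> t)"
    using \<pi> ft[OF t0] by (simp add: continuous_map_weak_topology)
  then obtain d1 where d1: "d1 > 0"
    "\<And>t. t \<in> T \<Longrightarrow> dist t t0 < d1 \<Longrightarrow> dist (\<integral>x. f t0 x \<partial>\<pi> t) (\<integral>x. f t0 x \<partial>\<pi> t0) < e / 2"
    using t0 e unfolding continuous_on_iff by (meson half_gt_zero)
  have "uniformly_continuous_on (T \<times> S) (\<lambda>(t, x). f t x)"
    using S T f by (intro compact_uniformly_continuous compact_Times)
  then obtain d2 where d2: "d2 > 0"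
    "\<And>p q. p \<in> T \<times> S \<Longrightarrow> q \<in> T \<times> S \<Longrightarrow> dist q p < d2 \<Longrightarrow>
      dist (case q of (t, x) \<Rightarrow> f t x) (case p of (t, x) \<Rightarrow> f t x) < e / 2"
    using e unfolding uniformly_continuous_on_def by (meson half_gt_zero)
  have "dist (\<integral>x. f t x \<partial>\<pi> t) (\<integral>x. f t0 x \<partial>\<pi> t0) < e" if t: "t \<in> T" "dist t t0 < min d1 d2" for t
  proof -
    interpret prob_space "\<pi> t" using p[OF t(1)] by (rule prob_measuresD)
    have int: "integrable (\<pi> t) (f s)" if "s \<in> T" for s
      using S ft[OF that] p[OF t(1)] by (rule continuous_on_integrable_prob_measures)
    have b: "\<bar>f t x - f t0 x\<bar> \<le> e / 2" if "x \<in> S" for x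
      using d2(2)[of "(t0, x)" "(t, x)"] that t t0 by (auto simp: dist_Pair_Pair dist_real_def)
    have "\<bar>(\<integral>x. f t x \<partial>\<pi> t) - (\<integral>x. f t0 x \<partial>\<pi> t)\<bar> = \<bar>\<integral>x. f t x - f t0 x \<partial>\<pi> t\<bar>"
      using int t(1) t0 by simp
    also have "\<dots> \<le> (\<integral>x. \<bar>f t x - f t0 x\<bar> \<partial>\<pi> t)" by (rule integral_abs_bound)
    also have "\<dots> \<le> (\<integral>x. e / 2 \<partial>\<pi> t)"
      using int t(1) t0 b by (intro integral_mono) (auto simp: prob_measuresD(3)[OF p[OF t(1)]])
    also have "\<dots> = e / 2" by (simp add: prob_space)
    finally have "\<bar>(\<integral>x. f t x \<partial>\<pi> t) - (\<integral>x. f t0 x \<partial>\<pi> t)\<bar> \<le> e / 2" .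
    moreover have "dist t t0 < d1" using t(2) by simp
    note d1(2)[OF t(1) this]
    ultimately show ?thesis unfolding dist_real_def by linarith
  qed
  then show "\<exists>d>0. \<forall>t\<in>T. dist t t0 < d \<longrightarrow> dist (\<integral>x. f t x \<partial>\<pi> t) (\<integral>x. f t0 x \<partial>\<pi> t0) < e"
    using d1(1) d2(1) by (intro exI[of _ "min d1 d2"]) auto
qed

section \<open>Measurability in time of the pairing with the momentum\<close>

lemma sets_borel_on_section:
  fixes S :: "'a::second_countable_topology set" and T :: "real set"
  assumes B: "B \<in> sets (borel_on (T \<times> S))" and t: "t \<in> T"
  shows "Pair t -` B \<in> sets (borel_on S)"
proof -
  have "Pair t \<in> borel_measurable borel"
    by (intro borel_measurable_continuous_onI continuous_intros)
  then have "Pair t \<in> measurable (borel_on S) (borel_on (T \<times> S))"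
    using t by (intro measurable_restrict_space2 measurable_restrict_space1) (auto simp: space_restrict_space)
  from measurable_sets[OF this B] have "Pair t -` B \<inter> S \<in> sets (borel_on S)"
    by (simp add: space_restrict_space)
  moreover have "B \<subseteq> T \<times> S"
    using sets.sets_into_space[OF B] by (simp add: space_restrict_space)
  then have "Pair t -` B \<inter> S = Pair t -` B" by auto
  ultimately show ?thesis by simp
qed

text \<open>The velocities are not known to fit together measurably in time, so \<open>g\<close> is
  approximated instead. For a simple function of \<open>(t, x)\<close> the pairing is a finite sum
  of terms \<open>y \<bullet> m t (Pair t -\<close> followed by a level set, and these are
  measurable in \<open>t\<close> by the slice condition. Dominated convergence inside each slice,
  with bound \<open>2 * K * norm v\<close>, carries this over to \<open>g\<close>.\<close>

lemma vector_integral_measurable: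
  fixes S :: "'a::euclidean_space set"
  assumes m: "m \<in> sliced_vector_measures S"
    and p: "\<And>t. t \<in> {0..1} \<Longrightarrow> \<pi> t \<in> prob_measures S"
    and ac: "\<And>t. t \<in> {0..1} \<Longrightarrow> vector_abs_cont (\<pi> t) (m t)"
    and S: "compact S"
    and g: "continuous_on ({0..1} \<times> S) (\<lambda>(t, x). g t x)"
  shows "(\<lambda>t. indicator {0..1} t *\<^sub>R vector_integral (\<pi> t) (m t) (g t)) \<in> borel_measurable lebesgue"
proof -
  let ?X = "{0..1} \<times> S" and ?v = "\<lambda>t. vector_RN_deriv (\<pi> t) (m t)"
  have vm: "vector_measure (\<pi> t) (m t)" if "t \<in> {0..1}" for t
    using m that prob_measuresD(2)[OF p[OF that]]
    by (auto simp: sliced_vector_measures_def vector_measure_def)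
  have fin: "finite_measure (\<pi> t)" if "t \<in> {0..1}" for t
    using prob_measuresD(1)[OF p[OF that]] by (simp add: prob_space_def)
  note v = vector_RN_deriv[OF fin vm ac]
  have "(\<lambda>(t, x). g t x) \<in> borel_measurable (borel_on ?X)"
    using g by (rule borel_measurable_continuous_on_restrict)
  from borel_measurable_implies_sequence_metric[OF this, of 0]
  obtain s where s': "\<forall>i. simple_function (borel_on ?X) (s i)"
      "\<forall>q\<in>space (borel_on ?X). (\<lambda>i. s i q) \<longlonglongrightarrow> (case q of (t, x) \<Rightarrow> g t x)"
      "\<forall>i. \<forall>q\<in>space (borel_on ?X). dist (s i q) 0 \<le> 2 * dist (case q of (t, x) \<Rightarrow> g t x) 0"
    by blast
  have s: "simple_function (borel_on ?X) (s i)" for i using s'(1) by blast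
  have lim: "(\<lambda>i. s i (t, x)) \<longlonglongrightarrow> g t x" if "t \<in> {0..1}" "x \<in> S" for t x
    using s'(2) that by (auto simp: space_restrict_space)
  have bd: "norm (s i (t, x)) \<le> 2 * norm (g t x)" if "t \<in> {0..1}" "x \<in> S" for i t x
    using s'(3) that by (auto simp: space_restrict_space)
  have "bounded ((\<lambda>(t, x). g t x) ` ?X)"
    using S g by (intro compact_imp_bounded compact_continuous_image compact_Times) auto
  then obtain K where K: "\<And>t x. t \<in> {0..1} \<Longrightarrow> x \<in> S \<Longrightarrow> norm (g t x) \<le> K"
    unfolding bounded_iff by (metis (no_types, lifting) SigmaI case_prod_conv image_eqI)
  define B where "B i y = s i -` {y} \<inter> ?X" for i y
  have B: "B i y \<in> sets (borel_on ?X)" for i y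
    using simple_functionD(2)[OF s, of i "{y}"] by (simp add: B_def space_restrict_space)
  have finr: "finite (s i ` ?X)" for i
    using simple_functionD(1)[OF s[of i]] by (simp add: space_restrict_space)
  define J where "J i t = (\<Sum>y\<in>s i ` ?X. y \<bullet> m t (Pair t -` B i y))" for i t
  have J: "(\<integral>x. s i (t, x) \<bullet> ?v t x \<partial>\<pi> t) = J i t" "(\<lambda>x. s i (t, x) \<bullet> ?v t x) \<in> borel_measurable (\<pi> t)"
    if t: "t \<in> {0..1}" for i t
  proof -
    have sec: "Pair t -` B i y \<in> sets (\<pi> t)" for y
      using sets_borel_on_section[OF B t] prob_measuresD(2)[OF p[OF t]] by simp
    have int: "integrable (\<pi> t) (\<lambda>x. y \<bullet> (indicator (Pair t -` B i y) x *\<^sub>R ?v t x))" for y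
      by (intro integrable_inner_right integrable_mult_indicator sec v t)
    have eq: "s i (t, x) \<bullet> ?v t x = (\<Sum>y\<in>s i ` ?X. y \<bullet> (indicator (Pair t -` B i y) x *\<^sub>R ?v t x))"
      if "x \<in> space (\<pi> t)" for x
    proof -
      have x: "x \<in> S" using that by (simp add: prob_measuresD(3)[OF p[OF t]])
      have "(\<Sum>y\<in>s i ` ?X. y \<bullet> (indicator (Pair t -` B i y) x *\<^sub>R ?v t x)) =
          (\<Sum>y\<in>s i ` ?X. if y = s i (t, x) then y \<bullet> ?v t x else 0)"
        using x t by (intro sum.cong) (auto simp: B_def indicator_def)
      also have "\<dots> = s i (t, x) \<bullet> ?v t x"
        using x t finr[of i] by (subst sum.delta) auto
      finally show ?thesis by simp
    qed
    have "(\<integral>x. s i (t, x) \<bullet> ?v t x \<partial>\<pi> t) = (\<integral>x. (\<Sum>y\<in>s i ` ?X. y \<bullet> (indicator (Pair t -` B i y) x *\<^sub>R ?v t x)) \<partial>\<pi> t)"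
      using eq by (rule Bochner_Integration.integral_cong[OF refl])
    also have "\<dots> = (\<Sum>y\<in>s i ` ?X. \<integral>x. y \<bullet> (indicator (Pair t -` B i y) x *\<^sub>R ?v t x) \<partial>\<pi> t)"
      by (rule Bochner_Integration.integral_sum) (rule int)
    also have "\<dots> = J i t"
      unfolding J_def
    proof (rule sum.cong[OF refl])
      fix y
      have "(\<integral>x. y \<bullet> (indicator (Pair t -` B i y) x *\<^sub>R ?v t x) \<partial>\<pi> t) =
          y \<bullet> (\<integral>x. indicator (Pair t -` B i y) x *\<^sub>R ?v t x \<partial>\<pi> t)"
        by (intro integral_inner_right integrable_mult_indicator sec v t)
      then show "(\<integral>x. y \<bullet> (indicator (Pair t -` B i y) x *\<^sub>R ?v t x) \<partial>\<pi> t) = y \<bullet> m t (Pair t -` B i y)"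
        using v(2)[OF t t t sec] by (simp add: set_lebesgue_integral_def)
    qed
    finally show "(\<integral>x. s i (t, x) \<bullet> ?v t x \<partial>\<pi> t) = J i t" .
    show "(\<lambda>x. s i (t, x) \<bullet> ?v t x) \<in> borel_measurable (\<pi> t)"
      using borel_measurable_integrable[OF Bochner_Integration.integrable_sum[OF int]]
      by (subst measurable_cong[OF eq]) auto
  qed
  have Jlim: "(\<lambda>i. J i t) \<longlonglongrightarrow> vector_integral (\<pi> t) (m t) (g t)" if t: "t \<in> {0..1}" for t
    unfolding J(1)[OF t, symmetric] vector_integral_def
  proof (rule integral_dominated_convergence[where w="\<lambda>x. 2 * K * norm (?v t x)"])
    have gt: "continuous_on S (g t)"
      using g t by (rule continuous_on_slice)
    show "(\<lambda>x. g t x \<bullet> ?v t x) \<in> borel_measurable (\<pi> t)"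
      using continuous_on_borel_measurable_prob_measures[OF gt p[OF t]] v(1)[OF t t t]
      by (intro borel_measurable_inner) auto
    show "integrable (\<pi> t) (\<lambda>x. 2 * K * norm (?v t x))"
      using v(1)[OF t t t] by (intro integrable_mult_right integrable_norm)
    show "AE x in \<pi> t. (\<lambda>i. s i (t, x) \<bullet> ?v t x) \<longlonglongrightarrow> g t x \<bullet> ?v t x"
      using lim[OF t] by (auto simp: prob_measuresD(3)[OF p[OF t]] intro!: tendsto_inner)
    have "norm (s i (t, x) \<bullet> ?v t x) \<le> 2 * K * norm (?v t x)" if "x \<in> S" for i x
    proof -
      have "norm (s i (t, x) \<bullet> ?v t x) \<le> norm (s i (t, x)) * norm (?v t x)"
        by (simp add: Cauchy_Schwarz_ineq2)
      also have "\<dots> \<le> 2 * K * norm (?v t x)"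
        using bd[OF t that, of i] K[OF t that] by (intro mult_right_mono) auto
      finally show ?thesis .
    qed
    then show "AE x in \<pi> t. norm (s i (t, x) \<bullet> ?v t x) \<le> 2 * K * norm (?v t x)" for i
      by (auto simp: prob_measuresD(3)[OF p[OF t]])
  qed (use J(2)[OF t] in auto)
  show ?thesis
  proof (rule borel_measurable_LIMSEQ_metric)
    show "(\<lambda>t. indicator {0..1} t *\<^sub>R J i t) \<in> borel_measurable lebesgue" for i
    proof -
      have "(\<lambda>t. indicator {0..1} t *\<^sub>R m t (Pair t -` B i y)) \<in> borel_measurable lebesgue" for y
        using m B[of i y] borel_measurable_integrable
        by (auto simp: sliced_vector_measures_def set_integrable_def)
      then have "(\<lambda>t. \<Sum>y\<in>s i ` ?X. y \<bullet> (indicator {0..1} t *\<^sub>R m t (Pair t -` B i y))) \<in> borel_measurable lebesgue"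
        by (intro borel_measurable_sum borel_measurable_inner) auto
      then show ?thesis by (simp add: J_def sum_distrib_left)
    qed
    show "(\<lambda>i. indicator {0..1} t *\<^sub>R J i t) \<longlonglongrightarrow> indicator {0..1} t *\<^sub>R vector_integral (\<pi> t) (m t) (g t)" for t
      using Jlim[of t] by (auto simp: indicator_def)
  qed
qed

section \<open>Inequalities for lower integrals\<close>

text \<open>Trades a difference in \<open>ereal\<close> for sums in \<open>ennreal\<close>. If
  \<open>A\<close> is infinite both sides hold, even for infinite \<open>B\<close>, because
  \<open>\<infinity> - \<infinity>\<close> equals \<open>\<infinity>\<close> in
  \<open>ereal\<close>.\<close>

lemma ereal_le_enn2ereal_diff_iff:
  assumes "0 \<le> p" "0 \<le> q"
  shows "ereal (p - q) \<le> enn2ereal A - enn2ereal B \<longleftrightarrow> ennreal p + B \<le> A + ennreal q"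
proof (cases A)
  case (real a)
  show ?thesis
  proof (cases B)
    case (real b)
    with \<open>A = ennreal a\<close> \<open>0 \<le> a\<close> assms show ?thesis
      by (auto simp: enn2ereal_ennreal simp flip: ennreal_plus)
  next
    case top
    with \<open>A = ennreal a\<close> \<open>0 \<le> a\<close> assms show ?thesis
      by (auto simp: enn2ereal_ennreal top_unique simp flip: ennreal_plus)
  qed
qed simp

text \<open>Additivity needs measurable summands, and \<open>b\<close> may fail to be measurable.
  The truncated difference of \<open>f\<close> and \<open>w\<close> is measurable and lies below
  \<open>b\<close>, so the splitting is done with it.\<close>

lemma nn_integral_le_add_lower:
  assumes f: "f \<in> borel_measurable M" and w: "w \<in> borel_measurable M"
    and le: "\<And>x. x \<in> space M \<Longrightarrow> f x \<le> ennreal (w x) + b x"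
  shows "(\<integral>\<^sup>+x. f x \<partial>M) \<le> (\<integral>\<^sup>+x. ennreal (w x) \<partial>M) + (\<integral>\<^sup>+x. b x \<partial>M)"
proof -
  have "(\<integral>\<^sup>+x. f x \<partial>M) \<le> (\<integral>\<^sup>+x. ennreal (w x) + (f x - ennreal (w x)) \<partial>M)"
    by (intro nn_integral_mono) (metis add_diff_eq_ennreal add_diff_self_ennreal linear order_refl le_add_same_cancel1 zero_le)
  also have "\<dots> = (\<integral>\<^sup>+x. ennreal (w x) \<partial>M) + (\<integral>\<^sup>+x. f x - ennreal (w x) \<partial>M)"
    using f w by (intro nn_integral_add) auto
  also have "(\<integral>\<^sup>+x. f x - ennreal (w x) \<partial>M) \<le> (\<integral>\<^sup>+x. b x \<partial>M)"
    using le by (intro nn_integral_mono) (auto simp: ennreal_minus_le_iff add.commute)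
  finally show ?thesis by (simp add: add_left_mono)
qed

text \<open>
  Neither \<open>a\<close> nor \<open>b\<close> is assumed to be measurable, so that the integrals on the right-hand side
  are lower integrals.
\<close>

lemma integral_le_lower_integral_diff:
  assumes c: "integrable M c"
    and le: "\<And>x. x \<in> space M \<Longrightarrow> ereal (c x) \<le> enn2ereal (a x) - enn2ereal (b x)"
  shows "ereal (\<integral>x. c x \<partial>M) \<le> enn2ereal (\<integral>\<^sup>+x. a x \<partial>M) - enn2ereal (\<integral>\<^sup>+x. b x \<partial>M)"
proof -
  have max: "ennreal (max 0 z) = ennreal z" for z by (cases "z \<ge> 0") (auto simp: ennreal_neg)
  have le': "ennreal (c x) + b x \<le> a x + ennreal (- c x)" if "x \<in> space M" for x
    using le[OF that] ereal_le_enn2ereal_diff_iff[of "max 0 (c x)" "max 0 (- c x)" "a x" "b x"]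
    by (auto simp: max split: if_splits) (auto simp: max_def split: if_splits)
  \<comment> \<open>The integral of \<open>b\<close> is the supremum over simple functions below
    \<open>b\<close>; each of these is measurable, so its integral may be added to that of the
    positive part of \<open>c\<close>.\<close>
  let ?A = "{g. simple_function M g \<and> g \<le> b}"
  have ne: "?A \<noteq> {}" by (auto intro!: exI[of _ "\<lambda>_. 0"] simp: le_fun_def)
  have "(\<integral>\<^sup>+x. ennreal (c x) \<partial>M) + (\<integral>\<^sup>+x. b x \<partial>M) = (SUP g\<in>?A. (\<integral>\<^sup>+x. ennreal (c x) \<partial>M) + integral\<^sup>S M g)"
    unfolding nn_integral_def[of M b] by (rule ennreal_SUP_add_right[OF ne])
  also have "\<dots> \<le> (\<integral>\<^sup>+x. ennreal (- c x) \<partial>M) + (\<integral>\<^sup>+x. a x \<partial>M)"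
  proof (rule SUP_least)
    fix g assume g: "g \<in> ?A"
    then have gm: "g \<in> borel_measurable M" by (auto intro: borel_measurable_simple_function)
    have "(\<integral>\<^sup>+x. ennreal (c x) \<partial>M) + integral\<^sup>S M g = (\<integral>\<^sup>+x. ennreal (c x) + g x \<partial>M)"
      using g gm c by (subst nn_integral_add) (auto simp: nn_integral_eq_simple_integral)
    also have "\<dots> \<le> (\<integral>\<^sup>+x. ennreal (- c x) \<partial>M) + (\<integral>\<^sup>+x. a x \<partial>M)"
    proof (rule nn_integral_le_add_lower)
      fix x assume "x \<in> space M"
      have "ennreal (c x) + g x \<le> ennreal (c x) + b x" using g by (auto simp: le_fun_def intro: add_left_mono)
      also have "\<dots> \<le> ennreal (- c x) + a x" using le'[OF \<open>x \<in> space M\<close>] by (simp add: add.commute)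
      finally show "ennreal (c x) + g x \<le> ennreal (- c x) + a x" .
    qed (use c gm in auto)
    finally show "(\<integral>\<^sup>+x. ennreal (c x) \<partial>M) + integral\<^sup>S M g \<le> (\<integral>\<^sup>+x. ennreal (- c x) \<partial>M) + (\<integral>\<^sup>+x. a x \<partial>M)" .
  qed
  finally have main: "(\<integral>\<^sup>+x. ennreal (c x) \<partial>M) + (\<integral>\<^sup>+x. b x \<partial>M) \<le> (\<integral>\<^sup>+x. a x \<partial>M) + (\<integral>\<^sup>+x. ennreal (- c x) \<partial>M)"
    by (simp add: add.commute)
  have fin: "(\<integral>\<^sup>+x. ennreal (c x) \<partial>M) < \<infinity>" "(\<integral>\<^sup>+x. ennreal (- c x) \<partial>M) < \<infinity>"
    using c by (auto simp: real_integrable_def top.not_eq_extremum)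
  show ?thesis
    unfolding real_lebesgue_integral_def[OF c]
    by (subst ereal_le_enn2ereal_diff_iff) (use main fin in auto)
qed

lemma ereal_le_if_add_small:
  fixes a b :: real
  assumes "\<And>e. e > 0 \<Longrightarrow> ereal (a + e * b) \<le> X"
  shows "ereal a \<le> X"
proof (cases X)
  case (real x)
  have "a \<le> x + e" if "e > 0" for e
  proof -
    have "a + e / (\<bar>b\<bar> + 1) * b \<le> x"
      using assms[of "e / (\<bar>b\<bar> + 1)"] that by (simp add: real)
    moreover have "e / (\<bar>b\<bar> + 1) * \<bar>b\<bar> \<le> e / (\<bar>b\<bar> + 1) * (\<bar>b\<bar> + 1)"
      using that by (intro mult_left_mono) auto
    moreover have "e / (\<bar>b\<bar> + 1) * (- b) \<le> e / (\<bar>b\<bar> + 1) * \<bar>b\<bar>"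
      using that by (intro mult_left_mono) auto
    ultimately show ?thesis by simp
  qed
  then show ?thesis using real by (simp add: field_le_epsilon)
qed (use assms[of 1] in auto)

text \<open>
  For convex \<open>G\<close> the perspective function \<open>\<eta> t x = (t + \<epsilon>) G (x / (t + \<epsilon>))\<close> solves
  \<open>\<partial>\<^sub>t \<eta> + G\<^sup>* (\<nabla>\<eta>) = 0\<close>; the shift by \<open>\<epsilon>\<close> removes the singularity at \<open>t = 0\<close>.
\<close>

lemma C1_test_perspective:
  fixes G :: "'a::euclidean_space \<Rightarrow> real"
  assumes G: "\<And>x. (G has_derivative (\<lambda>h. D x \<bullet> h)) (at x)" and D: "continuous_on UNIV D"
    and \<epsilon>: "\<epsilon> > 0"
  defines "y \<equiv> \<lambda>t x. (1 / (t + \<epsilon>)) *\<^sub>R x"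
  shows "C1_test S (\<lambda>t x. (t + \<epsilon>) * G (y t x)) (\<lambda>t x. G (y t x) - D (y t x) \<bullet> y t x) (\<lambda>t x. D (y t x))"
proof -
  have cG: "continuous_on UNIV G"
    using G by (intro continuous_at_imp_continuous_on ballI has_derivative_continuous)
  have cy: "continuous_on ({0..1} \<times> S) (\<lambda>p. y (fst p) (snd p))"
    unfolding y_def using \<epsilon> by (intro continuous_intros) auto
  note c = continuous_on_compose2[OF cG cy] continuous_on_compose2[OF D cy]
  have "continuous_on ({0..1} \<times> S) (\<lambda>(t, x). G (y t x) - D (y t x) \<bullet> y t x)"
    unfolding case_prod_beta by (intro continuous_on_diff continuous_on_inner c cy) auto
  moreover have "continuous_on ({0..1} \<times> S) (\<lambda>(t, x). D (y t x))"
    unfolding case_prod_beta by (intro c) auto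
  moreover have "((\<lambda>(s, z). (s + \<epsilon>) * G (y s z)) has_derivative
      (\<lambda>(s, z). s * (G (y t x) - D (y t x) \<bullet> y t x) + D (y t x) \<bullet> z)) (at (t, x) within {0..1} \<times> S)"
    if "t \<in> {0..1}" for t x
  proof -
    have pos: "t + \<epsilon> > 0" using that \<epsilon> by auto
    have "((\<lambda>p. y (fst p) (snd p)) has_derivative
        (\<lambda>p. (1 / (t + \<epsilon>)) *\<^sub>R snd p - (fst p / (t + \<epsilon>)) *\<^sub>R y t x)) (at (t, x) within {0..1} \<times> S)"
      unfolding y_def using pos
      by (auto intro!: derivative_eq_intros simp: field_simps power2_eq_square)
    from has_derivative_compose[OF this, of G "\<lambda>h. D (y t x) \<bullet> h"]
    have "((\<lambda>p. G (y (fst p) (snd p))) has_derivative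
        (\<lambda>p. D (y t x) \<bullet> ((1 / (t + \<epsilon>)) *\<^sub>R snd p - (fst p / (t + \<epsilon>)) *\<^sub>R y t x))) (at (t, x) within {0..1} \<times> S)"
      using G by simp
    then have "((\<lambda>p. (fst p + \<epsilon>) * G (y (fst p) (snd p))) has_derivative
        (\<lambda>p. (fst p) * G (y t x) +
          (t + \<epsilon>) * (D (y t x) \<bullet> ((1 / (t + \<epsilon>)) *\<^sub>R snd p - (fst p / (t + \<epsilon>)) *\<^sub>R y t x))))
        (at (t, x) within {0..1} \<times> S)"
      by (auto intro!: derivative_eq_intros)
    moreover have "(fst p) * G (y t x) +
          (t + \<epsilon>) * (D (y t x) \<bullet> ((1 / (t + \<epsilon>)) *\<^sub>R snd p - (fst p / (t + \<epsilon>)) *\<^sub>R y t x)) =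
        fst p * (G (y t x) - D (y t x) \<bullet> y t x) + D (y t x) \<bullet> snd p" for p :: "real \<times> 'a"
      using less_imp_neq[OF pos] by (simp add: inner_diff_right right_diff_distrib)
    ultimately show ?thesis by (simp add: split_def)
  qed
  ultimately show ?thesis by (simp add: C1_test_def)
qed

lemma integrable_continuous_on_inner:
  fixes S :: "'a::topological_space set" and g v :: "'a \<Rightarrow> 'b::euclidean_space"
  assumes S: "compact S" and M: "M \<in> prob_measures S" and g: "continuous_on S g"
    and v: "integrable M v"
  shows "integrable M (\<lambda>x. g x \<bullet> v x)"
proof -
  have "bounded (g ` S)" using g S by (intro compact_imp_bounded compact_continuous_image)
  then obtain K where K: "\<And>x. x \<in> S \<Longrightarrow> norm (g x) \<le> K" by (auto simp: bounded_iff)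
  show ?thesis
  proof (rule Bochner_Integration.integrable_bound)
    show "integrable M (\<lambda>x. K * norm (v x))"
      using v by (intro integrable_mult_right integrable_norm)
    show "(\<lambda>x. g x \<bullet> v x) \<in> borel_measurable M"
      using continuous_on_borel_measurable_prob_measures[OF g M] v
      by (intro borel_measurable_inner) auto
    have "\<bar>g x \<bullet> v x\<bar> \<le> \<bar>K * norm (v x)\<bar>" if "x \<in> S" for x
    proof -
      have "\<bar>g x \<bullet> v x\<bar> \<le> norm (g x) * norm (v x)" by (rule Cauchy_Schwarz_ineq2)
      also have "\<dots> \<le> K * norm (v x)" using K[OF that] by (rule mult_right_mono) simp
      finally show ?thesis by simp
    qed
    then show "AE x in M. norm (g x \<bullet> v x) \<le> norm (K * norm (v x))"
      by (auto simp: prob_measuresD(3)[OF M])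
  qed
qed

text \<open>Without integrability the time integral of the pairing in
  \<open>continuity_equation\<close> would be the default value 0. The pairing is at most
  \<open>K\<close> times the first moment of the velocity, and
  \<open>norm v \<le> 1 + norm v powr r\<close> reduces this to the finite energy.\<close>

lemma vector_integral_set_integrable:
  fixes S :: "'a::euclidean_space set"
  assumes S: "compact S" and m: "m \<in> sliced_vector_measures S"
    and p: "\<And>t. t \<in> {0..1} \<Longrightarrow> \<pi> t \<in> prob_measures S"
    and ac: "\<And>t. t \<in> {0..1} \<Longrightarrow> vector_abs_cont (\<pi> t) (m t)"
    and v: "\<And>t. t \<in> {0..1} \<Longrightarrow> integrable (\<pi> t) (vector_RN_deriv (\<pi> t) (m t))"
    and r: "r > 1" "(\<integral>\<^sup>+t\<in>{0..1}. (\<integral>\<^sup>+x. ennreal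
        (norm (vector_RN_deriv (\<pi> t) (m t) x) powr r) \<partial>\<pi> t) \<partial>lebesgue) < \<infinity>"
    and g: "continuous_on ({0..1} \<times> S) (\<lambda>(t, x). g t x)"
  shows "set_integrable lebesgue {0..1} (\<lambda>t. vector_integral (\<pi> t) (m t) (g t))"
proof -
  let ?v = "\<lambda>t. vector_RN_deriv (\<pi> t) (m t)" and ?V = "\<lambda>t. vector_integral (\<pi> t) (m t) (g t)"
  let ?h = "\<lambda>t. \<integral>\<^sup>+x. ennreal (norm (?v t x) powr r) \<partial>\<pi> t"
  have "bounded ((\<lambda>(t, x). g t x) ` ({0..1} \<times> S))"
    using S g by (intro compact_imp_bounded compact_continuous_image compact_Times) auto
  then obtain K where K: "K > 0" "\<And>t x. t \<in> {0..1} \<Longrightarrow> x \<in> S \<Longrightarrow> norm (g t x) \<le> K"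
    unfolding bounded_pos by (metis (no_types, lifting) SigmaI case_prod_conv image_eqI)
  have Vm: "(\<lambda>t. indicator {0..1} t *\<^sub>R ?V t) \<in> borel_measurable lebesgue"
    by (rule vector_integral_measurable[OF m p ac S g])
  have bound: "ennreal (\<bar>?V t\<bar> / K) \<le> 1 + ?h t" if t: "t \<in> {0..1}" for t
  proof -
    interpret prob_space "\<pi> t" using p[OF t] by (rule prob_measuresD)
    have gt: "continuous_on S (g t)" using g t by (rule continuous_on_slice)
    have gv: "norm (g t x \<bullet> ?v t x) \<le> K * norm (?v t x)" if "x \<in> S" for x
      using Cauchy_Schwarz_ineq2[of "g t x" "?v t x"] K(2)[OF t that]
      by (simp add: order_trans[OF _ mult_right_mono])
    have gvi: "integrable (\<pi> t) (\<lambda>x. g t x \<bullet> ?v t x)"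
      using S p[OF t] gt v[OF t] by (rule integrable_continuous_on_inner)
    have "\<bar>?V t\<bar> \<le> (\<integral>x. \<bar>g t x \<bullet> ?v t x\<bar> \<partial>\<pi> t)"
      unfolding vector_integral_def by (rule integral_abs_bound)
    also have "\<dots> \<le> (\<integral>x. K * norm (?v t x) \<partial>\<pi> t)"
      using gvi v[OF t] gv by (intro integral_mono) (auto simp: prob_measuresD(3)[OF p[OF t]])
    finally have "\<bar>?V t\<bar> / K \<le> (\<integral>x. norm (?v t x) \<partial>\<pi> t)"
      using K(1) by (simp add: pos_divide_le_eq mult.commute)
    then have "ennreal (\<bar>?V t\<bar> / K) \<le> ennreal (\<integral>x. norm (?v t x) \<partial>\<pi> t)" by (rule ennreal_leI)
    also have "\<dots> = (\<integral>\<^sup>+x. ennreal (norm (?v t x)) \<partial>\<pi> t)"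
      using v[OF t] by (intro nn_integral_eq_integral[symmetric]) auto
    also have "\<dots> \<le> (\<integral>\<^sup>+x. 1 + ennreal (norm (?v t x) powr r) \<partial>\<pi> t)"
    proof (rule nn_integral_mono)
      fix x
      have "norm (?v t x) \<le> 1 + norm (?v t x) powr r"
      proof (cases "norm (?v t x) \<le> 1")
        case False
        then have "norm (?v t x) powr 1 \<le> norm (?v t x) powr r"
          using r(1) by (intro powr_mono) auto
        with False show ?thesis by simp
      qed (simp add: add_increasing2)
      then have "ennreal (norm (?v t x)) \<le> ennreal (1 + norm (?v t x) powr r)" by (rule ennreal_leI)
      then show "ennreal (norm (?v t x)) \<le> 1 + ennreal (norm (?v t x) powr r)" by simp
    qed
    also have "\<dots> = 1 + ?h t"
      using v[OF t] by (subst nn_integral_add) (auto simp: emeasure_space_1)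
    finally show ?thesis .
  qed
  have "(\<integral>\<^sup>+t. ennreal (\<bar>indicator {0..1} t *\<^sub>R ?V t\<bar> / K) \<partial>lebesgue) \<le>
      (\<integral>\<^sup>+t. ennreal (indicator {0..1::real} t) \<partial>lebesgue) + (\<integral>\<^sup>+t. ?h t * indicator {0..1} t \<partial>lebesgue)"
  \<comment> \<open>The slice energy is not known to be measurable in \<open>t\<close>, hence the
    one-sided lemma in place of additivity.\<close>
  proof (rule nn_integral_le_add_lower)
    show "(\<lambda>t. indicator {0..1::real} t :: real) \<in> borel_measurable lebesgue"
      by (intro borel_measurable_indicator) simp
    show "(\<lambda>t. ennreal (\<bar>indicator {0..1} t *\<^sub>R ?V t\<bar> / K)) \<in> borel_measurable lebesgue"
      using Vm by (intro measurable_compose[OF _ measurable_ennreal] borel_measurable_divide borel_measurable_abs) auto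
  qed (use bound in \<open>auto simp: indicator_def\<close>)
  also have "\<dots> < \<infinity>"
    using r(2) by (simp add: ennreal_indicator)
  finally have "(\<integral>\<^sup>+t. ennreal (norm ((indicator {0..1} t *\<^sub>R ?V t) / K)) \<partial>lebesgue) < \<infinity>"
    using K(1) by simp
  then have "integrable lebesgue (\<lambda>t. (indicator {0..1} t *\<^sub>R ?V t) / K)"
    using Vm by (intro integrableI_bounded) auto
  from integrable_mult_left[OF this, of K] show ?thesis
    using K(1) by (simp add: set_integrable_def)
qed

text \<open>The continuity equation is tested with the perspective of \<open>G\<close>. In each
  slice the integrand is the tangent of \<open>G\<close> at \<open>x / (t + \<epsilon>)\<close>
  evaluated at the velocity, hence at most \<open>G\<close> and so at most \<open>F\<close> there;
  the boundary terms equal the integral of \<open>G\<close> up to an error of order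
  \<open>\<epsilon>\<close>.\<close>

lemma smooth_minorant_le_action:
  fixes S :: "'a::euclidean_space set"
  assumes S: "compact S" "0 \<in> S"
    and \<pi>: "continuous_map (top_of_set {0..1}) (weak_topology S) \<pi>"
    and m: "m \<in> sliced_vector_measures S"
    and ac: "\<And>t. t \<in> {0..1} \<Longrightarrow> vector_abs_cont (\<pi> t) (m t)"
    and r: "r > 1" "(\<integral>\<^sup>+t\<in>{0..1}. (\<integral>\<^sup>+x. ennreal
        (norm (vector_RN_deriv (\<pi> t) (m t) x) powr r) \<partial>\<pi> t) \<partial>lebesgue) < \<infinity>"
    and ce: "continuity_equation S \<pi> m"
    and \<pi>0: "\<pi> 0 = return (borel_on S) 0"
    and G: "\<And>x. (G has_derivative (\<lambda>h. D x \<bullet> h)) (at x)" and D: "continuous_on UNIV D"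
    and tangent: "\<And>x v. G x + D x \<bullet> (v - x) \<le> G v" and GF: "\<And>v. G v \<le> F v"
  shows "ereal (\<integral>x. G x \<partial>\<pi> 1) \<le> action F (\<pi>, m)"
proof -
  let ?v = "\<lambda>t. vector_RN_deriv (\<pi> t) (m t)"
  have p: "\<pi> t \<in> prob_measures S" if "t \<in> {0..1}" for t
    using \<pi> that by (simp add: continuous_map_weak_topology)
  have v: "integrable (\<pi> t) (?v t)" if t: "t \<in> {0..1}" for t
  proof (rule integrable_vector_RN_deriv)
    show "finite_measure (\<pi> t)" using prob_measuresD(1)[OF p[OF t]] by (simp add: prob_space_def)
    show "vector_measure (\<pi> t) (m t)"
      using m t prob_measuresD(2)[OF p[OF t]] by (auto simp: sliced_vector_measures_def vector_measure_def)
  qed (rule ac[OF t])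
  have cG: "continuous_on UNIV G"
    using G by (intro continuous_at_imp_continuous_on ballI has_derivative_continuous)
  interpret P1: prob_space "\<pi> 1" by (rule prob_measuresD[OF p]) simp
  have int1: "integrable (\<pi> 1) f" if "continuous_on S f" for f :: "'a \<Rightarrow> real"
    by (rule continuous_on_integrable_prob_measures[OF S(1) that p]) simp
  have int_GD: "integrable (\<pi> 1) G" "integrable (\<pi> 1) (\<lambda>x. D x \<bullet> x)"
    by (intro int1 continuous_on_subset[OF cG] continuous_on_inner continuous_on_subset[OF D]
        continuous_on_id subset_UNIV)+
  \<comment> \<open>The bracket multiplying \<open>\<epsilon>\<close> does not depend on
    \<open>\<epsilon>\<close>: it collects the tangent bound for \<open>\<eta> 1\<close> and the
    value \<open>\<epsilon> * G 0\<close> that the Dirac mass yields at time 0.\<close>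
  have "ereal ((\<integral>x. G x \<partial>\<pi> 1) + \<epsilon> * ((\<integral>x. G x \<partial>\<pi> 1) - (\<integral>x. D x \<bullet> x \<partial>\<pi> 1) - G 0)) \<le> action F (\<pi>, m)"
    if \<epsilon>: "\<epsilon> > 0" for \<epsilon>
  proof -
    define y where "y t x = (1 / (t + \<epsilon>)) *\<^sub>R x" for t and x :: 'a
    define \<eta> where "\<eta> t x = (t + \<epsilon>) * G (y t x)" for t x
    define \<eta>t where "\<eta>t t x = G (y t x) - D (y t x) \<bullet> y t x" for t x
    define g where "g t x = D (y t x)" for t x
    have C1: "C1_test S \<eta> \<eta>t g"
      using C1_test_perspective[OF G D \<epsilon>, of S] by (simp add: \<eta>_def[abs_def] \<eta>t_def[abs_def] g_def[abs_def] y_def)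
    then have c\<eta>t: "continuous_on ({0..1} \<times> S) (\<lambda>(t, x). \<eta>t t x)"
      and cg: "continuous_on ({0..1} \<times> S) (\<lambda>(t, x). g t x)"
      by (auto simp: C1_test_def)
    let ?A = "\<lambda>t. \<integral>x. \<eta>t t x \<partial>\<pi> t" and ?V = "\<lambda>t. vector_integral (\<pi> t) (m t) (g t)"
    have iA: "set_integrable lebesgue {0..1} ?A"
      by (intro absolutely_integrable_continuous_real continuous_on_integral_weakly_continuous[OF S(1) _ \<pi> c\<eta>t]) simp
    have iV: "set_integrable lebesgue {0..1} ?V"
      by (rule vector_integral_set_integrable[OF S(1) m p ac v r cg])
    have slice: "ereal (?A t + ?V t) \<le> enn2ereal (\<integral>\<^sup>+x. ennreal (F (?v t x)) \<partial>\<pi> t) - enn2ereal (\<integral>\<^sup>+x. ennreal (- F (?v t x)) \<partial>\<pi> t)"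
      if t: "t \<in> {0..1}" for t
    proof -
      have gt: "continuous_on S (g t)" using cg t by (rule continuous_on_slice)
      have \<eta>tt: "continuous_on S (\<eta>t t)" using c\<eta>t t by (rule continuous_on_slice)
      have i1: "integrable (\<pi> t) (\<eta>t t)"
        using S(1) \<eta>tt p[OF t] by (rule continuous_on_integrable_prob_measures)
      have i2: "integrable (\<pi> t) (\<lambda>x. g t x \<bullet> ?v t x)"
        using S(1) p[OF t] gt v[OF t] by (rule integrable_continuous_on_inner)
      have "?A t + ?V t = (\<integral>x. \<eta>t t x + g t x \<bullet> ?v t x \<partial>\<pi> t)"
        unfolding vector_integral_def using i1 i2 by simp
      also have "ereal \<dots> \<le> enn2ereal (\<integral>\<^sup>+x. ennreal (F (?v t x)) \<partial>\<pi> t) - enn2ereal (\<integral>\<^sup>+x. ennreal (- F (?v t x)) \<partial>\<pi> t)"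
      proof (rule integral_le_lower_integral_diff)
        show "integrable (\<pi> t) (\<lambda>x. \<eta>t t x + g t x \<bullet> ?v t x)" using i1 i2 by simp
        fix x
        have "\<eta>t t x + g t x \<bullet> ?v t x = G (y t x) + D (y t x) \<bullet> (?v t x - y t x)"
          by (simp add: \<eta>t_def g_def inner_diff_right)
        also have "\<dots> \<le> F (?v t x)" using tangent GF order_trans by blast
        finally show "ereal (\<eta>t t x + g t x \<bullet> ?v t x) \<le> enn2ereal (ennreal (F (?v t x))) - enn2ereal (ennreal (- F (?v t x)))"
          by (cases "F (?v t x) \<ge> 0") (auto simp: ennreal_neg enn2ereal_ennreal zero_ennreal.rep_eq)
      qed
      finally show ?thesis .
    qed
    have "(LINT t:{0..1}|lebesgue. ?A t) + (LINT t:{0..1}|lebesgue. ?V t) = (\<integral>t. indicator {0..1} t * (?A t + ?V t) \<partial>lebesgue)"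
      using set_integral_add(2)[OF iA iV] by (simp add: set_lebesgue_integral_def)
    also have "ereal \<dots> \<le> action F (\<pi>, m)"
      unfolding action_def prod.case
    proof (rule integral_le_lower_integral_diff)
      show "integrable lebesgue (\<lambda>t. indicator {0..1} t * (?A t + ?V t))"
        using set_integral_add(1)[OF iA iV] by (simp add: set_integrable_def)
      show "ereal (indicator {0..1} t * (?A t + ?V t)) \<le>
          enn2ereal ((\<integral>\<^sup>+x. ennreal (F (?v t x)) \<partial>\<pi> t) * indicator {0..1} t) -
          enn2ereal ((\<integral>\<^sup>+x. ennreal (- F (?v t x)) \<partial>\<pi> t) * indicator {0..1} t)" for t
        using slice[of t] by (auto simp: indicator_def)
    qed
    finally have "ereal ((\<integral>x. \<eta> 1 x \<partial>\<pi> 1) - (\<integral>x. \<eta> 0 x \<partial>\<pi> 0)) \<le> action F (\<pi>, m)"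
      using ce C1 by (simp add: continuity_equation_def)
    moreover have "(\<integral>x. \<eta> 0 x \<partial>\<pi> 0) = \<epsilon> * G 0"
    proof -
      have "\<eta> 0 \<in> borel_measurable (borel_on S)"
        unfolding \<eta>_def y_def
        by (intro borel_measurable_continuous_on_restrict continuous_intros continuous_on_compose2[OF cG]) auto
      then show ?thesis
        unfolding \<pi>0 using S(2) by (subst integral_return) (auto simp: space_restrict_space \<eta>_def y_def)
    qed
    \<comment> \<open>\<open>y 1 x\<close> is \<open>x / (1 + \<epsilon>)\<close>, not
      \<open>x\<close>; the tangent of \<open>G\<close> at \<open>x\<close> controls the difference
      from below.\<close>
    moreover have "(1 + \<epsilon>) * (\<integral>x. G x \<partial>\<pi> 1) - \<epsilon> * (\<integral>x. D x \<bullet> x \<partial>\<pi> 1) \<le> (\<integral>x. \<eta> 1 x \<partial>\<pi> 1)"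
    proof -
      have "(1 + \<epsilon>) * (\<integral>x. G x \<partial>\<pi> 1) - \<epsilon> * (\<integral>x. D x \<bullet> x \<partial>\<pi> 1) = (\<integral>x. (1 + \<epsilon>) * G x - \<epsilon> * (D x \<bullet> x) \<partial>\<pi> 1)"
        using int_GD by simp
      also have "\<dots> \<le> (\<integral>x. \<eta> 1 x \<partial>\<pi> 1)"
      proof (rule integral_mono)
        show "integrable (\<pi> 1) (\<eta> 1)"
          unfolding \<eta>_def y_def
          by (intro int1 continuous_intros continuous_on_compose2[OF cG]) auto
        fix x
        have "y 1 x - x = - (\<epsilon> / (1 + \<epsilon>)) *\<^sub>R x"
        proof -
          have "1 / (1 + \<epsilon>) = 1 - \<epsilon> / (1 + \<epsilon>)" using \<epsilon> by (simp add: field_simps)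
          then show ?thesis by (simp add: y_def scaleR_diff_left)
        qed
        then have "G x - \<epsilon> / (1 + \<epsilon>) * (D x \<bullet> x) \<le> G (y 1 x)"
          using tangent[of x "y 1 x"] by simp
        then have "(1 + \<epsilon>) * (G x - \<epsilon> / (1 + \<epsilon>) * (D x \<bullet> x)) \<le> (1 + \<epsilon>) * G (y 1 x)"
          using \<epsilon> by (intro mult_left_mono) auto
        moreover have "(1 + \<epsilon>) * (G x - \<epsilon> / (1 + \<epsilon>) * (D x \<bullet> x)) = (1 + \<epsilon>) * G x - \<epsilon> * (D x \<bullet> x)"
          using \<epsilon> by (simp add: right_diff_distrib)
        ultimately show "(1 + \<epsilon>) * G x - \<epsilon> * (D x \<bullet> x) \<le> \<eta> 1 x" by (simp add: \<eta>_def)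
      qed (use int_GD in simp)
      finally show ?thesis .
    qed
    ultimately show ?thesis
      by (elim order_trans[rotated]) (simp add: algebra_simps)
  qed
  then show ?thesis by (rule ereal_le_if_add_small)
qed

text \<open>The minorant \<open>G\<close> loses at most \<open>e\<close> on \<open>S\<close>, which
  carries \<open>\<pi> 1\<close>, while \<open>G \<le> F\<close> on the whole space handles
  velocities outside \<open>S\<close>.\<close>

lemma convex_integral_le_action:
  fixes S :: "'a::euclidean_space set"
  assumes S: "compact S" "0 \<in> S" and F: "convex_on UNIV F"
    and \<pi>: "continuous_map (top_of_set {0..1}) (weak_topology S) \<pi>"
    and m: "m \<in> sliced_vector_measures S"
    and ac: "\<And>t. t \<in> {0..1} \<Longrightarrow> vector_abs_cont (\<pi> t) (m t)"
    and r: "r > 1" "(\<integral>\<^sup>+t\<in>{0..1}. (\<integral>\<^sup>+x. ennreal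
        (norm (vector_RN_deriv (\<pi> t) (m t) x) powr r) \<partial>\<pi> t) \<partial>lebesgue) < \<infinity>"
    and ce: "continuity_equation S \<pi> m"
    and \<pi>0: "\<pi> 0 = return (borel_on S) 0"
  shows "ereal (\<integral>x. F x \<partial>\<pi> 1) \<le> action F (\<pi>, m)"
proof (rule ereal_le_if_add_small[of _ "-1"])
  fix e :: real assume e: "e > 0"
  have p: "\<pi> 1 \<in> prob_measures S"
    using \<pi> by (simp add: continuous_map_weak_topology)
  interpret prob_space "\<pi> 1" using p by (rule prob_measuresD)
  obtain G D where G: "\<And>x. (G has_derivative (\<lambda>h. D x \<bullet> h)) (at x)" "continuous_on UNIV D"
    "\<And>x v. G x + D x \<bullet> (v - x) \<le> G v" "\<And>v. G v \<le> F v" "\<And>x. x \<in> S \<Longrightarrow> F x - e \<le> G x"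
    using smooth_convex_minorant[OF F S(1) e] by metis
  have iF: "integrable (\<pi> 1) F"
    using S(1) p F by (intro continuous_on_integrable_prob_measures[of S] continuous_on_subset[OF convex_on_continuous[of UNIV]]) auto
  have iG: "integrable (\<pi> 1) G"
    using S(1) p G(1) by (intro continuous_on_integrable_prob_measures[of S] continuous_at_imp_continuous_on)
      (auto intro: has_derivative_continuous)
  have "(\<integral>x. F x \<partial>\<pi> 1) + e * - 1 = (\<integral>x. F x - e \<partial>\<pi> 1)"
    using iF by (simp add: prob_space)
  also have "\<dots> \<le> (\<integral>x. G x \<partial>\<pi> 1)"
    using iF iG G(5) by (intro integral_mono) (auto simp: prob_measuresD(3)[OF p])
  also have "ereal \<dots> \<le> action F (\<pi>, m)"
    by (rule smooth_minorant_le_action[OF S \<pi> m ac r ce \<pi>0 G(1-4)])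
  finally show "ereal ((\<integral>x. F x \<partial>\<pi> 1) + e * - 1) \<le> action F (\<pi>, m)" by simp
qed

section \<open>The flow induced by a coupling\<close>

text \<open>Countable additivity is dominated convergence with majorant \<open>norm w\<close>. It
  serves twice: for the time slices of the induced flow and for its space-time measure.\<close>

lemma vector_measure_push_forward:
  fixes w :: "'a \<Rightarrow> 'b::{banach, second_countable_topology}"
  assumes \<phi>: "\<phi> \<in> measurable M N" and w: "integrable M w"
  shows "vector_measure N (\<lambda>A. \<integral>z. indicator A (\<phi> z) *\<^sub>R w z \<partial>M)"
  unfolding vector_measure_def
proof (intro conjI allI impI)
  fix A :: "nat \<Rightarrow> _" assume A: "range A \<subseteq> sets N" "disjoint_family A"
  have ind: "(\<lambda>z. indicator B (\<phi> z) :: real) \<in> borel_measurable M" if "B \<in> sets N" for B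
    using measurable_compose[OF \<phi> borel_measurable_indicator[OF that]] .
  have int: "integrable M (\<lambda>z. indicator B (\<phi> z) *\<^sub>R w z)" if "B \<in> sets N" for B
    using ind[OF that] w by (intro Bochner_Integration.integrable_bound[OF w])
      (auto intro!: borel_measurable_scaleR simp: indicator_def)
  have "(\<Sum>i<n. \<integral>z. indicator (A i) (\<phi> z) *\<^sub>R w z \<partial>M) = (\<integral>z. indicator (\<Union>i<n. A i) (\<phi> z) *\<^sub>R w z \<partial>M)" for n
  proof -
    have "indicator (\<Union>i<n. A i) (\<phi> z) *\<^sub>R w z = (\<Sum>i<n. indicator (A i) (\<phi> z) *\<^sub>R w z)" for z
      using A(2) by (subst indicator_UN_disjoint)
        (auto simp: scaleR_sum_left intro: disjoint_family_on_mono)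
    then have "(\<integral>z. indicator (\<Union>i<n. A i) (\<phi> z) *\<^sub>R w z \<partial>M) =
        (\<integral>z. (\<Sum>i<n. indicator (A i) (\<phi> z) *\<^sub>R w z) \<partial>M)"
      by (rule Bochner_Integration.integral_cong[OF refl])
    also have "\<dots> = (\<Sum>i<n. \<integral>z. indicator (A i) (\<phi> z) *\<^sub>R w z \<partial>M)"
      using A(1) by (intro Bochner_Integration.integral_sum int) auto
    finally show ?thesis by simp
  qed
  moreover have "(\<lambda>n. \<integral>z. indicator (\<Union>i<n. A i) (\<phi> z) *\<^sub>R w z \<partial>M) \<longlonglongrightarrow> (\<integral>z. indicator (\<Union>i. A i) (\<phi> z) *\<^sub>R w z \<partial>M)"
  proof (rule integral_dominated_convergence[where w="\<lambda>z. norm (w z)"])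
    show "AE z in M. (\<lambda>n. indicator (\<Union>i<n. A i) (\<phi> z) *\<^sub>R w z) \<longlonglongrightarrow> indicator (\<Union>i. A i) (\<phi> z) *\<^sub>R w z"
      by (intro AE_I2 tendsto_scaleR tendsto_const LIMSEQ_indicator_UN)
    show "(\<lambda>z. indicator (\<Union>i<n. A i) (\<phi> z) *\<^sub>R w z) \<in> borel_measurable M" for n
      using A(1) by (intro borel_measurable_integrable int) auto
    show "(\<lambda>z. indicator (\<Union>i. A i) (\<phi> z) *\<^sub>R w z) \<in> borel_measurable M"
      using A(1) by (intro borel_measurable_integrable int) auto
  qed (use w in \<open>auto simp: indicator_def\<close>)
  ultimately show "(\<lambda>n. \<integral>z. indicator (A n) (\<phi> z) *\<^sub>R w z \<partial>M) sums (\<integral>z. indicator (\<Union>n. A n) (\<phi> z) *\<^sub>R w z \<partial>M)"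
    by (simp add: sums_def)
qed simp

text \<open>Fubini arguments run on this Borel measure, before completion;
  \<open>unit_lborel_lebesgue\<close> moves the results to the \<open>lebesgue\<close> integrals of
  the definitions.\<close>

abbreviation unit_lborel :: "real measure" where
  "unit_lborel \<equiv> restrict_space lborel {0..1}"

lemma finite_measure_unit_lborel: "finite_measure unit_lborel"
  by (rule finite_measureI) (simp add: space_restrict_space emeasure_restrict_space)

lemma unit_lborel_lebesgue:
  fixes f :: "real \<Rightarrow> 'b::{banach, second_countable_topology}"
  assumes "f \<in> borel_measurable unit_lborel"
  shows "(LINT t:{0..1}|lebesgue. f t) = (\<integral>t. f t \<partial>unit_lborel)"
    and "integrable unit_lborel f \<Longrightarrow> set_integrable lebesgue {0..1} f"
    and "(\<lambda>t. indicator {0..1} t *\<^sub>R f t) \<in> borel_measurable lebesgue"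
proof -
  have m: "(\<lambda>t. indicator {0..1} t *\<^sub>R f t) \<in> borel_measurable lborel"
    using assms by (subst (asm) borel_measurable_restrict_space_iff) auto
  then show "(\<lambda>t. indicator {0..1} t *\<^sub>R f t) \<in> borel_measurable lebesgue"
    by (rule measurable_completion)
  show "(LINT t:{0..1}|lebesgue. f t) = (\<integral>t. f t \<partial>unit_lborel)"
    unfolding set_lebesgue_integral_def
    using m by (subst integral_completion) (auto simp: integral_restrict_space)
  show "set_integrable lebesgue {0..1} f" if "integrable unit_lborel f"
    using that m unfolding set_integrable_def
    by (subst integrable_completion) (auto simp: integrable_restrict_space)
qed

text \<open>Formulas for the velocity of the induced flow divide by \<open>t\<close>, so integrands
  are identified for positive times only. The point 0 is Lebesgue-null, and altering one value
  preserves measurability.\<close>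

lemma set_integral_unit_cong_pos:
  fixes f f' :: "real \<Rightarrow> 'b::{banach, second_countable_topology}"
  assumes m: "(\<lambda>t. indicator {0..1} t *\<^sub>R f' t) \<in> borel_measurable lebesgue"
    and eq: "\<And>t. 0 < t \<Longrightarrow> t \<le> 1 \<Longrightarrow> f t = f' t"
  shows "(LINT t:{0..1}|lebesgue. f t) = (LINT t:{0..1}|lebesgue. f' t)"
  unfolding set_lebesgue_integral_def
proof (rule integral_cong_AE)
  have "(\<lambda>t. indicator {0..1} t *\<^sub>R f t) = (\<lambda>t. if t = 0 then f 0 else indicator {0..1} t *\<^sub>R f' t)"
    using eq by (auto simp: indicator_def fun_eq_iff)
  moreover have "(\<lambda>t. if t = 0 then f 0 else indicator {0..1} t *\<^sub>R f' t) \<in> borel_measurable lebesgue"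
    using m by (intro measurable_If) auto
  ultimately show "(\<lambda>t. indicator {0..1} t *\<^sub>R f t) \<in> borel_measurable lebesgue" by simp
  have "AE t in lebesgue. t \<noteq> (0::real)"
    by (rule AE_I[of _ _ "{0}"]) auto
  then show "AE t in lebesgue. indicator {0..1} t *\<^sub>R f t = indicator {0..1} t *\<^sub>R f' t"
  proof eventually_elim
    case (elim t)
    then show ?case using eq[of t] by (auto simp: indicator_def)
  qed
qed (rule m)

locale dilation_flow =
  fixes S :: "'a::euclidean_space set" and \<gamma> :: "'a measure"
  assumes compact_S: "compact S" and convex_S: "convex S" and zero_in_S: "0 \<in> S"
    and prob_\<gamma>: "\<gamma> \<in> prob_measures S"
begin

sublocale prob_space \<gamma>
  using prob_\<gamma> by (rule prob_measuresD)

definition pos :: "real \<Rightarrow> 'a measure" where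
  "pos t = distr \<gamma> (borel_on S) (\<lambda>x. t *\<^sub>R x)"

definition mom :: "real \<Rightarrow> 'a set \<Rightarrow> 'a" where
  "mom t A = (\<integral>x. indicator A (t *\<^sub>R x) *\<^sub>R x \<partial>\<gamma>)"

lemma space_\<gamma>: "space \<gamma> = S"
  using prob_\<gamma> by (rule prob_measuresD)

lemma scale_in_S: "t \<in> {0..1} \<Longrightarrow> x \<in> S \<Longrightarrow> t *\<^sub>R x \<in> S"
  using convexD[OF convex_S _ zero_in_S, of x t "1 - t"] by auto

lemma measurable_id_\<gamma>: "(\<lambda>x. x) \<in> borel_measurable \<gamma>"
  using borel_measurable_prob_measures[OF measurable_ident prob_\<gamma>] by (simp add: id_def)

lemma measurable_scale: "t \<in> {0..1} \<Longrightarrow> (\<lambda>x. t *\<^sub>R x) \<in> measurable \<gamma> (borel_on S)"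
  using measurable_id_\<gamma> by (intro measurable_restrict_space2) (auto simp: space_\<gamma> scale_in_S)

lemma integrable_\<gamma>: "continuous_on S f \<Longrightarrow> integrable \<gamma> f"
  for f :: "'a \<Rightarrow> 'b::{banach, second_countable_topology}"
  using continuous_on_integrable_prob_measures[OF compact_S _ prob_\<gamma>] .

lemma pos_prob: "t \<in> {0..1} \<Longrightarrow> pos t \<in> prob_measures S"
  using prob_space_distr[OF measurable_scale] by (simp add: pos_def prob_measures_def)

lemma integral_pos:
  fixes f :: "'a \<Rightarrow> 'b::{banach, second_countable_topology}"
  assumes "t \<in> {0..1}" "f \<in> borel_measurable (borel_on S)"
  shows "(\<integral>x. f x \<partial>pos t) = (\<integral>x. f (t *\<^sub>R x) \<partial>\<gamma>)"
  unfolding pos_def using measurable_scale[OF assms(1)] assms(2) by (rule integral_distr)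

lemma vector_measure_mom: "t \<in> {0..1} \<Longrightarrow> vector_measure (borel_on S) (mom t)"
  unfolding mom_def
  by (intro vector_measure_push_forward measurable_scale integrable_\<gamma> continuous_intros)

lemma abs_cont_mom:
  assumes t: "t \<in> {0..1}"
  shows "vector_abs_cont (pos t) (mom t)"
  unfolding vector_abs_cont_def
proof
  fix A assume "A \<in> null_sets (pos t)"
  then have "AE y in pos t. y \<notin> A" by (rule AE_not_in)
  then have "AE x in \<gamma>. t *\<^sub>R x \<notin> A"
    unfolding pos_def by (rule AE_distrD[OF measurable_scale[OF t]])
  then have "AE x in \<gamma>. indicator A (t *\<^sub>R x) *\<^sub>R x = 0" by (auto elim!: AE_mp)
  then show "mom t A = 0" unfolding mom_def by (rule integral_eq_zero_AE)
qed

text \<open>A change of variables moves the time dependence from the measure to the integrand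
  \<open>f (t *\<^sub>R x)\<close>, so the result on joint continuity applies to the constant curve
  \<open>\<gamma>\<close>.\<close>

lemma pos_continuous: "continuous_map (top_of_set {0..1}) (weak_topology S) pos"
  unfolding continuous_map_weak_topology
proof (intro conjI allI impI ballI pos_prob)
  fix f :: "'a \<Rightarrow> real" assume f: "continuous_on S f"
  have "continuous_on {0..1} (\<lambda>t. \<integral>x. f (t *\<^sub>R x) \<partial>\<gamma>)"
  proof (rule continuous_on_integral_weakly_continuous[OF compact_S, where \<pi>="\<lambda>_. \<gamma>"])
    show "continuous_map (top_of_set {0..1}) (weak_topology S) (\<lambda>_. \<gamma>)"
      unfolding continuous_map_weak_topology using prob_\<gamma> by simp
    show "continuous_on ({0..1} \<times> S) (\<lambda>(t, x). f (t *\<^sub>R x))"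
      unfolding split_def using scale_in_S
      by (intro continuous_on_compose2[OF f] continuous_intros) auto
  qed simp
  then show "continuous_on {0..1} (\<lambda>t. \<integral>x. f x \<partial>pos t)"
    by (rule continuous_on_eq) (simp add: integral_pos borel_measurable_continuous_on_restrict f)
qed

text \<open>For positive \<open>t\<close> dilation is injective: mass at \<open>y\<close> started
  out as the particle with label \<open>y / t\<close>, which is also its velocity. At
  \<open>t = 0\<close> all labels collapse to one point.\<close>

lemma RN_deriv_mom:
  assumes t: "0 < t" "t \<le> 1"
  shows "AE y in pos t. vector_RN_deriv (pos t) (mom t) y = (1 / t) *\<^sub>R y"
proof (rule vector_RN_deriv_AE_eq)
  have t': "t \<in> {0..1}" using t by auto
  show "finite_measure (pos t)" using prob_measuresD(1)[OF pos_prob[OF t']] by (simp add: prob_space_def)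
  show "integrable (pos t) (\<lambda>y. (1 / t) *\<^sub>R y)"
    by (intro continuous_on_integrable_prob_measures[OF compact_S _ pos_prob[OF t']] continuous_intros)
  fix A assume "A \<in> sets (pos t)"
  then have A: "A \<in> sets (borel_on S)" by (simp add: pos_def)
  have "(\<lambda>y. indicator A y *\<^sub>R (1 / t) *\<^sub>R y) \<in> borel_measurable (borel_on S)"
    using A by (intro borel_measurable_scaleR borel_measurable_indicator borel_measurable_continuous_on_restrict continuous_intros)
  then have "(LINT y:A|pos t. (1 / t) *\<^sub>R y) = (\<integral>x. indicator A (t *\<^sub>R x) *\<^sub>R (1 / t) *\<^sub>R t *\<^sub>R x \<partial>\<gamma>)"
    unfolding set_lebesgue_integral_def by (rule integral_pos[OF t'])
  then show "mom t A = (LINT y:A|pos t. (1 / t) *\<^sub>R y)" using t by (simp add: mom_def)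
qed

text \<open>The velocity at \<open>t *\<^sub>R x\<close> is \<open>x\<close>, so velocities have law
  \<open>\<gamma>\<close> at every positive time; action and energy are therefore constant in
  \<open>t\<close>.\<close>

lemma nn_integral_RN_deriv_mom:
  assumes t: "0 < t" "t \<le> 1" and f: "f \<in> borel_measurable borel"
  shows "(\<integral>\<^sup>+y. f (vector_RN_deriv (pos t) (mom t) y) \<partial>pos t) = (\<integral>\<^sup>+x. f x \<partial>\<gamma>)"
proof -
  have t': "t \<in> {0..1}" using t by auto
  have "(\<integral>\<^sup>+y. f (vector_RN_deriv (pos t) (mom t) y) \<partial>pos t) = (\<integral>\<^sup>+y. f ((1 / t) *\<^sub>R y) \<partial>pos t)"
    using RN_deriv_mom[OF t] by (intro nn_integral_cong_AE) auto
  also have "\<dots> = (\<integral>\<^sup>+x. f ((1 / t) *\<^sub>R t *\<^sub>R x) \<partial>\<gamma>)"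
    unfolding pos_def
  proof (rule nn_integral_distr[OF measurable_scale[OF t']], rule measurable_compose[OF _ f])
    show "(\<lambda>y. (1 / t) *\<^sub>R y) \<in> borel_measurable (distr \<gamma> (borel_on S) (\<lambda>x. t *\<^sub>R x))"
      by (simp add: borel_measurable_continuous_on_restrict continuous_intros)
  qed
  finally show ?thesis using t by simp
qed

lemma nn_integral_unit_const:
  fixes h :: "real \<Rightarrow> ennreal"
  assumes "\<And>t. 0 < t \<Longrightarrow> t \<le> 1 \<Longrightarrow> h t = c"
  shows "(\<integral>\<^sup>+t\<in>{0..1}. h t \<partial>lebesgue) = c"
proof -
  have "AE t in lebesgue. t \<noteq> (0::real)"
    by (rule AE_I[of _ _ "{0}"]) auto
  then have "(\<integral>\<^sup>+t\<in>{0..1}. h t \<partial>lebesgue) = (\<integral>\<^sup>+t. c * indicator {0..1::real} t \<partial>lebesgue)"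
    using assms by (intro nn_integral_cong_AE) (auto simp: indicator_def elim!: AE_mp)
  also have "\<dots> = c" by (simp add: nn_integral_cmult_indicator)
  finally show ?thesis .
qed

lemma action_pos_mom:
  assumes F: "continuous_on UNIV F"
  shows "action F (pos, mom) = ereal (\<integral>x. F x \<partial>\<gamma>)"
proof -
  have Fm: "F \<in> borel_measurable borel" using F by (rule borel_measurable_continuous_onI)
  have int: "integrable \<gamma> F" by (rule integrable_\<gamma>[OF continuous_on_subset[OF F]]) simp
  have "action F (pos, mom) = enn2ereal (\<integral>\<^sup>+x. ennreal (F x) \<partial>\<gamma>) - enn2ereal (\<integral>\<^sup>+x. ennreal (- F x) \<partial>\<gamma>)"
    unfolding action_def prod.case using Fm
    by (intro arg_cong2[of _ _ _ _ "\<lambda>a b. enn2ereal a - enn2ereal b"] nn_integral_unit_const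
        nn_integral_RN_deriv_mom) auto
  moreover obtain p q where "(\<integral>\<^sup>+x. ennreal (F x) \<partial>\<gamma>) = ennreal p" "p \<ge> 0"
      "(\<integral>\<^sup>+x. ennreal (- F x) \<partial>\<gamma>) = ennreal q" "q \<ge> 0"
    using int unfolding real_integrable_def by (metis ennreal_cases infinity_ennreal_def)
  ultimately show ?thesis
    unfolding real_lebesgue_integral_def[OF int] by (simp add: enn2ereal_ennreal)
qed

section \<open>Space-time description of the induced flow and its continuity equation\<close>

text \<open>The passage from labels to positions: particle \<open>x\<close> at time \<open>t\<close>
  is sent to its place in space-time, and the push-forward of \<open>x dt d\<gamma>\<close> is the
  vector measure of the flow.\<close>

definition shear :: "real \<times> 'a \<Rightarrow> real \<times> 'a" where
  "shear p = (fst p, fst p *\<^sub>R snd p)"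

lemma measurable_fst_snd:
  "fst \<in> borel_measurable (unit_lborel \<Otimes>\<^sub>M \<gamma>)" "snd \<in> borel_measurable (unit_lborel \<Otimes>\<^sub>M \<gamma>)"
proof -
  have "(\<lambda>t. t) \<in> borel_measurable unit_lborel" by (intro measurable_restrict_space1) simp
  from measurable_compose[OF measurable_fst[of unit_lborel \<gamma>] this] show "fst \<in> borel_measurable (unit_lborel \<Otimes>\<^sub>M \<gamma>)" by simp
  from measurable_compose[OF measurable_snd[of unit_lborel \<gamma>] measurable_id_\<gamma>]
  show "snd \<in> borel_measurable (unit_lborel \<Otimes>\<^sub>M \<gamma>)" by simp
qed

lemma space_unit_pair: "space (unit_lborel \<Otimes>\<^sub>M \<gamma>) = {0..1} \<times> S"
  by (simp add: space_pair_measure space_restrict_space space_\<gamma>)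

lemma measurable_shear: "shear \<in> measurable (unit_lborel \<Otimes>\<^sub>M \<gamma>) (borel_on ({0..1} \<times> S))"
proof (rule measurable_restrict_space2)
  show "shear \<in> borel_measurable (unit_lborel \<Otimes>\<^sub>M \<gamma>)"
    unfolding shear_def using measurable_fst_snd
    by (intro borel_measurable_Pair borel_measurable_scaleR)
  show "shear \<in> space (unit_lborel \<Otimes>\<^sub>M \<gamma>) \<rightarrow> {0..1} \<times> S"
    using scale_in_S by (auto simp: space_unit_pair shear_def)
qed

sublocale UP: pair_sigma_finite unit_lborel \<gamma>
  using finite_measure_unit_lborel sigma_finite_measure_axioms
  by (simp add: pair_sigma_finite_def finite_measure.sigma_finite_measure)

lemma finite_measure_unit_pair: "finite_measure (unit_lborel \<Otimes>\<^sub>M \<gamma>)"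
proof (rule finite_measureI)
  have "emeasure (unit_lborel \<Otimes>\<^sub>M \<gamma>) (space unit_lborel \<times> space \<gamma>) =
      emeasure unit_lborel (space unit_lborel) * emeasure \<gamma> (space \<gamma>)"
    by (rule emeasure_pair_measure_Times) (rule sets.top)+
  then show "emeasure (unit_lborel \<Otimes>\<^sub>M \<gamma>) (space (unit_lborel \<Otimes>\<^sub>M \<gamma>)) \<noteq> \<infinity>"
    by (simp add: space_pair_measure emeasure_space_1 space_restrict_space emeasure_restrict_space)
qed

lemma integrable_unit_pair:
  fixes f :: "real \<times> 'a \<Rightarrow> 'b::{banach, second_countable_topology}"
  assumes "f \<in> borel_measurable (unit_lborel \<Otimes>\<^sub>M \<gamma>)" "\<And>t x. t \<in> {0..1} \<Longrightarrow> x \<in> S \<Longrightarrow> norm (f (t, x)) \<le> K"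
  shows "integrable (unit_lborel \<Otimes>\<^sub>M \<gamma>) f"
  using assms
  by (intro finite_measure.integrable_const_bound[OF finite_measure_unit_pair, of f K] AE_I2)
    (auto simp: space_unit_pair)

lemma integrable_unit_pair_snd: "integrable (unit_lborel \<Otimes>\<^sub>M \<gamma>) snd"
proof -
  obtain K where "\<And>x. x \<in> S \<Longrightarrow> norm x \<le> K"
    using compact_imp_bounded[OF compact_S] by (auto simp: bounded_iff)
  then show ?thesis using measurable_fst_snd by (intro integrable_unit_pair) auto
qed

text \<open>The measure on the product is the push-forward under \<open>shear\<close>; Fubini yields
  both integrability in time and the slice formula.\<close>

lemma mom_sliced: "mom \<in> sliced_vector_measures S"
proof -
  let ?P = "unit_lborel \<Otimes>\<^sub>M \<gamma>"
  define N where "N B = (\<integral>p. indicator B (shear p) *\<^sub>R snd p \<partial>?P)" for B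
  have "vector_measure (borel_on ({0..1} \<times> S)) N"
    unfolding N_def by (rule vector_measure_push_forward[OF measurable_shear integrable_unit_pair_snd])
  moreover have "set_integrable lebesgue {0..1} (\<lambda>t. mom t (Pair t -` B)) \<and>
      N B = (LINT t:{0..1}|lebesgue. mom t (Pair t -` B))" if B: "B \<in> sets (borel_on ({0..1} \<times> S))" for B
  proof -
    have "(\<lambda>p. indicator B (shear p) *\<^sub>R snd p) \<in> borel_measurable ?P"
      using measurable_fst_snd measurable_compose[OF measurable_shear borel_measurable_indicator[OF B]]
      by (intro borel_measurable_scaleR) auto
    then have int: "integrable ?P (\<lambda>p. indicator B (shear p) *\<^sub>R snd p)"
      by (intro Bochner_Integration.integrable_bound[OF integrable_unit_pair_snd]) (auto simp: indicator_def)
    have mom: "mom t (Pair t -` B) = (\<integral>x. indicator B (shear (t, x)) *\<^sub>R snd (t, x) \<partial>\<gamma>)" for t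
      by (simp add: mom_def shear_def indicator_def)
    have im: "integrable unit_lborel (\<lambda>t. mom t (Pair t -` B))"
      using UP.integrable_fst'[OF int] by (simp add: mom)
    have "N B = (\<integral>t. mom t (Pair t -` B) \<partial>unit_lborel)"
      unfolding N_def mom using UP.integral_fst'[OF int] by simp
    then show ?thesis
      using unit_lborel_lebesgue(1,2)[OF borel_measurable_integrable[OF im]] im by simp
  qed
  ultimately show ?thesis
    unfolding sliced_vector_measures_def using vector_measure_mom by blast
qed

lemma vector_integral_mom:
  assumes t: "0 < t" "t \<le> 1" and g: "continuous_on S g"
  shows "vector_integral (pos t) (mom t) g = (\<integral>x. g (t *\<^sub>R x) \<bullet> x \<partial>\<gamma>)"
proof -
  have t': "t \<in> {0..1}" using t by auto
  note P = pos_prob[OF t']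
  have v: "integrable (pos t) (vector_RN_deriv (pos t) (mom t))"
  proof (rule integrable_vector_RN_deriv)
    show "finite_measure (pos t)" using prob_measuresD(1)[OF P] by (simp add: prob_space_def)
    show "vector_measure (pos t) (mom t)"
      using vector_measure_mom[OF t'] by (simp add: vector_measure_def pos_def)
  qed (rule abs_cont_mom[OF t'])
  have gm: "g \<in> borel_measurable (pos t)"
    using g P by (rule continuous_on_borel_measurable_prob_measures)
  have "vector_integral (pos t) (mom t) g = (\<integral>y. g y \<bullet> ((1 / t) *\<^sub>R y) \<partial>pos t)"
    unfolding vector_integral_def
  proof (rule integral_cong_AE)
    show "AE y in pos t. g y \<bullet> vector_RN_deriv (pos t) (mom t) y = g y \<bullet> ((1 / t) *\<^sub>R y)"
      using RN_deriv_mom[OF t] by eventually_elim simp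
    show "(\<lambda>y. g y \<bullet> ((1 / t) *\<^sub>R y)) \<in> borel_measurable (pos t)"
      by (intro continuous_on_borel_measurable_prob_measures[OF _ P] continuous_intros g)
  qed (use gm v in auto)
  also have "\<dots> = (\<integral>x. g (t *\<^sub>R x) \<bullet> ((1 / t) *\<^sub>R t *\<^sub>R x) \<partial>\<gamma>)"
    by (intro integral_pos[OF t'] borel_measurable_continuous_on_restrict continuous_intros g)
  finally show ?thesis using t by simp
qed

text \<open>In label coordinates the sum of both integrands is the time derivative of
  \<open>\<eta> t (t *\<^sub>R x)\<close>. Fubini puts the time integral inside, and the fundamental
  theorem of calculus along each ray leaves the boundary terms.\<close>

lemma continuity_equation_pos_mom: "continuity_equation S pos mom"
  unfolding continuity_equation_def
proof (intro allI impI)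
  fix \<eta> \<eta>t g assume C1: "C1_test S \<eta> \<eta>t g"
  let ?P = "unit_lborel \<Otimes>\<^sub>M \<gamma>" and ?X = "{0..1::real} \<times> S"
  have c\<eta>t: "continuous_on ?X (\<lambda>(t, x). \<eta>t t x)" and cg: "continuous_on ?X (\<lambda>(t, x). g t x)"
    and d\<eta>: "\<And>t x. t \<in> {0..1} \<Longrightarrow> x \<in> S \<Longrightarrow> ((\<lambda>(s, y). \<eta> s y) has_derivative (\<lambda>(s, y). s * \<eta>t t x + g t x \<bullet> y)) (at (t, x) within ?X)"
    using C1 by (auto simp: C1_test_def)
  have c\<eta>: "continuous_on ?X (\<lambda>(t, x). \<eta> t x)"
    unfolding continuous_on_eq_continuous_within
    using has_derivative_continuous[OF d\<eta>] by auto
  define f1 where "f1 = (\<lambda>(t, x). \<eta>t t (t *\<^sub>R x))"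
  define f2 where "f2 = (\<lambda>(t, x). g t (t *\<^sub>R x) \<bullet> x)"
  have cshear: "continuous_on ?X shear" unfolding shear_def by (intro continuous_intros)
  have shearX: "shear ` ?X \<subseteq> ?X" using scale_in_S by (auto simp: shear_def)
  have f1': "f1 = (\<lambda>p. (case shear p of (t, x) \<Rightarrow> \<eta>t t x))" by (auto simp: f1_def shear_def)
  have f2': "f2 = (\<lambda>p. (case shear p of (t, x) \<Rightarrow> g t x) \<bullet> snd p)" by (auto simp: f2_def shear_def)
  have cf1: "continuous_on ?X f1"
    unfolding f1' by (rule continuous_on_compose2[OF c\<eta>t cshear shearX])
  have cf2: "continuous_on ?X f2"
    unfolding f2' by (intro continuous_on_inner continuous_on_compose2[OF cg cshear shearX] continuous_on_snd continuous_on_id)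
  have mX: "(\<lambda>p. p) \<in> measurable ?P (borel_on ?X)"
    using borel_measurable_Pair[OF measurable_fst_snd] by (intro measurable_restrict_space2) (auto simp: space_unit_pair)
  have int: "integrable ?P f" if f: "continuous_on ?X f" for f :: "real \<times> 'a \<Rightarrow> real"
  proof -
    have "bounded (f ` ?X)"
      using compact_S f by (intro compact_imp_bounded compact_continuous_image compact_Times) auto
    then obtain K where "\<And>p. p \<in> ?X \<Longrightarrow> norm (f p) \<le> K" by (auto simp: bounded_iff)
    then show ?thesis
      using measurable_compose[OF mX borel_measurable_continuous_on_restrict[OF f]]
      by (intro integrable_unit_pair[of f K]) auto
  qed
  have fst: "(LINT t:{0..1}|lebesgue. \<integral>x. f (t, x) \<partial>\<gamma>) = (\<integral>p. f p \<partial>?P)"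
    "(\<lambda>t. indicator {0..1} t *\<^sub>R (\<integral>x. f (t, x) \<partial>\<gamma>)) \<in> borel_measurable lebesgue"
    if "continuous_on ?X f" for f :: "real \<times> 'a \<Rightarrow> real"
    using UP.integral_fst'[OF int[OF that]] unit_lborel_lebesgue(1,3)[OF borel_measurable_integrable[OF UP.integrable_fst'[OF int[OF that]]]]
    by auto
  have "(LINT t:{0..1}|lebesgue. \<integral>x. \<eta>t t x \<partial>pos t) = (LINT t:{0..1}|lebesgue. \<integral>x. f1 (t, x) \<partial>\<gamma>)"
    using continuous_on_slice[OF c\<eta>t]
    by (intro set_lebesgue_integral_cong) (auto simp: f1_def integral_pos borel_measurable_continuous_on_restrict)
  \<comment> \<open>\<open>vector_integral_mom\<close> is available for positive times only, so the
    two integrands are compared away from \<open>t = 0\<close>.\<close>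
  moreover have "(LINT t:{0..1}|lebesgue. vector_integral (pos t) (mom t) (g t)) = (LINT t:{0..1}|lebesgue. \<integral>x. f2 (t, x) \<partial>\<gamma>)"
    using continuous_on_slice[OF cg]
    by (intro set_integral_unit_cong_pos fst(2) cf2) (auto simp: f2_def vector_integral_mom)
  ultimately have "(LINT t:{0..1}|lebesgue. \<integral>x. \<eta>t t x \<partial>pos t) + (LINT t:{0..1}|lebesgue. vector_integral (pos t) (mom t) (g t)) =
      (\<integral>p. f1 p + f2 p \<partial>?P)"
    using int[OF cf1] int[OF cf2] by (simp add: fst(1)[OF cf1] fst(1)[OF cf2])
  also have "\<dots> = (\<integral>x. \<integral>t. f1 (t, x) + f2 (t, x) \<partial>unit_lborel \<partial>\<gamma>)"
    using UP.integral_snd[of "\<lambda>t x. f1 (t, x) + f2 (t, x)"] int[OF continuous_on_add[OF cf1 cf2]]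
    by (simp add: split_def)
  also have "\<dots> = (\<integral>x. \<eta> 1 (1 *\<^sub>R x) - \<eta> 0 (0 *\<^sub>R x) \<partial>\<gamma>)"
  proof (rule Bochner_Integration.integral_cong[OF refl])
    fix x assume "x \<in> space \<gamma>"
    then have x: "x \<in> S" by (simp add: space_\<gamma>)
    have c: "continuous_on {0..1} (\<lambda>t. f1 (t, x) + f2 (t, x))"
      using x by (intro continuous_on_add continuous_on_compose2[OF cf1] continuous_on_compose2[OF cf2] continuous_intros) auto
    have "((\<lambda>t. \<eta> t (t *\<^sub>R x)) has_vector_derivative f1 (t, x) + f2 (t, x)) (at t within {0..1})" if t: "0 \<le> t" "t \<le> 1" for t
    proof -
      let ?\<phi> = "\<lambda>s::real. (s, s *\<^sub>R x)"
      \<comment> \<open>Derivatives of \<open>\<eta>\<close> are relative to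
        \<open>[0,1] \<times> S\<close>; the chain rule applies because the ray stays in this
        set.\<close>
      have "?\<phi> ` {0..1} \<subseteq> ?X" using x scale_in_S by auto
      moreover have "((\<lambda>(s, y). \<eta> s y) has_derivative (\<lambda>(s, y). s * \<eta>t t (t *\<^sub>R x) + g t (t *\<^sub>R x) \<bullet> y)) (at (?\<phi> t) within ?X)"
        using t x scale_in_S by (intro d\<eta>) auto
      ultimately have "((\<lambda>(s, y). \<eta> s y) has_derivative (\<lambda>(s, y). s * \<eta>t t (t *\<^sub>R x) + g t (t *\<^sub>R x) \<bullet> y)) (at (?\<phi> t) within ?\<phi> ` {0..1})"
        by (rule has_derivative_subset[rotated])
      moreover have "(?\<phi> has_derivative (\<lambda>h. (h, h *\<^sub>R x))) (at t within {0..1})"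
        by (auto intro!: derivative_eq_intros)
      ultimately have "((\<lambda>s. case ?\<phi> s of (s, y) \<Rightarrow> \<eta> s y) has_derivative
          (\<lambda>h. case (h, h *\<^sub>R x) of (s, y) \<Rightarrow> s * \<eta>t t (t *\<^sub>R x) + g t (t *\<^sub>R x) \<bullet> y)) (at t within {0..1})"
        by (rule has_derivative_in_compose[rotated])
      then show ?thesis
        by (simp add: has_vector_derivative_def f1_def f2_def algebra_simps)
    qed
    from integral_FTC_Icc[OF _ this c]
    show "(\<integral>t. f1 (t, x) + f2 (t, x) \<partial>unit_lborel) = \<eta> 1 (1 *\<^sub>R x) - \<eta> 0 (0 *\<^sub>R x)"
      by (simp add: integral_restrict_space)
  qed
  also have "\<dots> = (\<integral>x. \<eta> 1 (1 *\<^sub>R x) \<partial>\<gamma>) - (\<integral>x. \<eta> 0 (0 *\<^sub>R x) \<partial>\<gamma>)"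
    using continuous_on_slice[OF c\<eta>, of 1] by (simp add: integrable_\<gamma>)
  also have "\<dots> = (\<integral>x. \<eta> 1 x \<partial>pos 1) - (\<integral>x. \<eta> 0 x \<partial>pos 0)"
    using continuous_on_slice[OF c\<eta>] by (simp add: integral_pos borel_measurable_continuous_on_restrict)
  finally show "(LINT t:{0..1}|lebesgue. \<integral>x. \<eta>t t x \<partial>pos t) + (LINT t:{0..1}|lebesgue. vector_integral (pos t) (mom t) (g t)) =
      (\<integral>x. \<eta> 1 x \<partial>pos 1) - (\<integral>x. \<eta> 0 x \<partial>pos 0)" .
qed

lemma pos_0: "pos 0 = return (borel_on S) 0"
proof -
  have "distr \<gamma> (borel_on S) (\<lambda>x. 0) = return (borel_on S) 0"
    using zero_in_S by (intro distr_const) (simp add: space_restrict_space)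
  then show ?thesis by (simp add: pos_def)
qed

lemma pos_1: "pos 1 = \<gamma>"
  using prob_measuresD(2)[OF prob_\<gamma>] by (simp add: pos_def distr_id2)

lemma finite_energy_mom:
  "(\<integral>\<^sup>+t\<in>{0..1}. (\<integral>\<^sup>+x. ennreal (norm (vector_RN_deriv (pos t) (mom t) x) powr r) \<partial>pos t) \<partial>lebesgue) < \<infinity>"
  if "r \<ge> 0"
proof -
  obtain K where K: "\<And>x. x \<in> S \<Longrightarrow> norm x \<le> K"
    using compact_imp_bounded[OF compact_S] by (auto simp: bounded_iff)
  have "(\<integral>\<^sup>+t\<in>{0..1}. (\<integral>\<^sup>+x. ennreal (norm (vector_RN_deriv (pos t) (mom t) x) powr r) \<partial>pos t) \<partial>lebesgue) =
      (\<integral>\<^sup>+x. ennreal (norm x powr r) \<partial>\<gamma>)"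
    by (intro nn_integral_unit_const nn_integral_RN_deriv_mom) auto
  also have "\<dots> \<le> (\<integral>\<^sup>+x. ennreal (K powr r) \<partial>\<gamma>)"
    using K that by (intro nn_integral_mono ennreal_leI powr_mono2) (auto simp: space_\<gamma>)
  also have "\<dots> < \<infinity>" by (simp add: emeasure_space_1)
  finally show ?thesis .
qed

end

section \<open>Equality of the static and the dynamic problem\<close>

lemma flow_endpoint_in_couplings:
  fixes \<mu> :: "'k::finite \<Rightarrow> (real ^ 'd) measure"
  assumes "(\<pi>, m) \<in> flows \<Omega> p \<mu>"
  shows "\<pi> 1 \<in> couplings \<Omega> \<mu>"
  using assms by (auto simp: flows_def couplings_def continuous_map_weak_topology)

lemma static_cost_le_dynamic_cost:
  fixes \<mu> :: "'k::finite \<Rightarrow> (real ^ 'd) measure"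
  assumes \<Omega>: "compact \<Omega>" and zero: "0 \<in> (set_power \<Omega> :: (real ^ 'd ^ 'k) set)"
    and F: "convex_on UNIV (\<lambda>x. L x + \<alpha> / 2 * (norm x)\<^sup>2)"
    and L: "continuous_on (set_power \<Omega>) L"
    and q: "(\<pi>, m) \<in> flows \<Omega> (return (borel_on (set_power \<Omega>)) 0) \<mu>"
  shows "ereal (static_cost L (\<pi> 1)) \<le> dynamic_cost \<alpha> L \<mu> (\<pi>, m)"
proof -
  let ?S = "set_power \<Omega> :: (real ^ 'd ^ 'k) set" and ?F = "\<lambda>x. L x + \<alpha> / 2 * (norm x)\<^sup>2"
  let ?c = "\<alpha> / 2 * (\<Sum>l\<in>UNIV. \<integral>x. (norm x)\<^sup>2 \<partial>\<mu> l)"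
  obtain r where r: "r > 1" "(\<integral>\<^sup>+t\<in>{0..1}. (\<integral>\<^sup>+x. ennreal
        (norm (vector_RN_deriv (\<pi> t) (m t) x) powr r) \<partial>\<pi> t) \<partial>lebesgue) < \<infinity>"
    using q by (auto simp: flows_def)
  have "ereal (\<integral>x. ?F x \<partial>\<pi> 1) \<le> action ?F (\<pi>, m)"
    using q by (intro convex_integral_le_action[OF compact_set_power[OF \<Omega>] zero F _ _ _ r])
      (auto simp: flows_def)
  then have "ereal (static_cost L (\<pi> 1) + ?c) \<le> action ?F (\<pi>, m)"
    using integral_coupling_eq_static_cost[OF \<Omega> flow_endpoint_in_couplings[OF q] L] by simp
  then show ?thesis
    unfolding dynamic_cost_def by (cases "action ?F (\<pi>, m)") auto
qed

lemma induced_flow_of_coupling: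
  fixes \<mu> :: "'k::finite \<Rightarrow> (real ^ 'd) measure"
  assumes \<Omega>: "compact \<Omega>" "convex \<Omega>" and zero: "0 \<in> (set_power \<Omega> :: (real ^ 'd ^ 'k) set)"
    and L: "continuous_on UNIV L" and \<gamma>: "\<gamma> \<in> couplings \<Omega> \<mu>"
  obtains \<pi> m where "induced_flow (set_power \<Omega>) \<gamma> (\<pi>, m)"
    "(\<pi>, m) \<in> flows \<Omega> (return (borel_on (set_power \<Omega>)) 0) \<mu>"
    "dynamic_cost \<alpha> L \<mu> (\<pi>, m) = ereal (static_cost L \<gamma>)" "\<pi> 1 = \<gamma>"
proof -
  interpret dilation_flow "set_power \<Omega> :: (real ^ 'd ^ 'k) set" \<gamma>
    using \<Omega> zero \<gamma> by unfold_locales (auto simp: compact_set_power convex_set_power couplings_def)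
  let ?F = "\<lambda>x. L x + \<alpha> / 2 * (norm x)\<^sup>2"
  show ?thesis
  proof
    show "induced_flow (set_power \<Omega>) \<gamma> (pos, mom)"
      by (auto simp: induced_flow_def pos_def mom_def)
    have "\<exists>r>1. (\<integral>\<^sup>+t\<in>{0..1}. (\<integral>\<^sup>+x. ennreal
        (norm (vector_RN_deriv (pos t) (mom t) x) powr r) \<partial>pos t) \<partial>lebesgue) < \<infinity>"
      \<comment> \<open>Velocities lie in a compact set, so every exponent above 1 has finite
        energy; 2 is an arbitrary choice.\<close>
      by (rule exI[of _ 2]) (use finite_energy_mom[of 2] in auto)
    then show "(pos, mom) \<in> flows \<Omega> (return (borel_on (set_power \<Omega>)) 0) \<mu>"
      using pos_continuous mom_sliced abs_cont_mom continuity_equation_pos_mom pos_0 pos_1 \<gamma>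
      by (auto simp: flows_def couplings_def)
    have "continuous_on UNIV ?F" using L by (intro continuous_intros)
    then have "action ?F (pos, mom) = ereal (\<integral>x. ?F x \<partial>\<gamma>)" by (rule action_pos_mom)
    then show "dynamic_cost \<alpha> L \<mu> (pos, mom) = ereal (static_cost L \<gamma>)"
      using integral_coupling_eq_static_cost[OF \<Omega>(1) \<gamma> continuous_on_subset[OF L subset_UNIV], of \<alpha>]
      by (simp add: dynamic_cost_def)
  qed (rule pos_1)
qed

theorem corollary2p5:
  fixes \<Omega> :: "(real ^ 'd) set"
    and \<mu> :: "'k::finite \<Rightarrow> (real ^ 'd) measure"
    and L :: "real ^ 'd ^ 'k \<Rightarrow> real"
    and \<alpha> :: real
  assumes "compact \<Omega>" and "convex \<Omega>"
    and "\<And>l. \<mu> l \<in> prob_measures \<Omega>"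
    and "0 \<in> (set_power \<Omega> :: (real ^ 'd ^ 'k) set)"
    and "\<alpha> \<ge> 0"
    and "convex_on UNIV (\<lambda>x. L x + \<alpha> * ((norm x)\<^sup>2 / 2))"
  shows "let \<Gamma> = couplings \<Omega> \<mu>;
             \<C> = flows \<Omega> (return (borel_on (set_power \<Omega>)) 0) \<mu>;
             static_min = is_arg_min (static_cost L) (\<lambda>\<gamma>. \<gamma> \<in> \<Gamma>);
             dynamic_min = is_arg_min (dynamic_cost \<alpha> L \<mu>) (\<lambda>q. q \<in> \<C>)
         in (INF \<gamma>\<in>\<Gamma>. ereal (static_cost L \<gamma>)) = (INF q\<in>\<C>. dynamic_cost \<alpha> L \<mu> q) \<and>
            (\<exists>\<gamma>. static_min \<gamma>) \<and>
            (\<exists>q. dynamic_min q) \<and>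
            (\<forall>\<gamma>. static_min \<gamma> \<longrightarrow>
               (\<exists>\<pi> m. induced_flow (set_power \<Omega>) \<gamma> (\<pi>, m) \<and> dynamic_min (\<pi>, m) \<and> \<pi> 1 = \<gamma>)) \<and>
            (\<forall>\<pi> m. dynamic_min (\<pi>, m) \<longrightarrow> static_min (\<pi> 1))"
proof -
  let ?\<Gamma> = "couplings \<Omega> \<mu>" and ?\<C> = "flows \<Omega> (return (borel_on (set_power \<Omega>)) 0) \<mu>"
  let ?static_min = "is_arg_min (static_cost L) (\<lambda>\<gamma>. \<gamma> \<in> ?\<Gamma>)"
  let ?dynamic_min = "is_arg_min (dynamic_cost \<alpha> L \<mu>) (\<lambda>q. q \<in> ?\<C>)"
  have F: "convex_on UNIV (\<lambda>x. L x + \<alpha> / 2 * (norm x)\<^sup>2)" using assms(6) by simp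
  have L: "continuous_on UNIV L"
  proof -
    have "continuous_on UNIV (\<lambda>x. L x + \<alpha> / 2 * (norm x)\<^sup>2)"
      using F by (intro convex_on_continuous) auto
    moreover have "continuous_on UNIV (\<lambda>x :: real ^ 'd ^ 'k. \<alpha> / 2 * (norm x)\<^sup>2)"
      by (intro continuous_intros)
    ultimately have "continuous_on UNIV (\<lambda>x. (L x + \<alpha> / 2 * (norm x)\<^sup>2) - \<alpha> / 2 * (norm x)\<^sup>2)"
      by (rule continuous_on_diff)
    then show ?thesis by simp
  qed
  have LS: "continuous_on (set_power \<Omega>) L" by (rule continuous_on_subset[OF L]) simp
  \<comment> \<open>All claims follow from a sandwich: a flow costs at least as much as its endpoint
    coupling (\<open>ge\<close>), and every coupling is the endpoint of a flow of exactly the same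
    cost (\<open>ex\<close>).\<close>
  have ge: "ereal (static_cost L (\<pi> 1)) \<le> dynamic_cost \<alpha> L \<mu> (\<pi>, m)" if "(\<pi>, m) \<in> ?\<C>" for \<pi> m
    by (rule static_cost_le_dynamic_cost[OF assms(1,4) F LS that])
  have ex: "\<exists>\<pi> m. induced_flow (set_power \<Omega>) \<gamma> (\<pi>, m) \<and> (\<pi>, m) \<in> ?\<C> \<and>
      dynamic_cost \<alpha> L \<mu> (\<pi>, m) = ereal (static_cost L \<gamma>) \<and> \<pi> 1 = \<gamma>" if "\<gamma> \<in> ?\<Gamma>" for \<gamma>
    by (rule induced_flow_of_coupling[OF assms(1,2,4) L that, of \<alpha>]) blast
  obtain \<gamma>0 where \<gamma>0: "\<gamma>0 \<in> ?\<Gamma>" "\<And>\<gamma>. \<gamma> \<in> ?\<Gamma> \<Longrightarrow> static_cost L \<gamma>0 \<le> static_cost L \<gamma>"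
    using static_minimizer_exists[of \<Omega> \<mu>, OF assms(1,3) LS] by blast
  have smin0: "?static_min \<gamma>0" using \<gamma>0 by (auto simp: is_arg_min_def not_less)
  have one: "\<exists>\<pi> m. induced_flow (set_power \<Omega>) \<gamma> (\<pi>, m) \<and> ?dynamic_min (\<pi>, m) \<and> \<pi> 1 = \<gamma>"
    if "?static_min \<gamma>" for \<gamma>
  proof -
    have \<gamma>: "\<gamma> \<in> ?\<Gamma>" "\<And>\<gamma>'. \<gamma>' \<in> ?\<Gamma> \<Longrightarrow> static_cost L \<gamma> \<le> static_cost L \<gamma>'"
      using that by (auto simp: is_arg_min_def not_less)
    obtain \<pi> m where q: "induced_flow (set_power \<Omega>) \<gamma> (\<pi>, m)" "(\<pi>, m) \<in> ?\<C>"
      "dynamic_cost \<alpha> L \<mu> (\<pi>, m) = ereal (static_cost L \<gamma>)" "\<pi> 1 = \<gamma>"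
      using ex[OF \<gamma>(1)] by blast
    have "dynamic_cost \<alpha> L \<mu> (\<pi>, m) \<le> dynamic_cost \<alpha> L \<mu> q'" if "q' \<in> ?\<C>" for q'
    proof -
      obtain \<pi>' m' where q': "q' = (\<pi>', m')" by (cases q')
      have "ereal (static_cost L \<gamma>) \<le> ereal (static_cost L (\<pi>' 1))"
        using \<gamma>(2)[OF flow_endpoint_in_couplings] that q' by simp
      also have "\<dots> \<le> dynamic_cost \<alpha> L \<mu> q'" using ge that q' by simp
      finally show ?thesis by (simp add: q(3))
    qed
    then have "?dynamic_min (\<pi>, m)" using q(2) by (auto simp: is_arg_min_def not_less)
    with q show ?thesis by blast
  qed
  have two: "?static_min (\<pi> 1)" if "?dynamic_min (\<pi>, m)" for \<pi> m
  proof -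
    have q: "(\<pi>, m) \<in> ?\<C>" "\<And>q'. q' \<in> ?\<C> \<Longrightarrow> dynamic_cost \<alpha> L \<mu> (\<pi>, m) \<le> dynamic_cost \<alpha> L \<mu> q'"
      using that by (auto simp: is_arg_min_def not_less)
    have "static_cost L (\<pi> 1) \<le> static_cost L \<gamma>" if \<gamma>: "\<gamma> \<in> ?\<Gamma>" for \<gamma>
    proof -
      obtain \<pi>' m' where q': "(\<pi>', m') \<in> ?\<C>" "dynamic_cost \<alpha> L \<mu> (\<pi>', m') = ereal (static_cost L \<gamma>)"
        using ex[OF \<gamma>] by blast
      have "ereal (static_cost L (\<pi> 1)) \<le> dynamic_cost \<alpha> L \<mu> (\<pi>, m)" by (rule ge[OF q(1)])
      also have "\<dots> \<le> ereal (static_cost L \<gamma>)" using q(2)[OF q'(1)] q'(2) by simp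
      finally show ?thesis by simp
    qed
    with flow_endpoint_in_couplings[OF q(1)] show ?thesis by (auto simp: is_arg_min_def not_less)
  qed
  have "(INF \<gamma>\<in>?\<Gamma>. ereal (static_cost L \<gamma>)) = (INF q\<in>?\<C>. dynamic_cost \<alpha> L \<mu> q)"
  proof (rule antisym)
    show "(INF \<gamma>\<in>?\<Gamma>. ereal (static_cost L \<gamma>)) \<le> (INF q\<in>?\<C>. dynamic_cost \<alpha> L \<mu> q)"
    proof (rule INF_greatest)
      fix q assume q: "q \<in> ?\<C>"
      obtain \<pi> m where "q = (\<pi>, m)" by (cases q)
      with q show "(INF \<gamma>\<in>?\<Gamma>. ereal (static_cost L \<gamma>)) \<le> dynamic_cost \<alpha> L \<mu> q"
        using ge[of \<pi> m] flow_endpoint_in_couplings[of \<pi> m] by (auto intro: INF_lower2)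
    qed
    show "(INF q\<in>?\<C>. dynamic_cost \<alpha> L \<mu> q) \<le> (INF \<gamma>\<in>?\<Gamma>. ereal (static_cost L \<gamma>))"
    proof (rule INF_greatest)
      fix \<gamma> assume "\<gamma> \<in> ?\<Gamma>"
      then show "(INF q\<in>?\<C>. dynamic_cost \<alpha> L \<mu> q) \<le> ereal (static_cost L \<gamma>)"
        using ex by (metis INF_lower)
    qed
  qed
  moreover have "\<exists>q. ?dynamic_min q" using one[OF smin0] by blast
  ultimately show ?thesis
    unfolding Let_def using smin0 one two by blast
qed

end
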